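(* Consider the node, i.e. the planar ICIS germ $xy\in k[[x,y]]$. Then: (a) For every integer $m\ge1$, $\mathrm{AD}^m_{(1)}(xy)=m(m-1)$; so in a general $1$-parameter deformation of a node, the number of $m^{\mathrm{th}}$-order weight-$1$ inflection points limiting to the node is $m(m-1)$. (b) $\mathrm{AD}^m_{(2)}(xy)=\binom{m+1}{4}$ for every integer $m\ge2$, and $\mathrm{AD}^m_{(1,1)}(xy)=\binom{m+2}{4}$ for every integer $m\ge1$.
   Context: $k$ is an algebraically closed field of characteristic $0$. An ICIS germ is $f=(f_1,\dots,f_{N-1})\colon(k^N,0)\to(k^{N-1},0)$, $N\ge2$, $f_i\in k[[x_1,\dots,x_N]]$, such that $A=k[[x_1,\dots,x_N]]/(f_1,\dots,f_{N-1})$ is a one-dimensional complete intersection with an isolated singularity; it is planar if $N=2$. Deformations: let $\delta_1,\dots,\delta_d\in k[[x_1,\dots,x_N]]^{N-1}$ represent a $k$-basis of $\mathrm{Def}^1(f)=\mathrm{Ext}^1_A(\Omega^1_{A/k},A)$ (a quotient of $A^{N-1}$). A $1$-parameter deformation $X/B$ of $f$, given by $(a_i)\in k^d$, has $\mathscr O_B=k[[t]]$, $\mathscr O_X=k[[x_1,\dots,x_N]][[t]]/(f+t\sum_i a_i\delta_i)$; $X_0$ is the fiber $t=0$, with ideal $I_{X_0}=(t)\subset\mathscr O_X$. Principal parts: $\mathscr P^m_{X/B}=(\mathscr O_X\widehat\otimes_{\mathscr O_B}\mathscr O_X)/I_\Delta^m$, $I_\Delta$ the ideal of the diagonal, regarded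 as an $\mathscr O_X$-module via the left factor. For a general deformation its dual is free of rank $m$; let $e_1,\dots,e_m$ be a basis of $(\mathscr P^m_{X/B})^\vee$. For a list $\overline\tau=(\tau_1,\dots,\tau_n)$ of elements of $\mathscr P^m_{X/B}$, let $I^m_{\overline\tau}\subset\mathscr O_X$ be the ideal of maximal minors of the $m\times n$ matrix $(e_i(\tau_j))$. Automatic degeneracies: $\mathrm{AD}^m_{(1)}(f)=\min_{X/B}\min_{\overline\tau}\dim_k\mathscr O_X/(I_{X_0}+I^m_{\overline\tau})$ with $n=m$; $\mathrm{AD}^m_{(2)}(f)=\min_{X/B}\min_{\overline\tau}\dim_k\mathscr O_X/I^m_{\overline\tau}$ with $n=m-1$ (here $m\ge2$); $\mathrm{AD}^m_{(1,1)}(f)=\min_{X/B}\min_{\overline\tau}\dim_k\mathscr O_X/I^m_{\overline\tau}$ with $n=m+1$. The minima are over $1$-parameter deformations $X/B$ of $f$ (with $(\mathscr P^m_{X/B})^\vee$ free of rank $m$) and lists $\overline\tau$ of $n$ elements of $\mathscr P^m_{X/B}$; if finite, they are attained for general $X/B$ and $\overline\tau$ ("general" meaning in a suitable dense Zariski-open subset of the parameters, respectively of the lists modulo a sufficiently high power of the maximal ideal). Number of limiting weight-$1$ inflection points: for a general $1$-parameter deformation $X/B$ and a list $\overline\tau$ of $m$ elements attaining the minimum defining $\mathrm{AD}^m_{(1)}(f)$, the number of $m^{\mathrm{th}}$-order weight-$1$ inflection points limiting to the singularity in a general $1$-parameter deformation is $\dim_{K}\big((\mathscr O_X/I^m_{\overline\tau})\otimes_{k[[t]]}K\big)$,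 where $K$ is an algebraic closure of $k((t))$. *)

theory Defs
  imports
    "HOL-Algebra.Algebraic_Closure_Type"
    "HOL-Algebra.Ideal_Product"
    "HOL-Algebra.QuotRing"
    "HOL-Algebra.Module"
    "HOL-Combinatorics.Permutations"
    "HOL-Library.Extended_Nat"
    "HOL-Library.FuncSet"
begin

section \<open>Commutative algebra over HOL-Algebra records\<close>

abbreviation type_ring :: "'a::comm_ring_1 ring"
  where "type_ring \<equiv> ring_of_type_algebra"

text \<open>
  The record type of modules extends that of rings, so that every module carries a
  multiplication and a unit; these two fields play no role below and are left undefined
  wherever there is no natural choice.
\<close>

definition alg_module :: "('a \<Rightarrow> 'b) \<Rightarrow> 'b ring \<Rightarrow> ('a, 'b) module"
  where "alg_module h E =
    \<lparr>carrier = carrier E, monoid.mult = monoid.mult E, one = monoid.one E,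
     zero = ring.zero E, add = ring.add E, module.smult = (\<lambda>a x. h a \<otimes>\<^bsub>E\<^esub> x)\<rparr>"

definition free_basis ::
    "'a ring \<Rightarrow> ('a, 'b) module \<Rightarrow> nat \<Rightarrow> (nat \<Rightarrow> 'b) \<Rightarrow> bool"
  where "free_basis R M m e \<longleftrightarrow>
    (\<forall>i<m. e i \<in> carrier M) \<and>
    (\<forall>x\<in>carrier M. \<exists>!c. c \<in> {..<m} \<rightarrow>\<^sub>E carrier R \<and>
        x = (\<Oplus>\<^bsub>M\<^esub>i\<in>{..<m}. c i \<odot>\<^bsub>M\<^esub> e i))"

text \<open>
  Dimension of a vector space \<open>M\<close> over a field \<open>K\<close>: the size of a finite basis, and \<open>\<infinity>\<close> if
  there is none (the infimum of the empty set).
\<close>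

definition vdim :: "'a ring \<Rightarrow> ('a, 'b) module \<Rightarrow> enat"
  where "vdim K M = Inf {enat n |n. \<exists>e. free_basis K M n e}"

definition dual_module :: "'a ring \<Rightarrow> ('a, 'b) module \<Rightarrow> ('a, 'b \<Rightarrow> 'a) module"
  where "dual_module R M =
    \<lparr>carrier = {\<phi> \<in> carrier M \<rightarrow>\<^sub>E carrier R.
        (\<forall>x\<in>carrier M. \<forall>y\<in>carrier M. \<phi> (x \<oplus>\<^bsub>M\<^esub> y) = \<phi> x \<oplus>\<^bsub>R\<^esub> \<phi> y) \<and>
        (\<forall>a\<in>carrier R. \<forall>x\<in>carrier M. \<phi> (a \<odot>\<^bsub>M\<^esub> x) = a \<otimes>\<^bsub>R\<^esub> \<phi> x)},
     monoid.mult = undefined, one = undefined,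
     zero = (\<lambda>x\<in>carrier M. \<zero>\<^bsub>R\<^esub>),
     add = (\<lambda>\<phi> \<psi>. \<lambda>x\<in>carrier M. \<phi> x \<oplus>\<^bsub>R\<^esub> \<psi> x),
     module.smult = (\<lambda>a \<phi>. \<lambda>x\<in>carrier M. a \<otimes>\<^bsub>R\<^esub> \<phi> x)\<rparr>"

definition quot_module :: "('a, 'b) module \<Rightarrow> 'b set \<Rightarrow> ('a, 'b set) module"
  where "quot_module M N =
    \<lparr>carrier = a_rcosets\<^bsub>M\<^esub> N, monoid.mult = undefined, one = undefined,
     zero = N, add = set_add M,
     module.smult = (\<lambda>a C. set_add M N ((\<lambda>x. a \<odot>\<^bsub>M\<^esub> x) ` C))\<rparr>"

definition free_module :: "'b set \<Rightarrow> ('c::comm_ring_1, 'b \<Rightarrow> 'c) module"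
  where "free_module B =
    \<lparr>carrier = {\<phi>. finite {b. \<phi> b \<noteq> 0} \<and> {b. \<phi> b \<noteq> 0} \<subseteq> B},
     monoid.mult = undefined, one = undefined,
     zero = (\<lambda>b. 0), add = (\<lambda>\<phi> \<psi> b. \<phi> b + \<psi> b), module.smult = (\<lambda>c \<phi> b. c * \<phi> b)\<rparr>"

definition single :: "'b \<Rightarrow> 'b \<Rightarrow> 'c::comm_ring_1"
  where "single x = (\<lambda>z. if z = x then 1 else 0)"

text \<open>
  The tensor product of an \<open>'a\<close>-module \<open>M\<close> with the \<open>'a\<close>-algebra given by \<open>h\<close>, by generators and
  relations: the symbol \<open>single x\<close> stands for the tensor of \<open>x\<close> and \<open>1\<close>.
\<close>

definition tensor_relations :: "('a \<Rightarrow> 'c::comm_ring_1) \<Rightarrow> ('a, 'b) module \<Rightarrow> ('b \<Rightarrow> 'c) set"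
  where "tensor_relations h M =
    {(\<lambda>z. single (x \<oplus>\<^bsub>M\<^esub> y) z - single x z - single y z) |x y.
        x \<in> carrier M \<and> y \<in> carrier M} \<union>
    {(\<lambda>z. single (a \<odot>\<^bsub>M\<^esub> x) z - h a * single x z) |a x. x \<in> carrier M}"

definition base_change ::
    "('a::comm_ring_1 \<Rightarrow> 'c::comm_ring_1) \<Rightarrow> ('a, 'b) module \<Rightarrow> ('c, ('b \<Rightarrow> 'c) set) module"
  where "base_change h M = quot_module (free_module (carrier M))
    (\<Inter>{N. submodule N (type_ring :: 'c ring) (free_module (carrier M)) \<and>
          tensor_relations h M \<subseteq> N})"

primrec ideal_power :: "'a ring \<Rightarrow> 'a set \<Rightarrow> nat \<Rightarrow> 'a set"
  where
    "ideal_power R I 0 = carrier R"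
  | "ideal_power R I (Suc n) = ideal_prod R (ideal_power R I n) I"

definition ring_det :: "'a ring \<Rightarrow> nat \<Rightarrow> (nat \<Rightarrow> nat \<Rightarrow> 'a) \<Rightarrow> 'a"
  where "ring_det R r A = (\<Oplus>\<^bsub>R\<^esub>p\<in>{p. p permutes {..<r}}.
    (let c = (\<Otimes>\<^bsub>R\<^esub>i\<in>{..<r}. A i (p i)) in if evenperm p then c else \<ominus>\<^bsub>R\<^esub> c))"

definition maximal_minors :: "'a ring \<Rightarrow> nat \<Rightarrow> nat \<Rightarrow> (nat \<Rightarrow> nat \<Rightarrow> 'a) \<Rightarrow> 'a set"
  where "maximal_minors R m n A =
    {ring_det R (min m n) (\<lambda>i j. A (\<rho> i) (\<sigma> j)) |\<rho> \<sigma>.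
      strict_mono_on {..<min m n} \<rho> \<and> \<rho> ` {..<min m n} \<subseteq> {..<m} \<and>
      strict_mono_on {..<min m n} \<sigma> \<and> \<sigma> ` {..<min m n} \<subseteq> {..<n}}"


section \<open>Planar germs and their one-parameter deformations\<close>

text \<open>
  The ring \<open>k[[x,y]]\<close> is \<open>'k fps fps\<close> with \<open>x\<close> the inner variable, and \<open>k[[x,y]][[t]]\<close> is
  \<open>'k fps fps fps\<close> with \<open>t\<close> the outermost variable.
\<close>

definition coeff_map :: "('a \<Rightarrow> 'b) \<Rightarrow> 'a fps \<Rightarrow> 'b fps"
  where "coeff_map h g = Abs_fps (\<lambda>n. h (fps_nth g n))"

definition const2 :: "'a::zero \<Rightarrow> 'a fps fps"
  where "const2 c = fps_const (fps_const c)"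

definition germ_x :: "'k::field fps fps"
  where "germ_x = fps_const fps_X"

definition germ_y :: "'k::field fps fps"
  where "germ_y = fps_X"

definition node :: "'k::field fps fps"
  where "node = germ_x * germ_y"

definition deriv_x :: "'k::field fps fps \<Rightarrow> 'k fps fps"
  where "deriv_x f = coeff_map fps_deriv f"

definition deriv_y :: "'k::field fps fps \<Rightarrow> 'k fps fps"
  where "deriv_y f = fps_deriv f"

text \<open>
  For a planar germ with \<open>A = k[[x,y]]/(f)\<close>, the conormal sequence resolves \<open>\<Omega>\<^sub>A\<close> by
  \<open>0 \<rightarrow> A \<rightarrow> A\<^sup>2 \<rightarrow> \<Omega>\<^sub>A \<rightarrow> 0\<close> with first map \<open>(f\<^sub>x, f\<^sub>y)\<close>, and so \<open>Def\<^sup>1(f) = Ext\<^sup>1(\<Omega>\<^sub>A, A)\<close> is the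
  quotient \<open>A/(f\<^sub>x, f\<^sub>y)\<close>.
\<close>

definition Def1_ideal :: "'k::field fps fps \<Rightarrow> 'k fps fps set"
  where "Def1_ideal f = genideal type_ring {f, deriv_x f, deriv_y f}"

definition Def1 :: "'k::field fps fps \<Rightarrow> ('k, 'k fps fps set) module"
  where "Def1 f = alg_module (\<lambda>c. Def1_ideal f +>\<^bsub>type_ring\<^esub> const2 c)
    (type_ring Quot Def1_ideal f)"

definition represents_Def1_basis ::
    "'k::field fps fps \<Rightarrow> nat \<Rightarrow> (nat \<Rightarrow> 'k fps fps) \<Rightarrow> bool"
  where "represents_Def1_basis f d \<delta> \<longleftrightarrow>
    free_basis type_ring (Def1 f) d (\<lambda>i. Def1_ideal f +>\<^bsub>type_ring\<^esub> \<delta> i)"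

definition affine_space :: "nat \<Rightarrow> (nat \<Rightarrow> 'k) set"
  where "affine_space d = {..<d} \<rightarrow>\<^sub>E UNIV"

definition deformation ::
    "'k::field fps fps \<Rightarrow> nat \<Rightarrow> (nat \<Rightarrow> 'k fps fps) \<Rightarrow> (nat \<Rightarrow> 'k) \<Rightarrow> 'k fps fps fps"
  where "deformation f d \<delta> a = fps_const f + fps_X * fps_const (\<Sum>i<d. const2 (a i) * \<delta> i)"

text \<open>
  A deformation \<open>X/B\<close> enters the following definitions through its equation \<open>F \<in> k[[x,y]][[t]]\<close>.
\<close>

definition OX :: "'k::field fps fps fps \<Rightarrow> 'k fps fps fps set ring"
  where "OX F = type_ring Quot (PIdl\<^bsub>type_ring\<^esub> F)"

definition OX_class :: "'k::field fps fps fps \<Rightarrow> 'k fps fps fps \<Rightarrow> 'k fps fps fps set"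
  where "OX_class F g = PIdl\<^bsub>type_ring\<^esub> F +>\<^bsub>type_ring\<^esub> g"

definition special_fiber_ideal :: "'k::field fps fps fps \<Rightarrow> 'k fps fps fps set set"
  where "special_fiber_ideal F = PIdl\<^bsub>OX F\<^esub> (OX_class F fps_X)"

definition dim_k_quot :: "'k::field fps fps fps \<Rightarrow> 'k fps fps fps set set \<Rightarrow> enat"
  where "dim_k_quot F J = vdim (type_ring :: 'k ring)
    (alg_module (\<lambda>c. J +>\<^bsub>OX F\<^esub> OX_class F (fps_const (const2 c))) (OX F Quot J))"

text \<open>
  The \<open>k[[t]]\<close>-module \<open>\<O>\<^sub>X/J\<close>, and its dimension after base change to an algebraic closure
  of \<open>k((t))\<close>.
\<close>

definition quot_kt_module ::
    "'k::field fps fps fps \<Rightarrow> 'k fps fps fps set set \<Rightarrow> ('k fps, 'k fps fps fps set set) module"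
  where "quot_kt_module F J =
    alg_module (\<lambda>g. J +>\<^bsub>OX F\<^esub> OX_class F (coeff_map const2 g)) (OX F Quot J)"

definition dim_generic_fiber :: "'k::field fps fps fps \<Rightarrow> 'k fps fps fps set set \<Rightarrow> enat"
  where "dim_generic_fiber F J = vdim (type_ring :: 'k fls alg_closure ring)
    (base_change (\<lambda>g. to_ac (fps_to_fls g)) (quot_kt_module F J))"



section \<open>Principal parts\<close>

text \<open>
  The ring \<open>k[[x\<^sub>1,y\<^sub>1,x\<^sub>2,y\<^sub>2]][[t]]\<close> is \<open>'k fps fps fps fps fps\<close>, built from the inside out as
  \<open>k[[x\<^sub>1,y\<^sub>1]]\<close>, then \<open>[[x\<^sub>2,y\<^sub>2]]\<close>, then \<open>[[t]]\<close>.  The two embeddings of \<open>k[[x,y]][[t]]\<close> replace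
  \<open>(x,y)\<close> by \<open>(x\<^sub>1,y\<^sub>1)\<close> and by \<open>(x\<^sub>2,y\<^sub>2)\<close>.  The completed tensor product of \<open>\<O>\<^sub>X\<close> with itself
  over \<open>k[[t]]\<close> is the quotient by \<open>F(x\<^sub>1,y\<^sub>1,t)\<close> and \<open>F(x\<^sub>2,y\<^sub>2,t)\<close>.
\<close>

definition left_factor :: "'k::field fps fps fps \<Rightarrow> 'k fps fps fps fps fps"
  where "left_factor = coeff_map const2"

definition right_factor :: "'k::field fps fps fps \<Rightarrow> 'k fps fps fps fps fps"
  where "right_factor = coeff_map (coeff_map (coeff_map const2))"

definition OXX_ideal :: "'k::field fps fps fps \<Rightarrow> 'k fps fps fps fps fps set"
  where "OXX_ideal F = genideal type_ring {left_factor F, right_factor F}"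

definition OXX :: "'k::field fps fps fps \<Rightarrow> 'k fps fps fps fps fps set ring"
  where "OXX F = type_ring Quot OXX_ideal F"

definition OXX_class ::
    "'k::field fps fps fps \<Rightarrow> 'k fps fps fps fps fps \<Rightarrow> 'k fps fps fps fps fps set"
  where "OXX_class F s = OXX_ideal F +>\<^bsub>type_ring\<^esub> s"

definition diagonal_ideal :: "'k::field fps fps fps \<Rightarrow> 'k fps fps fps fps fps set set"
  where "diagonal_ideal F =
    genideal (OXX F) (range (\<lambda>g. OXX_class F (left_factor g - right_factor g)))"

definition PP_ring :: "nat \<Rightarrow> 'k::field fps fps fps \<Rightarrow> 'k fps fps fps fps fps set set ring"
  where "PP_ring m F = OXX F Quot (ideal_power (OXX F) (diagonal_ideal F) m)"

definition PP_class ::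
    "nat \<Rightarrow> 'k::field fps fps fps \<Rightarrow> 'k fps fps fps fps fps \<Rightarrow> 'k fps fps fps fps fps set set"
  where "PP_class m F s =
    ideal_power (OXX F) (diagonal_ideal F) m +>\<^bsub>OXX F\<^esub> OXX_class F s"

text \<open>
  As in the library's first isomorphism theorem, \<open>the_elem (h ` C)\<close> is the value on the
  coset \<open>C\<close> of the map induced by \<open>h\<close> on the quotient.
\<close>

definition PP ::
    "nat \<Rightarrow> 'k::field fps fps fps \<Rightarrow> ('k fps fps fps set, 'k fps fps fps fps fps set set) module"
  where "PP m F =
    alg_module (\<lambda>C. the_elem ((\<lambda>r. PP_class m F (left_factor r)) ` C)) (PP_ring m F)"

definition PP_dual_basis ::
    "nat \<Rightarrow> 'k::field fps fps fps \<Rightarrow>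
      (nat \<Rightarrow> 'k fps fps fps fps fps set set \<Rightarrow> 'k fps fps fps set) \<Rightarrow> bool"
  where "PP_dual_basis m F e \<longleftrightarrow> free_basis (OX F) (dual_module (OX F) (PP m F)) m e"

definition degeneracy_ideal ::
    "nat \<Rightarrow> nat \<Rightarrow> 'k::field fps fps fps \<Rightarrow>
      (nat \<Rightarrow> 'k fps fps fps fps fps set set \<Rightarrow> 'k fps fps fps set) \<Rightarrow>
      (nat \<Rightarrow> 'k fps fps fps fps fps set set) \<Rightarrow> 'k fps fps fps set set"
  where "degeneracy_ideal m n F e \<tau> =
    genideal (OX F) (maximal_minors (OX F) m n (\<lambda>i j. e i (\<tau> j)))"


section \<open>Automatic degeneracies\<close>

text \<open>
  \<open>\<delta> 0, \<dots>, \<delta> (d - 1)\<close> are the chosen representatives of a basis of \<open>Def\<^sup>1(f)\<close>.  The ideal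
  \<open>degeneracy_ideal m n F e \<tau>\<close> does not depend on the basis \<open>e\<close>, so letting the infima range
  over \<open>e\<close> as well does not change them.
\<close>

definition admissible ::
    "'k::field fps fps \<Rightarrow> nat \<Rightarrow> (nat \<Rightarrow> 'k fps fps) \<Rightarrow> nat \<Rightarrow> nat \<Rightarrow>
      (nat \<Rightarrow> 'k) \<Rightarrow> (nat \<Rightarrow> 'k fps fps fps fps fps set set \<Rightarrow> 'k fps fps fps set) \<Rightarrow>
      (nat \<Rightarrow> 'k fps fps fps fps fps set set) \<Rightarrow> bool"
  where "admissible f d \<delta> m n a e \<tau> \<longleftrightarrow>
    a \<in> affine_space d \<and>
    PP_dual_basis m (deformation f d \<delta> a) e \<and>
    (\<forall>j<n. \<tau> j \<in> carrier (PP m (deformation f d \<delta> a)))"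

definition dim_1 ::
    "'k::field fps fps \<Rightarrow> nat \<Rightarrow> (nat \<Rightarrow> 'k fps fps) \<Rightarrow> nat \<Rightarrow>
      (nat \<Rightarrow> 'k) \<Rightarrow> (nat \<Rightarrow> 'k fps fps fps fps fps set set \<Rightarrow> 'k fps fps fps set) \<Rightarrow>
      (nat \<Rightarrow> 'k fps fps fps fps fps set set) \<Rightarrow> enat"
  where "dim_1 f d \<delta> m a e \<tau> = (let F = deformation f d \<delta> a in
    dim_k_quot F (set_add (OX F) (special_fiber_ideal F) (degeneracy_ideal m m F e \<tau>)))"

definition AD_1 :: "'k::field fps fps \<Rightarrow> nat \<Rightarrow> (nat \<Rightarrow> 'k fps fps) \<Rightarrow> nat \<Rightarrow> enat"
  where "AD_1 f d \<delta> m = Inf {dim_1 f d \<delta> m a e \<tau> |a e \<tau>. admissible f d \<delta> m m a e \<tau>}"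

definition AD_2 :: "'k::field fps fps \<Rightarrow> nat \<Rightarrow> (nat \<Rightarrow> 'k fps fps) \<Rightarrow> nat \<Rightarrow> enat"
  where "AD_2 f d \<delta> m =
    Inf {let F = deformation f d \<delta> a in dim_k_quot F (degeneracy_ideal m (m - 1) F e \<tau>) |a e \<tau>.
      admissible f d \<delta> m (m - 1) a e \<tau>}"

definition AD_11 :: "'k::field fps fps \<Rightarrow> nat \<Rightarrow> (nat \<Rightarrow> 'k fps fps) \<Rightarrow> nat \<Rightarrow> enat"
  where "AD_11 f d \<delta> m =
    Inf {let F = deformation f d \<delta> a in dim_k_quot F (degeneracy_ideal m (m + 1) F e \<tau>) |a e \<tau>.
      admissible f d \<delta> m (m + 1) a e \<tau>}"


section \<open>General deformations and limiting inflection points\<close>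

inductive_set poly_functions :: "nat \<Rightarrow> ((nat \<Rightarrow> 'k::field) \<Rightarrow> 'k) set" for d
  where
    const: "(\<lambda>a. c) \<in> poly_functions d"
  | coord: "i < d \<Longrightarrow> (\<lambda>a. a i) \<in> poly_functions d"
  | add: "p \<in> poly_functions d \<Longrightarrow> q \<in> poly_functions d \<Longrightarrow> (\<lambda>a. p a + q a) \<in> poly_functions d"
  | mult: "p \<in> poly_functions d \<Longrightarrow> q \<in> poly_functions d \<Longrightarrow> (\<lambda>a. p a * q a) \<in> poly_functions d"

definition zariski_open :: "nat \<Rightarrow> (nat \<Rightarrow> 'k::field) set \<Rightarrow> bool"
  where "zariski_open d U \<longleftrightarrow>
    (\<exists>S\<subseteq>poly_functions d. U = {a \<in> affine_space d. \<exists>p\<in>S. p a \<noteq> 0})"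

definition dense_zariski_open :: "nat \<Rightarrow> (nat \<Rightarrow> 'k::field) set \<Rightarrow> bool"
  where "dense_zariski_open d U \<longleftrightarrow>
    zariski_open d U \<and> (\<forall>V. zariski_open d V \<and> V \<noteq> {} \<longrightarrow> U \<inter> V \<noteq> {})"

text \<open>
  \<open>N\<close> is the number of \<open>m\<close>-th order weight-1 inflection points limiting to the singularity in a
  general deformation: for all \<open>a\<close> in some dense open set, the minimum \<open>AD_1\<close> is attained on the
  deformation given by \<open>a\<close>, and every list attaining it gives generic fiber dimension \<open>N\<close>.
\<close>

definition limiting_inflection_number ::
    "'k::field fps fps \<Rightarrow> nat \<Rightarrow> (nat \<Rightarrow> 'k fps fps) \<Rightarrow> nat \<Rightarrow> enat \<Rightarrow> bool"
  where "limiting_inflection_number f d \<delta> m N \<longleftrightarrow>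
    (\<exists>U. dense_zariski_open d U \<and> (\<forall>a\<in>U.
      (\<exists>e \<tau>. admissible f d \<delta> m m a e \<tau> \<and> dim_1 f d \<delta> m a e \<tau> = AD_1 f d \<delta> m) \<and>
      (\<forall>e \<tau>. admissible f d \<delta> m m a e \<tau> \<and> dim_1 f d \<delta> m a e \<tau> = AD_1 f d \<delta> m \<longrightarrow>
        (let F = deformation f d \<delta> a in
          dim_generic_fiber F (degeneracy_ideal m m F e \<tau>) = N))))"

end

theory Submission
  imports Defs
begin

text \<open>
  \<open>Def\<^sup>1\<close> of the node is spanned by a unit, so a deformation is \<open>xy + tu\<close> with \<open>u\<close> zero or a unit.  If
  \<open>u = 0\<close> the dual of the principal parts is not free for \<open>m \<ge> 2\<close>.  If \<open>u\<close> is a unit, the total space is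
  \<open>k[[x,y]]\<close> with \<open>t = X y\<close>, \<open>X = - x / u\<close>, and the derivation \<open>\<theta>\<close> with \<open>\<theta> X = X\<close>, \<open>\<theta> y = - y\<close> kills \<open>t\<close>.
  The operators \<open>e\<^sub>i = binom(\<theta> + m - 1 - i, m - 1)\<close>, \<open>i < m\<close>, form a basis of the dual of the
  principal parts, and the values of \<open>e\<^sub>i\<close> fill exactly the ideal \<open>(x\<^sup>i, y\<^sup>m\<^sup>-\<^sup>i)\<close>.

  Expanding an \<open>r\<close>-minor with \<open>r\<close> distinct rows, every term thus lies in the monomial ideal generated by
  the \<open>x\<^bsup>p(p+1)/2\<^esup> y\<^bsup>q(q+1)/2\<^esup>\<close> with \<open>p + q = r - 1\<close>, whose colength is \<open>binom(r + 2, 4)\<close>; modulo \<open>xy\<close>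
  a single such determinant has colength at least \<open>m(m - 1)\<close>.  Elements of the principal parts dual to
  the \<open>e\<^sub>i\<close> up to powers of \<open>X\<close> and \<open>y\<close> attain these bounds.  Finally the determinant of an optimal
  square matrix is a nonzerodivisor modulo \<open>t\<close>, so its quotient is free over \<open>k[[t]]\<close>, and the generic
  fibre has the same dimension as the special one.
\<close>

section \<open>Monomial ideals of \<open>k[[x,y]]\<close>\<close>

text \<open>Only the dual of the principal parts is computed, never the power of the diagonal ideal
  that defines them. That power lies in the set \<open>Z m\<close> of functions whose derivatives of
  order below m vanish on the diagonal, and it contains zeta^m, where zeta = X_2 - X_1.
  Multiplication by X^m carries \<open>Z m\<close> into the ideal of zeta^m, so a linear form with
  values in the domain k[[x,y]] cannot tell the two bounds apart. What remains is integrality: the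
  coefficient of a form at e_i has at worst the denominator X^i, and an element with the value
  y^(m-i) at the same place removes it, as x and y are coprime. The operators come from ordinary
  derivatives: where X is invertible it is a relative coordinate, and e_i = X^i d^(m-1) X^(m-1-i) /
  (m-1)! with d = d/dX. Triangular exponents appear because row i of a determinant offers x^i or
  y^(m-i), and distinct rows offer distinct exponents. Modulo xy only x^T and y^T with T = m(m-1)/2
  survive, one for each branch of the node, whence 2T = m(m-1).\<close>

definition cf :: "'k::zero fps fps \<Rightarrow> nat \<Rightarrow> nat \<Rightarrow> 'k"
  where "cf f a b = fps_nth (fps_nth f b) a"

text \<open>Exponents are listed with x first, although y is the outer variable. Membership
  constrains the support only; for an upset \<open>U\<close> it defines an ideal.\<close>

definition mon_ideal :: "(nat \<times> nat) set \<Rightarrow> 'k::field fps fps set"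
  where "mon_ideal U = {f. \<forall>a b. cf f a b \<noteq> 0 \<longrightarrow> (a, b) \<in> U}"

definition upset :: "(nat \<times> nat) set \<Rightarrow> bool"
  where "upset U \<longleftrightarrow> (\<forall>a b i j. (a, b) \<in> U \<longrightarrow> (a + i, b + j) \<in> U)"

abbreviation mpow :: "nat \<Rightarrow> 'k::field fps fps set"
  where "mpow n \<equiv> mon_ideal {(a, b). n \<le> a + b}"

lemma cf_eqI: "(\<And>a b. cf f a b = cf g a b) \<Longrightarrow> f = g"
  by (simp add: cf_def fps_eq_iff)

lemma cf_0 [simp]: "cf 0 a b = 0"
  and cf_add [simp]: "cf (f + g) a b = cf f a b + cf g a b"
  for f g :: "'k::monoid_add fps fps"
  by (simp_all add: cf_def)

lemma cf_diff [simp]: "cf (f - g) a b = cf f a b - cf g a b"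
  and cf_uminus [simp]: "cf (- f) a b = - cf f a b"
  for f g :: "'k::group_add fps fps"
  by (simp_all add: cf_def)

lemma cf_sum: "cf (\<Sum>i\<in>A. f i) a b = (\<Sum>i\<in>A. cf (f i) a b)" for f :: "'b \<Rightarrow> 'k::comm_monoid_add fps fps"
  by (simp add: cf_def fps_sum_nth)

lemma cf_mult: "cf (f * g) a b = (\<Sum>j\<le>b. \<Sum>i\<le>a. cf f i j * cf g (a - i) (b - j))"
  for f g :: "'k::field fps fps"
  by (simp add: cf_def fps_mult_nth fps_sum_nth atLeast0AtMost)

lemma cf_Abs: "cf (Abs_fps (\<lambda>b. Abs_fps (\<lambda>a. h a b))) a b = h a b"
  by (simp add: cf_def)

lemma cf_const2: "cf (const2 c) a b = (if a = 0 \<and> b = 0 then c else 0)"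
  by (simp add: cf_def const2_def)

lemma cf_1: "cf (1 :: 'k::field fps fps) a b = (if a = 0 \<and> b = 0 then 1 else 0)"
  by (simp add: cf_def)

lemma const2_simps [simp]:
  "const2 (0 :: 'a::comm_ring_1) = 0" "const2 (1 :: 'a::comm_ring_1) = 1"
  "const2 (c + d) = const2 c + const2 d" "const2 (c * d) = const2 c * const2 d"
  "const2 (- c) = - const2 c" "const2 (c - d) = const2 c - const2 d"
  for c d :: "'a::comm_ring_1"
  by (simp_all add: const2_def fps_const_add [symmetric] fps_const_mult [symmetric]
      del: fps_const_add fps_const_mult)

lemma cf_const2_mult [simp]: "cf (const2 c * f) a b = c * cf f a b" for f :: "'k::field fps fps"
  by (simp add: cf_def const2_def)

lemma cf_germ_x_mult: "cf (germ_x * f) a b = (if a = 0 then 0 else cf f (a - 1) b)"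
  by (simp add: cf_def germ_x_def)

lemma cf_germ_y_mult: "cf (germ_y * f) a b = (if b = 0 then 0 else cf f a (b - 1))"
  by (simp add: cf_def germ_y_def)

lemma cf_germ_x_power_mult:
  "cf (germ_x ^ i * f) a b = (if i \<le> a then cf f (a - i) b else 0)"
proof (induction i arbitrary: a)
  case (Suc i)
  then show ?case by (auto simp: cf_germ_x_mult mult.assoc)
qed simp

lemma cf_germ_y_power_mult:
  "cf (germ_y ^ i * f) a b = (if i \<le> b then cf f a (b - i) else 0)"
proof (induction i arbitrary: b)
  case (Suc i)
  then show ?case by (auto simp: cf_germ_y_mult mult.assoc)
qed simp

lemma cf_monomial_mult:
  "cf (germ_x ^ i * germ_y ^ j * f) a b = (if i \<le> a \<and> j \<le> b then cf f (a - i) (b - j) else 0)"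
  by (simp add: mult.assoc cf_germ_x_power_mult cf_germ_y_power_mult)

lemma cf_monomial:
  "cf (germ_x ^ i * germ_y ^ j :: 'k::field fps fps) a b = (if a = i \<and> b = j then 1 else 0)"
  using cf_monomial_mult [of i j 1 a b] by (auto simp: cf_1)

lemma mon_idealI: "(\<And>a b. (a, b) \<notin> U \<Longrightarrow> cf f a b = 0) \<Longrightarrow> f \<in> mon_ideal U"
  and mon_idealD: "f \<in> mon_ideal U \<Longrightarrow> (a, b) \<notin> U \<Longrightarrow> cf f a b = 0"
  by (auto simp: mon_ideal_def)

lemma mon_ideal_0 [simp]: "0 \<in> mon_ideal U"
  and mon_ideal_add: "f \<in> mon_ideal U \<Longrightarrow> g \<in> mon_ideal U \<Longrightarrow> f + g \<in> mon_ideal U"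
  and mon_ideal_diff: "f \<in> mon_ideal U \<Longrightarrow> g \<in> mon_ideal U \<Longrightarrow> f - g \<in> mon_ideal U"
  and mon_ideal_uminus: "f \<in> mon_ideal U \<Longrightarrow> - f \<in> mon_ideal U"
  and mon_ideal_mono: "f \<in> mon_ideal U \<Longrightarrow> U \<subseteq> V \<Longrightarrow> f \<in> mon_ideal V"
  by (auto simp: mon_ideal_def) (metis add_0 add.right_neutral diff_zero diff_self subsetD)+

lemma mon_ideal_UNIV [simp]: "f \<in> mon_ideal UNIV"
  by (simp add: mon_ideal_def)

lemma mon_ideal_sum: "(\<And>i. i \<in> A \<Longrightarrow> f i \<in> mon_ideal U) \<Longrightarrow> (\<Sum>i\<in>A. f i) \<in> mon_ideal U"
  by (induction A rule: infinite_finite_induct) (auto intro: mon_ideal_add)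

lemma mon_ideal_mult:
  assumes "f \<in> mon_ideal U" "g \<in> mon_ideal V"
    and "\<And>a b c d. (a, b) \<in> U \<Longrightarrow> (c, d) \<in> V \<Longrightarrow> (a + c, b + d) \<in> W"
  shows "f * g \<in> mon_ideal W"
proof (rule mon_idealI)
  fix a b assume n: "(a, b) \<notin> W"
  have "cf f i j * cf g (a - i) (b - j) = 0" if "i \<le> a" "j \<le> b" for i j
  proof (rule ccontr)
    assume "\<not> ?thesis"
    then have "(i, j) \<in> U" "(a - i, b - j) \<in> V"
      using assms(1,2) by (auto simp: mon_ideal_def)
    from assms(3) [OF this] that n show False by simp
  qed
  then show "cf (f * g) a b = 0" unfolding cf_mult by (intro sum.neutral ballI) simp
qed

lemma mon_ideal_mult_left: "upset U \<Longrightarrow> f \<in> mon_ideal U \<Longrightarrow> g * f \<in> mon_ideal U"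
  by (rule mon_ideal_mult [where U = UNIV and V = U]) (simp_all add: upset_def, metis add.commute)

lemma mon_ideal_mult_right: "upset U \<Longrightarrow> f \<in> mon_ideal U \<Longrightarrow> f * g \<in> mon_ideal U"
  using mon_ideal_mult_left [of U f g] by (simp add: mult.commute)

lemma upset_deg [simp]: "upset {(a, b). n \<le> a + b}"
  by (auto simp: upset_def)

lemma mpow_mult: "f \<in> mpow m \<Longrightarrow> g \<in> mpow n \<Longrightarrow> f * g \<in> mpow (m + n)"
  by (rule mon_ideal_mult) auto

lemma mpow_power: "f \<in> mpow 1 \<Longrightarrow> f ^ n \<in> mpow n"
proof (induction n)
  case (Suc n)
  then show ?case using mpow_mult [of f 1 "f ^ n" n] by simp
qed simp

text \<open>Separatedness of the adic topology: limits that agree modulo every power of the maximal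
  ideal are equal.\<close>

lemma mpow_eq_0: "(\<And>n. f \<in> mpow n) \<Longrightarrow> f = 0"
  by (rule cf_eqI) (metis (mono_tags, lifting) case_prodD cf_0 less_add_one linorder_not_le mem_Collect_eq mon_idealD)

lemma mpow_1_iff: "f \<in> mpow 1 \<longleftrightarrow> cf f 0 0 = 0"
proof
  assume "cf f 0 0 = 0"
  then show "f \<in> mpow 1" by (intro mon_idealI) (auto simp: not_le)
qed (simp add: mon_idealD)

lemma germ_in_mpow [simp]: "germ_x \<in> mpow 1" "germ_y \<in> mpow 1"
  by (simp_all only: mpow_1_iff) (simp_all add: cf_def germ_x_def germ_y_def)

lemmas germ_in_mpow_Suc [simp] = germ_in_mpow [unfolded One_nat_def]


section \<open>Evaluation of power series over \<open>k[[x,y]]\<close>\<close>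

text \<open>Substitution of \<open>z\<close> for the outermost variable. If \<open>z\<close> has
  positive order, z^n contributes only in degrees at least n, so in degree a + b the sum may stop at
  n = a + b and no limit is formed.\<close>

definition ev :: "'k::field fps fps \<Rightarrow> 'k fps fps fps \<Rightarrow> 'k fps fps"
  where "ev z g = Abs_fps (\<lambda>b. Abs_fps (\<lambda>a. cf (\<Sum>n\<le>a + b. fps_nth g n * z ^ n) a b))"

lemma ev_approx:
  assumes z: "z \<in> mpow 1"
  shows "ev z g - (\<Sum>n<N. fps_nth g n * z ^ n) \<in> mpow N"
proof (rule mon_idealI)
  fix a b assume "(a, b) \<notin> {(a, b). N \<le> a + b}"
  then have ab: "a + b < N" by simp
  have "(\<Sum>n<N. fps_nth g n * z ^ n) =
      (\<Sum>n\<le>a + b. fps_nth g n * z ^ n) + (\<Sum>n\<in>{a + b<..<N}. fps_nth g n * z ^ n)"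
    using ab by (subst sum.union_disjoint [symmetric]) (auto intro!: sum.cong)
  moreover have "(\<Sum>n\<in>{a + b<..<N}. fps_nth g n * z ^ n) \<in> mpow (a + b + 1)"
    by (rule mon_ideal_sum, rule mon_ideal_mult_left [OF upset_deg], rule mon_ideal_mono [OF mpow_power [OF z]]) auto
  then have "cf (\<Sum>n\<in>{a + b<..<N}. fps_nth g n * z ^ n) a b = 0"
    by (rule mon_idealD) auto
  ultimately show "cf (ev z g - (\<Sum>n<N. fps_nth g n * z ^ n)) a b = 0"
    by (simp add: ev_def cf_Abs)
qed

lemma ev_eqI:
  assumes z: "z \<in> mpow 1" and f: "\<And>N. f - (\<Sum>n<N. fps_nth g n * z ^ n) \<in> mpow N"
  shows "ev z g = f"
proof -
  have "ev z g - f \<in> mpow N" for N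
    using mon_ideal_diff [OF ev_approx [OF z, of g N] f [of N]] by (simp add: algebra_simps)
  then show ?thesis using mpow_eq_0 [of "ev z g - f"] by simp
qed

lemma ev_rec:
  assumes z: "z \<in> mpow 1"
  shows "ev z g = fps_nth g 0 + z * ev z (fps_shift 1 g)"
proof (rule ev_eqI [OF z])
  fix N
  let ?S = "\<Sum>n<N. fps_nth (fps_shift 1 g) n * z ^ n"
  have "(\<Sum>n<Suc N. fps_nth g n * z ^ n) = fps_nth g 0 + z * ?S"
    by (subst sum.lessThan_Suc_shift) (simp add: sum_distrib_left mult_ac)
  then have "fps_nth g 0 + z * ev z (fps_shift 1 g) - (\<Sum>n<N. fps_nth g n * z ^ n)
      = z * (ev z (fps_shift 1 g) - ?S) + fps_nth g N * z ^ N"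
    by (simp add: algebra_simps)
  moreover have "z * (ev z (fps_shift 1 g) - ?S) + fps_nth g N * z ^ N \<in> mpow N"
    by (intro mon_ideal_add mon_ideal_mult_left [OF upset_deg] ev_approx [OF z] mpow_power [OF z])
  ultimately show "fps_nth g 0 + z * ev z (fps_shift 1 g) - (\<Sum>n<N. fps_nth g n * z ^ n) \<in> mpow N"
    by simp
qed

text \<open>Synthetic division by t - z: by \<open>ev_rec\<close>, coefficient n of the quotient is
  the value at \<open>z\<close> of the series with its first n + 1 coefficients removed.\<close>

lemma ev_division:
  assumes z: "z \<in> mpow 1"
  shows "\<exists>q. g = fps_const (ev z g) + (fps_X - fps_const z) * q"
proof -
  define q where "q = Abs_fps (\<lambda>n. ev z (fps_shift (Suc n) g))"
  have "g = fps_const (ev z g) + (fps_X - fps_const z) * q"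
  proof (rule fps_ext)
    fix n
    show "fps_nth g n = fps_nth (fps_const (ev z g) + (fps_X - fps_const z) * q) n"
    proof (cases n)
      case 0
      then show ?thesis using ev_rec [OF z, of g] by (simp add: q_def left_diff_distrib)
    next
      case (Suc k)
      have "fps_shift 1 (fps_shift (Suc k) g) = fps_shift (Suc (Suc k)) g"
        by (simp add: fps_eq_iff)
      then show ?thesis using Suc ev_rec [OF z, of "fps_shift (Suc k) g"]
        by (simp add: q_def left_diff_distrib)
    qed
  qed
  then show ?thesis ..
qed

text \<open>Two divisions differ by a series p whose product with t - z is constant, so p_n = z
  p_(n+1) for all n. Then p_0 lies in every power of the maximal ideal and vanishes, and with it the
  difference of the remainders.\<close>

lemma ev_unique:
  assumes z: "z \<in> mpow 1" and g: "g = fps_const c + (fps_X - fps_const z) * q"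
  shows "ev z g = c"
proof -
  have lin: "A - B = d * (r - r')" if "A + d * r' = B + d * r" for A B d r r' :: "'a fps fps fps"
    using that by (simp add: algebra_simps)
  obtain q' where q': "g = fps_const (ev z g) + (fps_X - fps_const z) * q'"
    using ev_division [OF z] by blast
  have e: "fps_const (ev z g - c) = (fps_X - fps_const z) * (q - q')"
    unfolding fps_const_sub [symmetric] by (rule lin) (rule trans [OF q' [symmetric] g])
  define p where "p = q - q'"
  have step: "fps_nth p n = z * fps_nth p (Suc n)" for n
    using arg_cong [OF e, of "\<lambda>s. fps_nth s (Suc n)"] by (simp add: p_def left_diff_distrib)
  have "fps_nth p 0 = z ^ n * fps_nth p n" for n
  proof (induction n)
    case (Suc n)
    then show ?case using step [of n] by (simp add: mult.assoc mult.left_commute [of z])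
  qed simp
  then have "fps_nth p 0 = 0"
    by (metis mpow_eq_0 mon_ideal_mult_right mpow_power upset_deg z)
  moreover have "ev z g - c = - z * fps_nth p 0"
    using arg_cong [OF e, of "\<lambda>s. fps_nth s 0"] by (simp add: p_def left_diff_distrib)
  ultimately show ?thesis by simp
qed

definition rhom :: "('a::comm_ring_1 \<Rightarrow> 'b::comm_ring_1) \<Rightarrow> bool"
  where "rhom h \<longleftrightarrow> (\<forall>a b. h (a + b) = h a + h b) \<and> (\<forall>a b. h (a * b) = h a * h b) \<and> h 1 = 1"

lemma rhomD:
  assumes "rhom h"
  shows "h (a + b) = h a + h b" "h (a * b) = h a * h b" "h 1 = 1" "h 0 = 0" "h (- a) = - h a"
    "h (a - b) = h a - h b" "h (a ^ n) = h a ^ n" "h (sum f A) = (\<Sum>i\<in>A. h (f i))"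
proof -
  have add: "h (a + b) = h a + h b" for a b using assms by (simp add: rhom_def)
  show 0: "h 0 = 0" using add [of 0 0] by simp
  show m: "h (- a) = - h a" for a using add [of a "- a"] 0 by (simp add: eq_neg_iff_add_eq_0 add.commute)
  show "h (a - b) = h a - h b" using add [of a "- b"] m by simp
  show "h (a ^ n) = h a ^ n" using assms by (induction n) (simp_all add: rhom_def)
  show "h (sum f A) = (\<Sum>i\<in>A. h (f i))"
    by (induction A rule: infinite_finite_induct) (simp_all add: 0 add)
qed (use assms in \<open>simp_all add: rhom_def\<close>)

lemma rhomI: "(\<And>a b. h (a + b) = h a + h b) \<Longrightarrow> (\<And>a b. h (a * b) = h a * h b) \<Longrightarrow> h 1 = 1 \<Longrightarrow> rhom h"
  by (simp add: rhom_def)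

lemma rhom_comp: "rhom g \<Longrightarrow> rhom h \<Longrightarrow> rhom (\<lambda>a. g (h a))"
  by (simp add: rhom_def)

text \<open>Adding or multiplying two division identities gives a division of the sum or the
  product, and remainders are unique. Cauchy products of limits are thereby avoided.\<close>

lemma rhom_ev:
  assumes z: "z \<in> mpow 1"
  shows "rhom (ev z)"
proof (rule rhomI)
  fix a b
  obtain p where p: "a = fps_const (ev z a) + (fps_X - fps_const z) * p" using ev_division [OF z] by blast
  obtain q where q: "b = fps_const (ev z b) + (fps_X - fps_const z) * q" using ev_division [OF z] by blast
  show "ev z (a + b) = ev z a + ev z b"
    by (rule ev_unique [OF z, of _ _ "p + q"], subst p, subst q) (simp add: algebra_simps flip: fps_const_add)
  have lin: "(A + d * p) * b = A * B + d * (A * q + p * b)" if "b = B + d * q" for A B d :: "'a fps fps fps"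
    using that by (simp add: algebra_simps)
  show "ev z (a * b) = ev z a * ev z b"
    by (rule ev_unique [OF z, of _ _ "fps_const (ev z a) * q + p * b"])
       (metis lin p q fps_const_mult)
next
  show "ev z 1 = 1" by (rule ev_unique [OF z, of _ _ 0]) simp
qed

lemma ev_const: "z \<in> mpow 1 \<Longrightarrow> ev z (fps_const c) = c"
  by (rule ev_unique [of _ _ _ 0]) simp_all

lemma ev_X: "z \<in> mpow 1 \<Longrightarrow> ev z fps_X = z"
  by (rule ev_unique [of _ _ _ 1]) simp_all

text \<open>Geometric series: with c the constant term, z = 1 - u / c has positive order, and 1 / (1
  - z) is the value of 1 + t + t^2 + ... at z.\<close>

lemma unit_if_cf_nonzero:
  fixes u :: "'k::field fps fps"
  assumes "cf u 0 0 \<noteq> 0"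
  shows "\<exists>w. u * w = 1"
proof -
  define c where "c = cf u 0 0"
  define z where "z = 1 - const2 (inverse c) * u"
  have z: "z \<in> mpow 1" using assms by (simp only: mpow_1_iff) (simp add: z_def cf_1 c_def)
  define e where "e = ev z (Abs_fps (\<lambda>_. 1))"
  have "(1 - fps_X) * Abs_fps (\<lambda>_. 1 :: 'k fps fps) = 1"
    by (rule fps_ext) (auto simp: left_diff_distrib)
  then have "ev z ((1 - fps_X) * Abs_fps (\<lambda>_. 1)) = 1" using rhomD(3) [OF rhom_ev [OF z]] by simp
  then have "(1 - z) * e = 1"
    by (simp add: rhomD [OF rhom_ev [OF z]] ev_X [OF z] e_def)
  then have "u * (const2 (inverse c) * e) = 1" by (simp add: z_def mult_ac)
  then show ?thesis ..
qed

section \<open>Restriction to the diagonal and derivations in the right factor\<close>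

lemma nth_coeff_map [simp]: "fps_nth (coeff_map h g) n = h (fps_nth g n)"
  by (simp add: coeff_map_def)

lemma coeff_map_coeff_map [simp]: "coeff_map h (coeff_map g s) = coeff_map (\<lambda>a. h (g a)) s"
  by (simp add: fps_eq_iff)

lemma coeff_map_ident [simp]: "coeff_map (\<lambda>a. a) s = s"
  by (simp add: fps_eq_iff)

lemma coeff_map_const: "h 0 = 0 \<Longrightarrow> coeff_map h (fps_const c) = fps_const (h c)"
  by (rule fps_ext) simp

lemma coeff_map_X: "h 0 = 0 \<Longrightarrow> h 1 = 1 \<Longrightarrow> coeff_map h fps_X = fps_X"
  by (rule fps_ext) (simp add: fps_X_def)

lemma rhom_coeff_map: "rhom h \<Longrightarrow> rhom (coeff_map h)"
  by (rule rhomI) (auto simp: fps_eq_iff fps_mult_nth rhomD)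

lemma rhom_fps_const: "rhom fps_const"
  by (rule rhomI) simp_all

lemma rhom_const2: "rhom const2"
  by (rule rhomI) simp_all

lemma rhom_left_factor: "rhom left_factor"
  unfolding left_factor_def by (intro rhom_coeff_map rhom_const2)

lemma rhom_right_factor: "rhom right_factor"
  unfolding right_factor_def by (intro rhom_coeff_map rhom_const2)

abbreviation right0 :: "'k::field fps fps \<Rightarrow> 'k fps fps fps fps"
  where "right0 \<equiv> coeff_map (coeff_map const2)"

lemma rhom_right0: "rhom right0"
  by (intro rhom_coeff_map rhom_const2)

lemma left_factor_const: "left_factor (fps_const g) = fps_const (const2 g)"
  by (simp add: left_factor_def coeff_map_const)

lemma right_factor_const: "right_factor (fps_const g) = fps_const (right0 g)"
  by (simp add: right_factor_def coeff_map_const rhomD [OF rhom_right0])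

definition derivn :: "('a::comm_ring_1 \<Rightarrow> 'a) \<Rightarrow> bool"
  where "derivn D \<longleftrightarrow> (\<forall>a b. D (a + b) = D a + D b) \<and> (\<forall>a b. D (a * b) = D a * b + a * D b)"

lemma derivnD:
  assumes "derivn D"
  shows "D (a + b) = D a + D b" "D (a * b) = D a * b + a * D b" "D 0 = 0" "D (- a) = - D a"
    "D (a - b) = D a - D b" "D (sum f A) = (\<Sum>i\<in>A. D (f i))" "D 1 = 0"
proof -
  have add: "D (a + b) = D a + D b" and m: "D (a * b) = D a * b + a * D b" for a b
    using assms by (simp_all add: derivn_def)
  show "D (a + b) = D a + D b" by (rule add)
  show "D (a * b) = D a * b + a * D b" by (rule m)
  show 0: "D 0 = 0" using add [of 0 0] by simp
  show "D 1 = 0" using m [of 1 1] by simp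
  show n: "D (- a) = - D a" for a using add [of a "- a"] 0 by (simp add: eq_neg_iff_add_eq_0 add.commute)
  show "D (a - b) = D a - D b" using add [of a "- b"] n by simp
  show "D (sum f A) = (\<Sum>i\<in>A. D (f i))"
    by (induction A rule: infinite_finite_induct) (simp_all add: 0 add)
qed

lemma derivn_coeff_map: "derivn D \<Longrightarrow> derivn (coeff_map D)"
  unfolding derivn_def [of "coeff_map D"]
  by (intro conjI allI fps_ext) (simp_all add: fps_mult_nth derivnD [of D] sum.distrib)

lemma derivn_fps_deriv: "derivn fps_deriv"
  by (simp add: derivn_def add.commute)

lemma derivn_lincomb: "derivn D \<Longrightarrow> derivn E \<Longrightarrow> derivn (\<lambda>f. a * D f + b * E f)"
  by (simp add: derivn_def algebra_simps)

lemma derivn_deriv_x: "derivn deriv_x"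
  unfolding deriv_x_def by (intro derivn_coeff_map derivn_fps_deriv)

lemma derivn_deriv_y: "derivn deriv_y"
  unfolding deriv_y_def by (rule derivn_fps_deriv)

lemma derivn_power: "derivn D \<Longrightarrow> D (a ^ Suc n) = of_nat (Suc n) * a ^ n * D a"
  by (induction n) (auto simp: derivnD algebra_simps)

text \<open>Restriction to the diagonal by two evaluations in one variable: x_2 = x_1 in each
  coefficient of a power of y_2, then y_2 = y_1.\<close>

definition mu0 :: "'k::field fps fps fps fps \<Rightarrow> 'k fps fps"
  where "mu0 s = ev germ_y (coeff_map (ev germ_x) s)"

definition mu :: "'k::field fps fps fps fps fps \<Rightarrow> 'k fps fps fps"
  where "mu = coeff_map mu0"

lemma rhom_mu0: "rhom mu0"
  unfolding mu0_def by (rule rhom_comp [OF rhom_ev rhom_coeff_map [OF rhom_ev]]) simp_all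

lemma rhom_mu: "rhom mu"
  unfolding mu_def by (intro rhom_coeff_map rhom_mu0)

lemma mu0_const2 [simp]: "mu0 (const2 g) = g"
  by (simp add: mu0_def const2_def coeff_map_const rhomD(4) [OF rhom_ev] ev_const)

lemma mu_left [simp]: "mu (left_factor s) = s"
  by (simp add: mu_def left_factor_def)

lemma ev_germ_x_const2: "ev germ_x (coeff_map const2 p) = fps_const p"
proof (rule cf_eqI)
  fix a b
  have "cf (const2 (fps_nth p n) * germ_x ^ n) a b = (if n = a \<and> b = 0 then fps_nth p n else 0)" for n
    using cf_monomial [of n 0 a b] by auto
  then show "cf (ev germ_x (coeff_map const2 p)) a b = cf (fps_const p) a b"
    by (simp add: ev_def cf_Abs cf_sum) (simp add: cf_def)
qed

lemma ev_germ_y_const: "ev germ_y (coeff_map fps_const g) = g"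
proof (rule cf_eqI)
  fix a b
  have "cf (fps_const (fps_nth g n) * germ_y ^ n) a b = (if n = b then cf g a b else 0)" for n
    by (subst mult.commute) (auto simp: cf_germ_y_power_mult, auto simp: cf_def)
  then show "cf (ev germ_y (coeff_map fps_const g)) a b = cf g a b"
    by (simp add: ev_def cf_Abs cf_sum)
qed

lemma mu0_right0 [simp]: "mu0 (right0 g) = g"
  by (simp add: mu0_def ev_germ_x_const2 ev_germ_y_const)

lemma mu_right [simp]: "mu (right_factor s) = s"
  by (simp add: mu_def right_factor_def)

abbreviation xi :: "'k::field fps fps fps fps fps"
  where "xi \<equiv> right_factor (fps_const germ_x) - left_factor (fps_const germ_x)"

abbreviation eta :: "'k::field fps fps fps fps fps"
  where "eta \<equiv> right_factor (fps_const germ_y) - left_factor (fps_const germ_y)"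

text \<open>The kernel of the restriction is generated by x_2 - x_1 and y_2 - y_1: divide each
  coefficient by x_2 - x_1, then the series of remainders by y_2 - y_1.\<close>

lemma mu0_division: "\<exists>q r. s = const2 (mu0 s) + (right0 germ_x - const2 germ_x) * q
    + (right0 germ_y - const2 germ_y) * r"
proof -
  have x: "right0 germ_x = fps_const fps_X" and y: "right0 germ_y = fps_X"
    by (simp_all add: germ_x_def germ_y_def coeff_map_const coeff_map_X rhomD [OF rhom_coeff_map [OF rhom_const2]])
  have "\<exists>q. g = fps_const (ev germ_x g) + (fps_X - fps_const germ_x) * q" for g :: "'a fps fps fps"
    by (rule ev_division) simp
  then obtain q where q: "g = fps_const (ev germ_x g) + (fps_X - fps_const germ_x) * q g" for g :: "'a fps fps fps"
    by metis
  have 1: "s = coeff_map fps_const (coeff_map (ev germ_x) s) + fps_const (fps_X - fps_const germ_x) * coeff_map q s"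
    by (rule fps_ext) (simp add: q [symmetric])
  obtain r where "coeff_map (ev germ_x) s = fps_const (mu0 s) + (fps_X - fps_const germ_y) * r"
    using ev_division [of germ_y "coeff_map (ev germ_x) s"] by (auto simp: mu0_def)
  then have "coeff_map fps_const (coeff_map (ev germ_x) s) =
      coeff_map fps_const (fps_const (mu0 s) + (fps_X - fps_const germ_y) * r)" by simp
  also have "\<dots> = const2 (mu0 s) + (fps_X - const2 germ_y) * coeff_map fps_const r"
    by (simp add: rhomD [OF rhom_coeff_map [OF rhom_fps_const]] coeff_map_const coeff_map_X const2_def)
  finally have 2: "s = const2 (mu0 s) + (fps_X - const2 germ_y) * coeff_map fps_const r
      + fps_const (fps_X - fps_const germ_x) * coeff_map q s"
    using 1 by simp
  show ?thesis
    by (rule exI [of _ "coeff_map q s"], rule exI [of _ "coeff_map fps_const r"])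
      (unfold x y, subst (1) 2, simp add: const2_def flip: fps_const_sub)
qed

lemma mu_division: "\<exists>q r. w = left_factor (mu w) + xi * q + eta * r"
proof -
  obtain q r where qr: "s = const2 (mu0 s) + (right0 germ_x - const2 germ_x) * q s
    + (right0 germ_y - const2 germ_y) * r s" for s :: "'a fps fps fps fps"
    using mu0_division by metis
  have "w = left_factor (mu w) + xi * coeff_map q w + eta * coeff_map r w"
    unfolding right_factor_const left_factor_const fps_const_sub
    by (rule fps_ext) (simp add: left_factor_def mu_def flip: qr)
  then show ?thesis by blast
qed

text \<open>The vector field \<alpha> d/dx + \<beta> d/dy in the variables of the right factor. The
  variables of the left factor and t are constants for it, which makes it linear over the left
  factor.\<close>

definition Theta :: "'k::field fps fps \<Rightarrow> 'k fps fps \<Rightarrow> 'k fps fps fps fps fps \<Rightarrow> 'k fps fps fps fps fps"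
  where "Theta \<alpha> \<beta> = coeff_map (\<lambda>s. right0 \<alpha> * coeff_map fps_deriv s + right0 \<beta> * fps_deriv s)"

definition theta :: "'k::field fps fps \<Rightarrow> 'k fps fps \<Rightarrow> 'k fps fps \<Rightarrow> 'k fps fps"
  where "theta \<alpha> \<beta> f = \<alpha> * deriv_x f + \<beta> * deriv_y f"

lemma derivn_theta: "derivn (theta \<alpha> \<beta>)"
  using derivn_lincomb [OF derivn_deriv_x derivn_deriv_y] by (simp add: theta_def [abs_def])

lemma derivn_Theta: "derivn (Theta \<alpha> \<beta>)"
  unfolding Theta_def
  by (rule derivn_coeff_map [OF derivn_lincomb [OF derivn_coeff_map [OF derivn_fps_deriv] derivn_fps_deriv]])

lemma Theta_left: "Theta \<alpha> \<beta> (left_factor s) = 0"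
  by (simp add: Theta_def left_factor_def const2_def coeff_map_const fps_eq_iff)

lemma Theta_right: "Theta \<alpha> \<beta> (right_factor s) = right_factor (coeff_map (theta \<alpha> \<beta>) s)"
proof -
  have of_nat: "const2 (of_nat n :: 'a) = of_nat n" for n
    by (induction n) simp_all
  have x: "fps_deriv (coeff_map const2 g) = coeff_map const2 (fps_deriv g)" for g :: "'a fps"
    by (rule fps_ext) (simp add: of_nat del: of_nat_Suc)
  have of_nat': "(of_nat n :: 'a fps fps fps) = coeff_map const2 (of_nat n :: 'a fps)" for n
    by (induction n) (simp_all add: rhomD [OF rhom_coeff_map [OF rhom_const2]])
  have y: "fps_deriv (right0 g) = right0 (deriv_y g)" for g :: "'a fps fps"
    by (rule fps_ext) (simp add: deriv_y_def of_nat' rhomD [OF rhom_coeff_map [OF rhom_const2]] del: of_nat_Suc)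
  show ?thesis
    by (rule fps_ext)
      (simp add: Theta_def right_factor_def theta_def rhomD [OF rhom_right0] y, simp add: deriv_x_def x)
qed

text \<open>Finite sums, as in the tensor product before completion. By \<open>taylor\<close> they
  approximate every series, which reduces an operator to its action on functions of the right
  variables alone.\<close>

inductive_set LR :: "'k::field fps fps fps fps fps set"
  where
    gen: "left_factor s * right_factor (fps_const g) \<in> LR"
  | add: "v \<in> LR \<Longrightarrow> w \<in> LR \<Longrightarrow> v + w \<in> LR"

lemma LR_mult_gen: "v \<in> LR \<Longrightarrow> left_factor s * right_factor (fps_const g) * v \<in> LR"
proof (induction rule: LR.induct)
  case (gen s' g')
  have "left_factor s * right_factor (fps_const g) * (left_factor s' * right_factor (fps_const g'))
      = left_factor (s * s') * right_factor (fps_const (g * g'))"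
    by (simp add: rhomD [OF rhom_left_factor] rhomD [OF rhom_right_factor] flip: fps_const_mult)
  then show ?case by (simp add: LR.gen)
qed (simp add: distrib_left LR.add)

lemma LR_mult: "u \<in> LR \<Longrightarrow> v \<in> LR \<Longrightarrow> u * v \<in> LR"
  by (induction rule: LR.induct) (auto simp: distrib_right LR.add intro: LR_mult_gen)

lemma LR_left: "left_factor s \<in> LR"
  using LR.gen [of s 1] by (simp add: rhomD [OF rhom_right_factor])

lemma LR_right: "right_factor (fps_const g) \<in> LR"
  using LR.gen [of 1 g] by (simp add: rhomD [OF rhom_left_factor])

lemma LR_diff: "right_factor (fps_const g) - left_factor s \<in> LR"
  using LR.add [OF LR_right LR_left [of "- s"]] by (simp add: rhomD [OF rhom_left_factor])

section \<open>Order of vanishing along the diagonal, measured by a relative derivation\<close>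

locale rel_derivation =
  fixes F :: "'k::field fps fps fps" and D :: "'k fps fps fps fps fps \<Rightarrow> 'k fps fps fps fps fps"
  assumes D: "derivn D" and D_left: "D (left_factor s) = 0"
    and D_right: "\<exists>c. D (right_factor F) = right_factor F * c"
begin

text \<open>A substitute for the n-th power of the diagonal ideal, tested by differentiation instead
  of generators; \<open>KN_Z\<close> shows that it contains that power. The locale serves twice, for
  the smoothing and for x d/dx on the node itself.\<close>

primrec Z :: "nat \<Rightarrow> 'k fps fps fps fps fps set"
  where
    "Z 0 = UNIV"
  | "Z (Suc n) = {w. F dvd mu w \<and> D w \<in> Z n}"

lemma Z_add: "v \<in> Z n \<Longrightarrow> w \<in> Z n \<Longrightarrow> v + w \<in> Z n"
  by (induction n arbitrary: v w) (simp_all add: rhomD [OF rhom_mu] derivnD [OF D])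

lemma Z_Suc: "w \<in> Z (Suc n) \<Longrightarrow> w \<in> Z n"
  by (induction n arbitrary: w) simp_all

lemma Z_le: "m \<le> n \<Longrightarrow> w \<in> Z n \<Longrightarrow> w \<in> Z m"
  by (induction rule: dec_induct) (auto dest: Z_Suc simp del: Z.simps)

lemma Z_mult: "w \<in> Z n \<Longrightarrow> a * w \<in> Z n"
proof (induction n arbitrary: a w)
  case (Suc n)
  have "w \<in> Z n" using Suc.prems by (rule Z_Suc)
  then show ?case using Suc
    by (simp add: rhomD [OF rhom_mu] derivnD [OF D] Z_add)
qed simp

lemma Z_uminus: "w \<in> Z n \<Longrightarrow> - w \<in> Z n"
  using Z_mult [of w n "- 1"] by simp

text \<open>Leibniz rule: in D (v w) the term D v * w is covered by induction, and v * D w lies in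
  \<open>Z n\<close> because \<open>v\<close> does.\<close>

lemma Z_mult_1: "v \<in> Z n \<Longrightarrow> w \<in> Z 1 \<Longrightarrow> v * w \<in> Z (Suc n)"
proof (induction n arbitrary: v w)
  case (Suc n)
  have "v * D w \<in> Z (Suc n)"
    using Z_mult [OF Suc.prems(1), of "D w"] by (simp add: mult.commute del: Z.simps)
  moreover have "D v * w \<in> Z (Suc n)" using Suc by simp
  ultimately have "D (v * w) \<in> Z (Suc n)" by (simp add: derivnD [OF D] Z_add del: Z.simps)
  then show ?case using Suc.prems by (simp add: rhomD [OF rhom_mu])
qed (simp add: rhomD [OF rhom_mu])

lemma Z_power: "w \<in> Z 1 \<Longrightarrow> w ^ n \<in> Z n"
  by (induction n) (simp_all add: mult.commute [of w] Z_mult_1 del: Z.simps(2))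

lemma Z_F: "left_factor F \<in> Z n" "right_factor F \<in> Z n"
proof -
  show "left_factor F \<in> Z n"
    by (cases n) (simp_all add: D_left, induct_tac nat, simp_all add: rhomD [OF rhom_mu] derivnD [OF D])
  show "right_factor F \<in> Z n"
  proof (induction n)
    case (Suc n)
    from D_right obtain c where c: "D (right_factor F) = right_factor F * c" by blast
    then show ?case using Z_mult [OF Suc, of c] by (simp add: mult.commute)
  qed simp
qed

lemma diff_in_Z_1: "left_factor s - right_factor s \<in> Z 1"
  by (simp add: rhomD [OF rhom_mu])

lemma xi_eta_in_Z_1: "xi \<in> Z 1" "eta \<in> Z 1"
  by (simp_all add: rhomD [OF rhom_mu])

text \<open>Write \<open>w\<close> as its restriction to the diagonal plus xi q + eta r and
  approximate q and r to order n. The factors xi and eta vanish on the diagonal and gain one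
  order.\<close>

lemma taylor: "\<exists>v\<in>LR. w - v \<in> Z n"
proof (induction n arbitrary: w)
  case 0
  show ?case using LR_left by auto
next
  case (Suc n)
  obtain q r where w: "w = left_factor (mu w) + xi * q + eta * r" using mu_division by blast
  obtain q' where q': "q' \<in> LR" "q - q' \<in> Z n" using Suc by blast
  obtain r' where r': "r' \<in> LR" "r - r' \<in> Z n" using Suc by blast
  have *: "w - (left_factor (mu w) + xi * q' + eta * r') = (q - q') * xi + (r - r') * eta"
    using arg_cong [OF w, of "\<lambda>w'. w' - (left_factor (mu w) + xi * q' + eta * r')"]
    by (simp add: algebra_simps)
  have "w - (left_factor (mu w) + xi * q' + eta * r') \<in> Z (Suc n)"
    unfolding * by (intro Z_add Z_mult_1 q' r' xi_eta_in_Z_1)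
  moreover have "left_factor (mu w) + xi * q' + eta * r' \<in> LR"
    by (intro LR.add LR_left LR_mult LR_diff q' r')
  ultimately show ?case by blast
qed

text \<open>The differential operator p(D), followed by restriction to the diagonal. It is linear
  over the left factor, and for degree below n it sends \<open>Z n\<close> into the multiples of
  \<open>F\<close>.\<close>

definition E :: "'k poly \<Rightarrow> 'k fps fps fps fps fps \<Rightarrow> 'k fps fps fps"
  where "E p w = (\<Sum>i\<le>degree p. fps_const (const2 (coeff p i)) * mu ((D ^^ i) w))"

lemma D_pow_add: "(D ^^ i) (v + w) = (D ^^ i) v + (D ^^ i) w"
  by (induction i) (simp_all add: derivnD [OF D])

lemma D_pow_left: "(D ^^ i) (left_factor s * w) = left_factor s * (D ^^ i) w"
  by (induction i) (simp_all add: derivnD [OF D] D_left)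

lemma E_add: "E p (v + w) = E p v + E p w"
  by (simp add: E_def D_pow_add rhomD [OF rhom_mu] distrib_left sum.distrib)

lemma E_left: "E p (left_factor s * w) = s * E p w"
  by (simp only: E_def D_pow_left rhomD [OF rhom_mu] sum_distrib_left mu_left mult.left_commute)

lemma Z_D_pow: "w \<in> Z n \<Longrightarrow> i < n \<Longrightarrow> F dvd mu ((D ^^ i) w)"
proof (induction i arbitrary: w n)
  case 0
  then show ?case by (cases n) auto
next
  case (Suc i)
  then obtain n' where "n = Suc n'" by (cases n) auto
  with Suc show ?case by (auto simp: funpow_Suc_right simp del: funpow.simps)
qed

lemma E_Z: "w \<in> Z n \<Longrightarrow> degree p < n \<Longrightarrow> F dvd E p w"
  unfolding E_def by (intro dvd_sum dvd_mult Z_D_pow) auto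

lemma Z_iff: "w \<in> Z n \<longleftrightarrow> (\<forall>i<n. F dvd mu ((D ^^ i) w))"
proof (induction n arbitrary: w)
  case (Suc n)
  have "(\<forall>i<Suc n. F dvd mu ((D ^^ i) w)) \<longleftrightarrow> F dvd mu w \<and> (\<forall>i<n. F dvd mu ((D ^^ i) (D w)))"
    by (auto simp: less_Suc_eq_0_disj funpow_swap1)
  then show ?case using Suc by simp
qed simp

end

section \<open>Differential operators of the smoothing \<open>xy + tu\<close>\<close>

text \<open>Comparison of coefficients in (1 - z)^m (1 - z)^(-m) = 1, obtained from the Vandermonde
  identity for the upper arguments -m and m.\<close>

lemma alternating_binomial_convolution:
  fixes m N :: nat
  assumes "m \<ge> 1"
  shows "(\<Sum>j\<le>N. (- 1) ^ (N - j) * of_nat (m choose (N - j)) * of_nat ((j + m - 1) choose (m - 1)))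
    = (if N = 0 then 1 else 0 :: 'a::field_char_0)"
proof -
  have neg: "(- of_nat m :: 'a) gchoose j = (- 1) ^ j * of_nat ((j + m - 1) choose (m - 1))" for j
  proof -
    have "(of_nat m + of_nat j - 1 :: 'a) = of_nat (j + m - 1)"
      using assms by (simp add: of_nat_diff)
    moreover have "(j + m - 1) choose j = (j + m - 1) choose (m - 1)"
      using assms binomial_symmetric [of j "j + m - 1"] by simp
    ultimately show ?thesis
      by (simp add: gbinomial_minus flip: binomial_gbinomial)
  qed
  have "(\<Sum>j\<le>N. (- 1) ^ (N - j) * of_nat (m choose (N - j)) * of_nat ((j + m - 1) choose (m - 1)))
    = (- 1) ^ N * (\<Sum>j\<le>N. ((- of_nat m :: 'a) gchoose j) * (of_nat m gchoose (N - j)))"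
    unfolding sum_distrib_left neg
  proof (rule sum.cong [OF refl])
    fix j assume "j \<in> {..N}"
    then have "(- 1) ^ N = ((- 1) ^ (N - j) * (- 1) ^ j :: 'a)" by (simp flip: power_add)
    moreover have "(- 1) ^ j * (- 1) ^ j = (1 :: 'a)" by (simp flip: power_mult_distrib)
    ultimately show "(- 1) ^ (N - j) * of_nat (m choose (N - j)) * of_nat ((j + m - 1) choose (m - 1)) =
        (- 1) ^ N * ((- 1) ^ j * of_nat ((j + m - 1) choose (m - 1)) * (of_nat m gchoose (N - j) :: 'a))"
      by (simp add: binomial_gbinomial mult_ac)
  qed
  also have "\<dots> = (- 1) ^ N * (0 gchoose N)"
    using gbinomial_Vandermonde [of "- of_nat m :: 'a" "of_nat m" N] by (simp add: atLeast0AtMost)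
  finally show ?thesis by (cases N) simp_all
qed

text \<open>The coefficient of z^(n-c) in (1 - z)^m, that is, a weight of the m-th finite
  difference.\<close>

definition acoef :: "nat \<Rightarrow> nat \<Rightarrow> nat \<Rightarrow> 'a::field_char_0"
  where "acoef m n c = (- 1) ^ (n - c) * of_nat (m choose (n - c))"

text \<open>After a shift by \<open>i\<close> this is the convolution identity. The index set
  \<open>A\<close> is left flexible so that sums starting at 0 and sums starting at 1 are both
  covered.\<close>

lemma acoef_sum:
  fixes h :: "nat \<Rightarrow> 'a::field_char_0"
  assumes m: "m \<ge> 1" and A: "{i..n} \<subseteq> A" "A \<subseteq> {..n}"
    and lo: "\<And>c. c \<in> A \<Longrightarrow> c < i \<Longrightarrow> h c = 0"
    and hi: "\<And>c. i \<le> c \<Longrightarrow> c \<le> n \<Longrightarrow> h c = of_nat ((c - i + m - 1) choose (m - 1))"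
  shows "(\<Sum>c\<in>A. acoef m n c * h c) = (if n = i then 1 else 0)"
proof -
  have fin: "finite A" using A(2) finite_subset by blast
  have *: "(\<Sum>c\<in>A. acoef m n c * h c) = (\<Sum>c=i..n. acoef m n c * h c)"
    by (rule sum.mono_neutral_right [OF fin A(1)]) (use A(2) lo in force)
  show ?thesis
  proof (cases "i \<le> n")
    case True
    have "(\<Sum>c=i..n. acoef m n c * h c) = (\<Sum>j\<le>n - i. acoef m n (j + i) * h (j + i))"
      using True by (intro sum.reindex_bij_witness [of _ "\<lambda>j. j + i" "\<lambda>c. c - i"]) auto
    also have "\<dots> = (\<Sum>j\<le>n - i. (- 1) ^ (n - i - j) * of_nat (m choose (n - i - j)) *
        of_nat ((j + m - 1) choose (m - 1)))"
      using True by (intro sum.cong) (auto simp: acoef_def hi add.commute [of _ i] simp flip: diff_diff_left)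
    also have "\<dots> = (if n - i = 0 then 1 else 0)" by (rule alternating_binomial_convolution [OF m])
    finally show ?thesis using * True by auto
  qed (use * in auto)
qed

text \<open>
  \<open>bpol m i\<close> is \<open>\<theta> \<mapsto> binom(\<theta> + m - 1 - i, m - 1)\<close>.  As an operator it kills the monomials
  of weight \<open>-(m - 1 - i), \<dots>, i - 1\<close>, so its values lie in the ideal \<open>(x\<^sup>i, y\<^sup>m\<^sup>-\<^sup>i)\<close>.
\<close>

definition bpol :: "nat \<Rightarrow> nat \<Rightarrow> 'k::field_char_0 poly"
  where "bpol m i = smult (inverse (fact (m - 1)))
    (\<Prod>l<m - 1. [:of_nat (m - 1 - i) - of_nat l, 1:])"

lemma poly_bpol: "poly (bpol m i) c = (c + of_nat (m - 1 - i)) gchoose (m - 1)"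
  by (simp add: bpol_def gbinomial_prod_rev poly_prod atLeast0LessThan field_simps add_diff_eq)

lemma degree_bpol: "m \<ge> 1 \<Longrightarrow> degree (bpol m i :: 'k::field_char_0 poly) < m"
proof -
  assume "m \<ge> 1"
  have "Polynomial.degree (\<Prod>l<m - 1. [:of_nat (m - 1 - i) - of_nat l, 1 :: 'k:]) \<le> m - 1"
    by (rule order_trans [OF degree_prod_sum_le]) auto
  then show ?thesis using \<open>m \<ge> 1\<close> by (auto simp: bpol_def)
qed

lemma poly_bpol_nat: "poly (bpol m i) (of_nat c :: 'k::field_char_0) = of_nat ((c + (m - 1 - i)) choose (m - 1))"
  by (simp add: poly_bpol binomial_gbinomial)

lemma poly_bpol_neg:
  assumes "i < m" "c \<ge> 1"
  shows "poly (bpol m i) (- of_nat c :: 'k::field_char_0) = (- 1) ^ (m - 1) * of_nat ((c + i - 1) choose (m - 1))"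
proof -
  have a: "- of_nat c + of_nat (m - 1 - i) = - (of_nat c - of_nat (m - 1 - i) :: 'k)" by simp
  have b: "of_nat c - of_nat (m - 1 - i) + of_nat (m - 1) - 1 = (of_nat (c + i - 1) :: 'k)"
    using assms by (auto simp: of_nat_diff algebra_simps)
  show ?thesis unfolding poly_bpol a gbinomial_minus b by (simp add: binomial_gbinomial)
qed

text \<open>At c < i the value of \<open>bpol m i\<close> vanishes, and from c = i on it runs
  through the coefficients of (1 - z)^(-m). Truncated differences at 0, 1, ..., n are therefore
  functionals dual to these polynomials.\<close>

lemma bpol_dual:
  assumes "i < m" "n < m"
  shows "(\<Sum>c\<le>n. acoef m n c * poly (bpol m i) (of_nat c)) = (if n = i then 1 else 0 :: 'k::field_char_0)"
  using assms by (intro acoef_sum) (auto simp: poly_bpol_nat binomial_eq_0)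

text \<open>Negating the argument produces the sign (-1)^(m-1) and exchanges \<open>i\<close> with m
  - i, so differences taken on the negative side are dual as well. The sum starts at c = 1 because
  the argument 0 belongs to the other side.\<close>

lemma bpol_dual_neg:
  assumes "i < m" "1 \<le> n" "n < m"
  shows "(\<Sum>c=1..m - n. (- 1) ^ (m - 1) * acoef m (m - n) c * poly (bpol m i) (- of_nat c))
    = (if n = i then 1 else 0 :: 'k::field_char_0)"
proof -
  have sq: "(- 1) ^ (m - 1) * (- 1) ^ (m - 1) = (1 :: 'k)" by (simp flip: power_mult_distrib)
  define h where "h c = (of_nat ((c + i - 1) choose (m - 1)) :: 'k)" for c
  have "(\<Sum>c=1..m - n. (- 1) ^ (m - 1) * acoef m (m - n) c * poly (bpol m i) (- of_nat c))
      = (\<Sum>c=1..m - n. acoef m (m - n) c * h c)"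
  proof (rule sum.cong [OF refl])
    fix c assume "c \<in> {1..m - n}"
    then show "(- 1) ^ (m - 1) * acoef m (m - n) c * poly (bpol m i) (- of_nat c) = acoef m (m - n) c * h c"
      using assms sq by (simp add: poly_bpol_neg h_def mult_ac)
  qed
  also have "\<dots> = (if m - n = m - i then 1 else 0)"
  proof (rule acoef_sum)
    fix c assume "m - i \<le> c" "c \<le> m - n"
    with assms show "h c = of_nat ((c - (m - i) + m - 1) choose (m - 1))" by (simp add: h_def)
  qed (use assms in \<open>auto simp: h_def binomial_eq_0\<close>)
  also have "\<dots> = (if n = i then 1 else 0)" using assms by auto
  finally show ?thesis .
qed

text \<open>The difference of both sides is annihilated by all dual functionals. These are
  unitriangular in the values at 0, ..., m - 1, so all m values vanish, too many zeros for a nonzero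
  polynomial of degree below m.\<close>

lemma bpol_span:
  fixes p :: "'k::field_char_0 poly"
  assumes "Polynomial.degree p < m"
  shows "p = (\<Sum>i<m. smult (\<Sum>c\<le>i. acoef m i c * poly p (of_nat c)) (bpol m i))"
proof -
  define f where "f q n = (\<Sum>c\<le>n. acoef m n c * poly q (of_nat c))" for q :: "'k poly" and n
  define r where "r = p - (\<Sum>i<m. smult (f p i) (bpol m i))"
  have m: "m \<ge> 1" using assms by simp
  have "Polynomial.degree (\<Sum>i<m. smult (f p i) (bpol m i)) \<le> m - 1"
  proof (rule degree_sum_le)
    fix i
    show "Polynomial.degree (Polynomial.smult (f p i) (bpol m i)) \<le> m - 1"
      using degree_bpol [OF m, of i, where 'k = 'k] by (intro order_trans [OF degree_smult_le]) simp
  qed simp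
  then have deg: "Polynomial.degree r < m" using assms m unfolding r_def
    by (intro le_less_trans [OF degree_diff_le_max]) auto
  have fr: "f r n = 0" if n: "n < m" for n
  proof -
    have "f r n = f p n - (\<Sum>c\<le>n. \<Sum>i<m. f p i * (acoef m n c * poly (bpol m i) (of_nat c)))"
      by (simp add: f_def [of _ n] r_def poly_sum right_diff_distrib sum_subtractf sum_distrib_left mult_ac)
    also have "(\<Sum>c\<le>n. \<Sum>i<m. f p i * (acoef m n c * poly (bpol m i) (of_nat c)))
        = (\<Sum>i<m. f p i * (\<Sum>c\<le>n. acoef m n c * poly (bpol m i) (of_nat c)))"
      by (subst sum.swap) (simp add: sum_distrib_left)
    also have "\<dots> = (\<Sum>i<m. if n = i then f p i else 0)"
      using n by (intro sum.cong) (auto simp: bpol_dual)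
    also have "\<dots> = f p n" using n by simp
    finally show ?thesis by simp
  qed
  have root: "poly r (of_nat n) = 0" if "n < m" for n
    using that
  proof (induction n rule: less_induct)
    case (less n)
    have "f r n = (\<Sum>c<n. acoef m n c * poly r (of_nat c)) + poly r (of_nat n)"
      unfolding f_def lessThan_Suc_atMost [symmetric] by (simp add: acoef_def)
    also have "(\<Sum>c<n. acoef m n c * poly r (of_nat c)) = 0"
      using less by (intro sum.neutral) auto
    finally show ?case using fr [OF less.prems] by simp
  qed
  have "r = 0"
  proof (rule ccontr)
    assume r: "r \<noteq> 0"
    have "of_nat ` {..<m} \<subseteq> {x. poly r x = 0}" using root by auto
    then have "card (of_nat ` {..<m} :: 'k set) \<le> card {x. poly r x = 0}"
      by (intro card_mono poly_roots_finite r)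
    also have "\<dots> \<le> Polynomial.degree r" by (rule card_poly_roots_bound [OF r])
    finally have "card (of_nat ` {..<m} :: 'k set) \<le> Polynomial.degree r" .
    then show False using deg by (simp add: card_image inj_on_def)
  qed
  then show ?thesis by (simp add: r_def f_def)
qed

section \<open>Divisibility by x and y in k[[x,y]]\<close>

lemma mon_ideal_x_dvd: "f \<in> mon_ideal {(a, b). n \<le> a} \<Longrightarrow> \<exists>g. f = germ_x ^ n * g"
  by (rule exI [of _ "Abs_fps (\<lambda>b. Abs_fps (\<lambda>a. cf f (a + n) b))"], rule cf_eqI)
     (auto simp: cf_germ_x_power_mult cf_Abs mon_idealD)

lemma germ_power_coprime:
  assumes "germ_x ^ n * a = germ_y ^ k * b"
  shows "\<exists>c. b = germ_x ^ n * c"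
proof (rule mon_ideal_x_dvd, rule mon_idealI)
  fix i j :: nat assume "(i, j) \<notin> {(i, j). n \<le> i}"
  then have "cf (germ_x ^ n * a) i (j + k) = 0" by (auto simp: cf_germ_x_power_mult)
  then show "cf b i j = 0" by (simp add: assms cf_germ_y_power_mult)
qed

lemma germ_division: "\<exists>g h. f = const2 (cf f 0 0) + germ_x * g + germ_y * h"
proof (intro exI, rule cf_eqI)
  fix a b
  show "cf f a b = cf (const2 (cf f 0 0) + germ_x * Abs_fps (\<lambda>b. Abs_fps (\<lambda>a. cf f (a + 1) b))
      + germ_y * Abs_fps (\<lambda>b. Abs_fps (\<lambda>a. if a = 0 then cf f 0 (b + 1) else 0))) a b"
    by (auto simp: cf_const2 cf_germ_x_mult cf_germ_y_mult cf_Abs)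
qed

lemma unit_fps:
  fixes f :: "'a::comm_ring_1 fps"
  assumes "fps_nth f 0 * c = 1"
  shows "\<exists>g. f * g = 1"
  using fps_right_inverse [OF assms] by blast

section \<open>The smoothing in the coordinates X and y, and its derivation\<close>

lemma deriv_germs:
  "deriv_x germ_x = (1 :: 'k::field fps fps)" "deriv_y germ_x = (0 :: 'k fps fps)"
  "deriv_x germ_y = (0 :: 'k fps fps)" "deriv_y germ_y = (1 :: 'k fps fps)"
proof -
  show "deriv_x germ_x = (1 :: 'k fps fps)" by (simp add: deriv_x_def germ_x_def coeff_map_const)
  show "deriv_y germ_x = (0 :: 'k fps fps)" by (simp add: deriv_y_def germ_x_def)
  have "coeff_map fps_deriv fps_X = (0 :: 'k fps fps)" by (rule fps_ext) (simp add: fps_X_def)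
  then show "deriv_x germ_y = (0 :: 'k fps fps)" by (simp add: deriv_x_def germ_y_def)
  show "deriv_y germ_y = (1 :: 'k fps fps)" by (simp add: deriv_y_def germ_y_def)
qed

text \<open>Here w = -1 / u, and X = x w is the coordinate with xy + tu = u (t - X y). The second
  equation makes the x-derivative w + x w_x of X invertible, with inverse \<open>v\<close>, so that
  X and y are again coordinates of the plane.\<close>

locale smoothing =
  fixes u w v :: "'k::field_char_0 fps fps"
  assumes uw: "u * w = - 1" and v: "v * (w + germ_x * deriv_x w) = 1"
begin

definition gx :: "'k fps fps" where "gx = germ_x * w"

definition t0 :: "'k fps fps" where "t0 = gx * germ_y"

definition Feq :: "'k fps fps fps"
  where "Feq = fps_const node + fps_X * fps_const u"

text \<open>With th y = -y prescribed, the coefficient \<alpha> of d/dx must solve \<alpha> (w + x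
  w_x) - x y w_y = x w in order that th X = X; the factor \<open>v\<close> performs the
  division.\<close>

definition th :: "'k fps fps \<Rightarrow> 'k fps fps"
  where "th = theta (germ_x * (w + germ_y * deriv_y w) * v) (- germ_y)"

definition D :: "'k fps fps fps fps fps \<Rightarrow> 'k fps fps fps fps fps"
  where "D = Theta (germ_x * (w + germ_y * deriv_y w) * v) (- germ_y)"

abbreviation lc :: "'k fps fps \<Rightarrow> 'k fps fps fps fps fps"
  where "lc g \<equiv> left_factor (fps_const g)"

abbreviation rc :: "'k fps fps \<Rightarrow> 'k fps fps fps fps fps"
  where "rc g \<equiv> right_factor (fps_const g)"

abbreviation eps :: "'k fps fps fps \<Rightarrow> 'k fps fps"
  where "eps \<equiv> ev t0"

lemma gx_mpow: "gx \<in> mpow 1" and t0_mpow: "t0 \<in> mpow 1"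
proof -
  show "gx \<in> mpow 1" unfolding gx_def by (intro mon_ideal_mult_right upset_deg germ_in_mpow)
  then show "t0 \<in> mpow 1" unfolding t0_def by (intro mon_ideal_mult_right upset_deg)
qed

lemmas eps_hom = rhomD [OF rhom_ev [OF t0_mpow]]

lemma eps_const [simp]: "eps (fps_const c) = c"
  by (rule ev_const [OF t0_mpow])

lemma th_hom: "derivn th"
  unfolding th_def by (rule derivn_theta)

lemma th_y: "th germ_y = - germ_y"
  by (simp add: th_def theta_def deriv_germs)

lemma th_gx: "th gx = gx"
proof -
  have "th gx = (v * (w + germ_x * deriv_x w)) * germ_x * (w + germ_y * deriv_y w) - germ_x * germ_y * deriv_y w"
    by (simp add: th_def theta_def gx_def derivnD [OF derivn_deriv_x] derivnD [OF derivn_deriv_y]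
        deriv_germs algebra_simps)
  then show ?thesis unfolding v by (simp add: gx_def algebra_simps)
qed

lemma th_const2: "th (const2 c) = 0"
  by (simp add: th_def theta_def deriv_x_def deriv_y_def const2_def coeff_map_const)

lemma th_gx_power: "th (gx ^ n) = of_nat n * gx ^ n"
proof (induction n)
  case (Suc n)
  then show ?case by (simp add: derivnD [OF th_hom] th_gx algebra_simps)
qed (simp add: derivnD [OF th_hom])

lemma th_y_power: "th (germ_y ^ n) = - of_nat n * germ_y ^ n"
proof (induction n)
  case (Suc n)
  then show ?case by (simp add: derivnD [OF th_hom] th_y algebra_simps)
qed (simp add: derivnD [OF th_hom])

lemma of_nat_const2: "of_nat n = const2 (of_nat n :: 'k)"
  by (induction n) simp_all

lemma th_monomial: "th (gx ^ i * germ_y ^ j) = const2 (of_nat i - of_nat j) * (gx ^ i * germ_y ^ j)"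
  by (simp add: derivnD [OF th_hom] th_gx_power th_y_power of_nat_const2 algebra_simps)

lemma th_t0: "th t0 = 0"
  using th_monomial [of 1 1] by (simp add: t0_def)

lemma Feq_eq: "Feq = fps_const u * (fps_X - fps_const t0)"
proof -
  have "u * t0 = (u * w) * node" by (simp add: t0_def gx_def node_def mult_ac)
  then have "u * t0 = - node" by (simp add: uw)
  then show ?thesis by (simp add: Feq_def right_diff_distrib mult.commute)
qed

lemma t_minus_t0: "fps_X - fps_const t0 = - fps_const w * Feq"
proof -
  have "- fps_const w * fps_const u = fps_const (- (u * w))" by (simp add: mult.commute)
  also have "\<dots> = 1" by (simp add: uw)
  finally have "- fps_const w * fps_const u = 1" .
  then show ?thesis by (simp add: Feq_eq flip: mult.assoc)
qed

text \<open>Up to a unit the equation of the total space is t - t0, so evaluation at t = t0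
  identifies its coordinate ring with k[[x,y]].\<close>

lemma eps_eq_0_iff: "eps s = 0 \<longleftrightarrow> Feq dvd s"
proof
  assume "eps s = 0"
  then obtain q where "s = (fps_X - fps_const t0) * q"
    using ev_division [OF t0_mpow, of s] by auto
  then show "Feq dvd s" by (simp add: t_minus_t0)
next
  assume "Feq dvd s"
  then show "eps s = 0" by (auto simp: Feq_eq eps_hom ev_X [OF t0_mpow])
qed

lemma Feq_dvd_diff_eps: "Feq dvd s - fps_const (eps s)"
  by (simp flip: eps_eq_0_iff add: eps_hom)

text \<open>As \<open>th\<close> annihilates t0, only the unit in front of t - t0 is differentiated.
  Hence the derivation is tangent to the total space, as the locale of relative derivations
  requires.\<close>

lemma coeff_map_th_Feq: "coeff_map th Feq = Feq * fps_const (- w * th u)"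
proof -
  have "coeff_map th (fps_X - fps_const t0) = 0"
    using th_t0 by (simp add: derivnD [OF derivn_coeff_map [OF th_hom]] coeff_map_const derivnD [OF th_hom])
      (rule fps_ext, simp add: fps_X_def derivnD [OF th_hom])
  then have "coeff_map th Feq = fps_const (th u) * (fps_X - fps_const t0)"
    by (simp add: Feq_eq derivnD [OF derivn_coeff_map [OF th_hom]] coeff_map_const derivnD [OF th_hom])
  then show ?thesis by (simp add: t_minus_t0 mult_ac)
qed

sublocale rel_derivation Feq D
proof
  show "derivn D" unfolding D_def by (rule derivn_Theta)
  show "D (left_factor s) = 0" for s unfolding D_def by (rule Theta_left)
  show "\<exists>c. D (right_factor Feq) = right_factor Feq * c"
    using coeff_map_th_Feq unfolding D_def Theta_right th_def
    by (auto simp: rhomD [OF rhom_right_factor])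
qed

lemma D_rc: "D (rc g) = rc (th g)"
  by (simp add: D_def Theta_right th_def coeff_map_const derivnD [OF derivn_theta])

lemma D_pow_rc: "(D ^^ i) (rc g) = rc ((th ^^ i) g)"
  by (induction i) (simp_all add: D_rc)

definition e :: "'k poly \<Rightarrow> 'k fps fps fps fps fps \<Rightarrow> 'k fps fps"
  where "e p \<tau> = eps (E p \<tau>)"

lemma e_add: "e p (\<sigma> + \<tau>) = e p \<sigma> + e p \<tau>"
  by (simp add: e_def E_add eps_hom)

lemma e_left: "e p (left_factor s * \<tau>) = eps s * e p \<tau>"
  by (simp add: e_def E_left eps_hom)

lemma e_lc: "e p (lc c * \<tau>) = c * e p \<tau>"
  by (simp add: e_left)

lemma e_0: "e p 0 = 0"
  using e_add [of p 0 0] by simp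

lemma e_diff: "e p (\<sigma> - \<tau>) = e p \<sigma> - e p \<tau>"
  using e_add [of p "\<sigma> - \<tau>" \<tau>] by simp

lemma e_sum: "e p (\<Sum>i\<in>A. \<tau> i) = (\<Sum>i\<in>A. e p (\<tau> i))"
  by (induction A rule: infinite_finite_induct) (simp_all add: e_0 e_add)

lemma e_Z: "\<tau> \<in> Z n \<Longrightarrow> degree p < n \<Longrightarrow> e p \<tau> = 0"
  unfolding e_def eps_eq_0_iff by (rule E_Z)

lemma e_rc: "e p (rc g) = (\<Sum>i\<le>Polynomial.degree p. const2 (coeff p i) * (th ^^ i) g)"
  by (simp add: e_def E_def D_pow_rc eps_hom)

text \<open>On an eigenvector the operator with polynomial \<open>p\<close> is multiplication by the
  value of \<open>p\<close> at the eigenvalue. Its action on monomials in X and y is thereby reduced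
  to binomial coefficients.\<close>

lemma e_eigen:
  assumes "th g = const2 c * g"
  shows "e p (rc g) = const2 (poly p c) * g"
proof -
  have "(th ^^ i) g = const2 (c ^ i) * g" for i
  proof (induction i)
    case (Suc i)
    then show ?case
      by (simp add: derivnD [OF th_hom] th_const2 assms mult_ac)
  qed simp
  then have "e p (rc g) = (\<Sum>i\<le>Polynomial.degree p. const2 (coeff p i * c ^ i)) * g"
    by (simp add: e_rc sum_distrib_right mult.assoc)
  then show ?thesis by (simp add: poly_altdef rhomD(8) [OF rhom_const2])
qed

lemma e_monomial: "e p (rc (gx ^ i * germ_y ^ j)) = const2 (poly p (of_nat i - of_nat j)) * (gx ^ i * germ_y ^ j)"
  by (rule e_eigen [OF th_monomial])

lemma E_degree_le: "Polynomial.degree p \<le> N \<Longrightarrow> E p \<tau> = (\<Sum>i\<le>N. fps_const (const2 (coeff p i)) * mu ((D ^^ i) \<tau>))"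
  unfolding E_def by (rule sum.mono_neutral_left) (auto simp: coeff_eq_0)

lemma e_poly_sum: "e (\<Sum>i\<in>A. smult (c i) (p i)) \<tau> = (\<Sum>i\<in>A. const2 (c i) * e (p i) \<tau>)"
proof -
  have add: "e (p + q) \<tau> = e p \<tau> + e q \<tau>" for p q
  proof -
    define N where "N = max (Polynomial.degree p) (Polynomial.degree q)"
    have "Polynomial.degree (p + q) \<le> N" "Polynomial.degree p \<le> N" "Polynomial.degree q \<le> N" by (auto simp: N_def degree_add_le_max)
    then show ?thesis
      by (simp add: e_def E_degree_le [of _ N] distrib_right sum.distrib flip: eps_hom(1) fps_const_add)
  qed
  have smult: "e (smult d p) \<tau> = const2 d * e p \<tau>" for d p
  proof -
    have "E (smult d p) \<tau> = fps_const (const2 d) * E p \<tau>"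
      by (subst E_degree_le [OF degree_smult_le]) (simp add: E_def sum_distrib_left mult.assoc flip: fps_const_mult)
    then show ?thesis by (simp add: e_def eps_hom)
  qed
  have "e 0 \<tau> = 0" by (simp add: e_def E_def eps_hom)
  then show ?thesis by (induction A rule: infinite_finite_induct) (simp_all add: add smult)
qed

text \<open>The polynomials \<open>bpol m i\<close> span all polynomials of degree below m, so their
  vanishing is that of every power D^l with l < m.\<close>

lemma Z_iff_e: "\<tau> \<in> Z m \<longleftrightarrow> (\<forall>i<m. e (bpol m i) \<tau> = 0)"
proof
  assume "\<tau> \<in> Z m"
  then show "\<forall>i<m. e (bpol m i) \<tau> = 0" by (auto intro!: e_Z degree_bpol)
next
  assume *: "\<forall>i<m. e (bpol m i) \<tau> = 0"
  have "Feq dvd mu ((D ^^ l) \<tau>)" if l: "l < m" for l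
  proof -
    have "Polynomial.degree (Polynomial.monom 1 l :: 'k poly) < m" using l by (simp add: degree_monom_eq)
    from arg_cong [OF bpol_span [OF this], of "\<lambda>p. e p \<tau>"]
    have "e (Polynomial.monom 1 l) \<tau> = 0"
      unfolding e_poly_sum using * by simp
    moreover have "E (Polynomial.monom 1 l) \<tau> = mu ((D ^^ l) \<tau>)"
      by (simp add: E_def degree_monom_eq if_distrib [of const2] if_distrib [of fps_const] if_distribR
          cong: if_cong) (simp add: sum.delta if_distrib [of "\<lambda>a. a * _"] cong: if_cong)
    ultimately show ?thesis by (simp add: e_def eps_eq_0_iff)
  qed
  then show "\<tau> \<in> Z m" by (simp add: Z_iff)
qed

end

section \<open>Elements with prescribed values, and the ideals containing the values of the
  operators\<close>

context smoothing
begin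

text \<open>
  On the dual basis \<open>bpol m 0, \<dots>, bpol m (m - 1)\<close>, the elements \<open>sig m n\<close> and \<open>rho m n\<close> take the
  values \<open>\<delta>\<^sub>i\<^sub>n gx\<^sup>n\<close> and \<open>\<delta>\<^sub>i\<^sub>n y\<^sup>m\<^sup>-\<^sup>n\<close>.  Both combinations are halves of the vanishing \<open>m\<close>-th
  difference of a polynomial of degree less than \<open>m\<close>.
\<close>

definition sig :: "nat \<Rightarrow> nat \<Rightarrow> 'k fps fps fps fps fps"
  where "sig m n = (\<Sum>c\<le>n. lc (const2 (acoef m n c) * gx ^ (n - c)) * rc (gx ^ c))"

definition rho :: "nat \<Rightarrow> nat \<Rightarrow> 'k fps fps fps fps fps"
  where "rho m n = (\<Sum>c=1..m - n.
    lc (const2 ((- 1) ^ (m - 1) * acoef m (m - n) c) * germ_y ^ (m - n - c)) * rc (germ_y ^ c))"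

lemma e_sig:
  assumes "i < m" "n < m"
  shows "e (bpol m i) (sig m n) = (if n = i then gx ^ n else 0)"
proof -
  have "e (bpol m i) (sig m n) =
      (\<Sum>c\<le>n. const2 (acoef m n c * poly (bpol m i) (of_nat c)) * gx ^ n)"
    unfolding sig_def e_sum e_lc
  proof (rule sum.cong [OF refl])
    fix c assume "c \<in> {..n}"
    then have "gx ^ (n - c) * gx ^ c = gx ^ n" by (simp flip: power_add)
    then show "const2 (acoef m n c) * gx ^ (n - c) * e (bpol m i) (rc (gx ^ c)) =
        const2 (acoef m n c * poly (bpol m i) (of_nat c)) * gx ^ n"
      using e_monomial [of "bpol m i" c 0] by (simp add: mult_ac)
  qed
  also have "\<dots> = const2 (\<Sum>c\<le>n. acoef m n c * poly (bpol m i) (of_nat c)) * gx ^ n"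
    unfolding rhomD(8) [OF rhom_const2] by (simp only: sum_distrib_right)
  also have "\<dots> = (if n = i then gx ^ n else 0)"
    unfolding bpol_dual [OF assms] by simp
  finally show ?thesis .
qed

lemma e_rho:
  assumes "i < m" "1 \<le> n" "n < m"
  shows "e (bpol m i) (rho m n) = (if n = i then germ_y ^ (m - n) else 0)"
proof -
  have "e (bpol m i) (rho m n) = (\<Sum>c=1..m - n. const2 ((- 1) ^ (m - 1) * acoef m (m - n) c *
      poly (bpol m i) (- of_nat c)) * germ_y ^ (m - n))"
    unfolding rho_def e_sum e_lc
  proof (rule sum.cong [OF refl])
    fix c assume "c \<in> {1..m - n}"
    then have "germ_y ^ (m - n - c) * germ_y ^ c = (germ_y ^ (m - n) :: 'k fps fps)"
      by (simp flip: power_add del: diff_diff_left)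
    then show "const2 ((- 1) ^ (m - 1) * acoef m (m - n) c) * germ_y ^ (m - n - c) * e (bpol m i) (rc (germ_y ^ c)) =
        const2 ((- 1) ^ (m - 1) * acoef m (m - n) c * poly (bpol m i) (- of_nat c)) * germ_y ^ (m - n)"
      using e_monomial [of "bpol m i" 0 c] by (simp add: mult_ac)
  qed
  also have "\<dots> = const2 (\<Sum>c=1..m - n. (- 1) ^ (m - 1) * acoef m (m - n) c *
      poly (bpol m i) (- of_nat c)) * germ_y ^ (m - n)"
    unfolding rhomD(8) [OF rhom_const2] by (simp only: sum_distrib_right)
  also have "\<dots> = (if n = i then germ_y ^ (m - n) else 0)"
    unfolding bpol_dual_neg [OF assms] by simp
  finally show ?thesis .
qed

text \<open>Polynomials in X and y: combinations of eigenvectors of \<open>th\<close>. The monomials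
  in x and y need not be eigenvectors, because x differs from X by a unit.\<close>

inductive_set PXY :: "'k fps fps set"
  where
    mono: "const2 c * (gx ^ a * germ_y ^ b) \<in> PXY"
  | add: "f \<in> PXY \<Longrightarrow> g \<in> PXY \<Longrightarrow> f + g \<in> PXY"

lemma PXY_gx: "f \<in> PXY \<Longrightarrow> gx * f \<in> PXY"
proof (induction rule: PXY.induct)
  case (mono c a b)
  have "gx * (const2 c * (gx ^ a * germ_y ^ b)) = const2 c * (gx ^ Suc a * germ_y ^ b)" by (simp add: mult_ac)
  then show ?case by (simp only: PXY.mono)
qed (simp add: distrib_left PXY.add)

lemma PXY_y: "f \<in> PXY \<Longrightarrow> germ_y * f \<in> PXY"
proof (induction rule: PXY.induct)
  case (mono c a b)
  have "germ_y * (const2 c * (gx ^ a * germ_y ^ b)) = const2 c * (gx ^ a * germ_y ^ Suc b)" by (simp add: mult_ac)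
  then show ?case by (simp only: PXY.mono)
qed (simp add: distrib_left PXY.add)

lemma PXY_const: "const2 c \<in> PXY"
  using PXY.mono [of c 0 0] by simp

lemma germ_x_eq: "germ_x = - u * gx"
proof -
  have "- u * gx = - (u * w) * germ_x" by (simp add: gx_def mult_ac)
  then show ?thesis by (simp add: uw)
qed

text \<open>Split off the constant term, replace x by -u X, and approximate the two cofactors one
  order lower.\<close>

lemma PXY_dense: "\<exists>f\<in>PXY. g - f \<in> mpow n"
proof (induction n arbitrary: g)
  case 0
  then show ?case using PXY_const by auto
next
  case (Suc n)
  obtain p q where g: "g = const2 (cf g 0 0) + germ_x * p + germ_y * q" using germ_division by blast
  obtain p' where p': "p' \<in> PXY" "- u * p - p' \<in> mpow n" using Suc by blast
  obtain q' where q': "q' \<in> PXY" "q - q' \<in> mpow n" using Suc by blast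
  have "g - (const2 (cf g 0 0) + gx * p' + germ_y * q') = gx * (- u * p - p') + germ_y * (q - q')"
    using g by (subst (1) g) (simp add: germ_x_eq algebra_simps)
  moreover have "gx * (- u * p - p') + germ_y * (q - q') \<in> mpow (1 + n)"
    by (intro mon_ideal_add mpow_mult gx_mpow germ_in_mpow p' q')
  moreover have "const2 (cf g 0 0) + gx * p' + germ_y * q' \<in> PXY"
    by (intro PXY.add PXY_const PXY_gx PXY_y p' q')
  ultimately show ?case by (metis plus_1_eq_Suc)
qed

text \<open>Both components of \<open>th\<close> have the form x d/dx or y d/dy times a series, so
  the order of a series does not drop and approximation commutes with the operators.\<close>

lemma th_mpow: "f \<in> mpow n \<Longrightarrow> th f \<in> mpow n"
proof -
  assume f: "f \<in> mpow n"
  have "germ_x * deriv_x f \<in> mpow n"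
    using f by (intro mon_idealI) (auto simp: cf_germ_x_mult, auto simp: cf_def deriv_x_def mon_ideal_def)
  moreover have "germ_y * deriv_y f \<in> mpow n"
    using f by (intro mon_idealI) (auto simp: cf_germ_y_mult,
        auto simp: cf_def deriv_y_def mon_ideal_def fps_of_nat [symmetric] simp del: fps_of_nat)
  moreover have "th f = ((w + germ_y * deriv_y w) * v) * (germ_x * deriv_x f) + (- 1) * (germ_y * deriv_y f)"
    by (simp add: th_def theta_def mult_ac)
  ultimately show "th f \<in> mpow n"
    by (metis mon_ideal_add mon_ideal_mult_left [OF upset_deg])
qed

text \<open>Exponents of the monomials in the ideal (x^i, y^(m-i)).\<close>

abbreviation (in -) corner :: "nat \<Rightarrow> nat \<Rightarrow> (nat \<times> nat) set"
  where "corner m i \<equiv> {(a, b). i \<le> a \<or> m - i \<le> b}"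

lemma upset_corner: "upset (corner m i)"
  by (auto simp: upset_def)

lemma gx_power_in: "upset U \<Longrightarrow> (\<And>b. (a, b) \<in> U) \<Longrightarrow> gx ^ a * f \<in> mon_ideal U"
proof -
  assume U: "upset U" "\<And>b. (a, b) \<in> U"
  have "germ_x ^ a * (w ^ a * f) \<in> mon_ideal U"
  proof (rule mon_idealI)
    fix i j assume "(i, j) \<notin> U"
    then have "i < a" using U(2) [of j] U(1) unfolding upset_def
      by (metis add.right_neutral le_Suc_ex not_le)
    then show "cf (germ_x ^ a * (w ^ a * f)) i j = 0" by (simp add: cf_germ_x_power_mult)
  qed
  then show ?thesis by (simp add: gx_def power_mult_distrib mult_ac)
qed

lemma gy_power_in: "upset U \<Longrightarrow> (\<And>a. (a, b) \<in> U) \<Longrightarrow> germ_y ^ b * f \<in> mon_ideal U"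
proof (rule mon_idealI)
  fix i j assume U: "upset U" "\<And>a. (a, b) \<in> U" "(i, j) \<notin> U"
  then have "j < b" using U(2) [of i] U(1) unfolding upset_def
    by (metis add.right_neutral le_Suc_ex not_le)
  then show "cf (germ_y ^ b * f) i j = 0" by (simp add: cf_germ_y_power_mult)
qed

text \<open>Outside the corner a < i and b < m - i, so the weight a - b is one of the m - 1 roots of
  \<open>bpol m i\<close>; the two cases below are the signs of this weight.\<close>

lemma e_bpol_monomial:
  assumes "i < m"
  shows "e (bpol m i) (rc (gx ^ a * germ_y ^ b)) \<in> mon_ideal (corner m i)"
proof (cases "i \<le> a \<or> m - i \<le> b")
  case True
  then show ?thesis
  proof
    assume a: "i \<le> a"
    have "gx ^ a * germ_y ^ b \<in> mon_ideal (corner m i)"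
      by (intro gx_power_in upset_corner) (use a in auto)
    then show ?thesis unfolding e_monomial by (rule mon_ideal_mult_left [OF upset_corner])
  next
    assume b: "m - i \<le> b"
    have "germ_y ^ b * gx ^ a \<in> mon_ideal (corner m i)"
      by (intro gy_power_in upset_corner) (use b in auto)
    then have "gx ^ a * germ_y ^ b \<in> mon_ideal (corner m i)" by (simp only: mult.commute)
    then show ?thesis unfolding e_monomial by (rule mon_ideal_mult_left [OF upset_corner])
  qed
next
  case False
  have "poly (bpol m i) (of_nat a - of_nat b :: 'k) = 0"
  proof (cases "b \<le> a")
    case True
    have "a - b + (m - 1 - i) < m - 1" using False assms by auto
    then show ?thesis using True poly_bpol_nat [of m i "a - b"]
      by (simp add: of_nat_diff binomial_eq_0 del: Nat.add_diff_assoc2)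
  next
    case b: False
    have "b - a + i - 1 < m - 1" using False b assms by auto
    moreover have "1 \<le> b - a" using b by auto
    ultimately show ?thesis using b assms poly_bpol_neg [of i m "b - a"]
      by (simp add: of_nat_diff binomial_eq_0 del: Nat.add_diff_assoc2)
  qed
  then show ?thesis unfolding e_monomial by simp
qed

lemma e_bpol_rc:
  assumes i: "i < m"
  shows "e (bpol m i) (rc g) \<in> mon_ideal (corner m i)"
proof -
  obtain f where f: "f \<in> PXY" "g - f \<in> mpow m" using PXY_dense by blast
  have "e (bpol m i) (rc f) \<in> mon_ideal (corner m i)"
    using f(1)
  proof (induction rule: PXY.induct)
    case (mono c a b)
    have "e (bpol m i) (rc (const2 c * (gx ^ a * germ_y ^ b))) = const2 c * e (bpol m i) (rc (gx ^ a * germ_y ^ b))"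
    proof -
      have "(th ^^ l) (const2 c * g) = const2 c * (th ^^ l) g" for l g
        by (induction l) (simp_all add: derivnD [OF th_hom] th_const2)
      then show ?thesis by (simp only: e_rc sum_distrib_left mult.left_commute)
    qed
    then show ?case using e_bpol_monomial [OF i, of a b] mon_ideal_mult_left [OF upset_corner] by metis
  next
    case (add f g)
    have "rc (f + g) = rc f + rc g" by (simp add: rhomD [OF rhom_right_factor] flip: fps_const_add)
    then show ?case using add by (simp add: e_add mon_ideal_add)
  qed
  moreover have "e (bpol m i) (rc (g - f)) \<in> mon_ideal (corner m i)"
  proof -
    have "(th ^^ l) (g - f) \<in> mpow m" for l
      by (induction l) (simp_all add: f(2) th_mpow)
    then have "e (bpol m i) (rc (g - f)) \<in> mpow m"
      unfolding e_rc by (intro mon_ideal_sum mon_ideal_mult_left upset_deg) auto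
    \<comment> \<open>An error of order m is harmless: a + b >= m forces a >= i or b >= m -
      i.\<close>
    then show ?thesis by (rule mon_ideal_mono) auto
  qed
  moreover have "rc g = rc f + rc (g - f)" by (simp flip: rhomD [OF rhom_right_factor] fps_const_add fps_const_sub)
  ultimately show ?thesis by (simp add: e_add mon_ideal_add)
qed

text \<open>Approximation by \<open>LR\<close> modulo \<open>Z m\<close> does not change the value,
  and linearity over the left factor leaves only functions of the right variables.\<close>

lemma e_bpol_in_corner:
  assumes i: "i < m"
  shows "e (bpol m i) \<tau> \<in> mon_ideal (corner m i)"
proof -
  obtain \<sigma> where \<sigma>: "\<sigma> \<in> LR" "\<tau> - \<sigma> \<in> Z m" using taylor by blast
  have "e (bpol m i) \<sigma> \<in> mon_ideal (corner m i)"
    using \<sigma>(1)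
  proof (induction rule: LR.induct)
    case (gen s g)
    then show ?case unfolding e_left by (intro mon_ideal_mult_left upset_corner e_bpol_rc i)
  qed (simp add: e_add mon_ideal_add)
  moreover have "e (bpol m i) (\<tau> - \<sigma>) = 0"
    using i by (intro e_Z [OF \<sigma>(2)] degree_bpol) simp
  ultimately show ?thesis by (simp add: e_diff)
qed

text \<open>The difference of the two copies of \<open>gx\<close>; inverting \<open>gx\<close>, it generates the diagonal ideal.\<close>

definition zeta :: "'k fps fps fps fps fps"
  where "zeta = rc gx - lc gx"

lemma zeta_in_Z_1: "zeta \<in> Z 1"
  by (simp add: zeta_def rhomD [OF rhom_mu])

lemma D_zeta: "D zeta = rc gx"
  by (simp add: zeta_def derivnD [OF D] D_rc D_left th_gx)

section \<open>Torsion of the principal parts and their linear forms\<close>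

lemma rc_hom: "rc (f + g) = rc f + rc g" "rc (f - g) = rc f - rc g" "rc (f * g) = rc f * rc g" "rc (- f) = - rc f" "rc 1 = 1"
  and lc_hom: "lc (f + g) = lc f + lc g" "lc (f - g) = lc f - lc g" "lc (f * g) = lc f * lc g" "lc (- f) = - lc f" "lc 1 = 1"
  by (simp_all add: rhomD [OF rhom_right_factor] rhomD [OF rhom_left_factor]
      flip: fps_const_add fps_const_sub fps_const_mult fps_const_neg)

text \<open>The constant term of 1 - X q is a unit; this is passed up through the nested power
  series rings, one variable at a time.\<close>

lemma left_unit: "\<exists>q'. (1 - lc gx * q) * q' = 1"
proof -
  have "\<exists>c. (1 - gx * r) * c = 1" for r
    using gx_mpow mon_ideal_mult_right [OF upset_deg gx_mpow, of r]
    by (intro unit_if_cf_nonzero) (simp add: cf_1 flip: mpow_1_iff, simp add: mpow_1_iff [unfolded One_nat_def])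
  then have "\<exists>c. fps_nth (1 - fps_const gx * r) 0 * c = 1" for r
    by simp
  then have "\<exists>c. (1 - fps_const gx * r) * c = 1" for r by (metis unit_fps)
  then have "\<exists>c. fps_nth (1 - const2 gx * r) 0 * c = 1" for r
    by (simp add: const2_def)
  then have "\<exists>c. (1 - const2 gx * r) * c = 1" for r by (metis unit_fps)
  then have "\<exists>c. fps_nth (1 - lc gx * r) 0 * c = 1" for r
    by (simp add: left_factor_const)
  then show ?thesis by (metis unit_fps)
qed

text \<open>The ideal of the fibre product of the total space with itself, kept as an explicit set
  so that congruences can be computed on power series.\<close>

definition NF :: "'k fps fps fps fps fps set"
  where "NF = {left_factor Feq * a + right_factor Feq * b |a b. True}"

lemma NF_add: "p \<in> NF \<Longrightarrow> q \<in> NF \<Longrightarrow> p + q \<in> NF"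
proof -
  have "left_factor Feq * a + right_factor Feq * b + (left_factor Feq * a' + right_factor Feq * b')
      = left_factor Feq * (a + a') + right_factor Feq * (b + b')" for a b a' b'
    by (simp add: algebra_simps)
  then show "p \<in> NF \<Longrightarrow> q \<in> NF \<Longrightarrow> p + q \<in> NF" unfolding NF_def by fastforce
qed

lemma NF_mult: "p \<in> NF \<Longrightarrow> q * p \<in> NF"
proof -
  have "q * (left_factor Feq * a + right_factor Feq * b) = left_factor Feq * (q * a) + right_factor Feq * (q * b)" for a b
    by (simp add: algebra_simps)
  then show "p \<in> NF \<Longrightarrow> q * p \<in> NF" unfolding NF_def by auto
qed

lemma NF_gen: "left_factor Feq \<in> NF" "right_factor Feq \<in> NF"
proof -
  have "left_factor Feq = left_factor Feq * 1 + right_factor Feq * 0"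
    "right_factor Feq = left_factor Feq * 0 + right_factor Feq * 1" by simp_all
  then show "left_factor Feq \<in> NF" "right_factor Feq \<in> NF" unfolding NF_def by blast+
qed

lemma NF_Z: "p \<in> NF \<Longrightarrow> p \<in> Z n"
  unfolding NF_def using Z_F [of n] by (auto intro!: Z_add simp: mult.commute [of "left_factor Feq"] mult.commute [of "right_factor Feq"] intro: Z_mult)

text \<open>Both factors share the same t, and each equation says t = t0 in its own
  variables.\<close>

lemma rc_t0_diff: "rc t0 - lc t0 \<in> NF"
proof -
  have l: "left_factor fps_X - lc t0 = - lc w * left_factor Feq"
    using arg_cong [OF t_minus_t0, of left_factor]
    by (simp add: rhomD [OF rhom_left_factor] del: fps_const_neg)
  have r: "right_factor fps_X - rc t0 = - rc w * right_factor Feq"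
    using arg_cong [OF t_minus_t0, of right_factor]
    by (simp add: rhomD [OF rhom_right_factor] del: fps_const_neg)
  have X: "right_factor fps_X = (left_factor fps_X :: 'k fps fps fps fps fps)"
    by (simp add: right_factor_def left_factor_def coeff_map_X rhomD [OF rhom_right0])
  have "rc t0 - lc t0 = (left_factor fps_X - lc t0) - (right_factor fps_X - rc t0)" by (simp add: X)
  also have "\<dots> = - lc w * left_factor Feq + rc w * right_factor Feq" unfolding l r by simp
  finally show ?thesis by (simp only: NF_add NF_mult NF_gen)
qed

text \<open>The diagonal ideal is generated by xi and eta. Multiplied by X_1, both become multiples
  of zeta modulo the equations, so one factor X_1 is the price for replacing two generators by
  one.\<close>

lemma left_gx_ker:
  assumes "Feq dvd mu \<tau>"
  shows "\<exists>q. lc gx * \<tau> - zeta * q \<in> NF"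
proof -
  \<comment> \<open>X_1 (y_2 - y_1) = -(X_2 - X_1) y_2 + (X_2 y_2 - X_1 y_1), and the last bracket
    is the difference of the two copies of t0.\<close>
  have eta: "\<exists>n\<in>NF. lc gx * eta = - zeta * rc germ_y + n"
  proof
    show "lc gx * eta = - zeta * rc germ_y + (rc t0 - lc t0)"
      by (simp add: t0_def rc_hom lc_hom zeta_def algebra_simps)
  qed (rule rc_t0_diff)
  then obtain n1 where n1: "n1 \<in> NF" "lc gx * eta = - zeta * rc germ_y + n1" by blast
  obtain a b where ab: "rc (- u) = left_factor (mu (rc (- u))) + xi * a + eta * b" using mu_division by blast
  \<comment> \<open>From x = -u X. The difference of the two copies of -u is again a combination of
    xi and eta, which yields a linear equation for xi whose coefficient 1 - X_1 a is a unit.\<close>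
  have xi: "xi = zeta * rc (- u) + lc gx * (xi * a + eta * b)"
  proof -
    have "xi = rc (gx * (- u)) - lc (gx * (- u))" using germ_x_eq by (simp add: mult.commute)
    also have "\<dots> = zeta * rc (- u) + lc gx * (rc (- u) - lc (- u))"
      unfolding rc_hom(3) lc_hom(3) zeta_def by (simp add: algebra_simps)
    also have "rc (- u) - lc (- u) = xi * a + eta * b"
    proof -
      have "rc (- u) = lc (- u) + xi * a + eta * b" using ab unfolding mu_right .
      then have "rc (- u) - lc (- u) = lc (- u) + xi * a + eta * b - lc (- u)" by (rule arg_cong)
      then show ?thesis by (simp only: add.assoc add_diff_cancel_left')
    qed
    finally show ?thesis .
  qed
  obtain a' where a': "(1 - lc gx * a) * a' = 1" using left_unit by blast
  have 1: "(1 - lc gx * a) * xi = zeta * rc (- u) + (lc gx * eta) * b"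
  proof -
    have lin: "(1 - g * a) * x = z + (g * y) * b" if "x = z + g * (x * a + y * b)"
      for g x y z :: "'k fps fps fps fps fps"
      using arg_cong [OF that, of "\<lambda>s. s - g * a * x"] by (simp add: algebra_simps)
    show ?thesis by (rule lin [OF xi])
  qed
  have xi2: "xi = zeta * (a' * (rc (- u) - rc germ_y * b)) + (a' * b) * n1"
  proof -
    have lin: "x = z * (p * (U - y * b)) + (p * b) * n"
      if "B * p = 1" "B * x = z * U + et * b" "et = - z * y + n"
      for B p x z U et b n y :: "'k fps fps fps fps fps"
    proof -
      have "x = p * (B * x)" using that(1) by (simp add: mult.assoc [symmetric] mult.commute)
      then show ?thesis unfolding that(2,3) by (simp add: algebra_simps)
    qed
    show ?thesis by (rule lin [OF a' 1 n1(2)])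
  qed
  obtain q r where \<tau>: "\<tau> = left_factor (mu \<tau>) + xi * q + eta * r" using mu_division by blast
  obtain s where s: "mu \<tau> = Feq * s" using assms by blast
  have "lc gx * \<tau> - zeta * (lc gx * (a' * (rc (- u) - rc germ_y * b)) * q - rc germ_y * r)
      = lc gx * left_factor s * left_factor Feq + (lc gx * a' * b * q) * n1 + r * n1"
  proof -
    have lin: "g * T - z * (g * A * q - y * r) = g * S * H + (g * B * q) * n + r * n"
      if "T = H * S + x * q + et * r" "x = z * A + B * n" "g * et = - z * y + n"
      for g T z A q y r S H B n x et :: "'k fps fps fps fps fps"
    proof -
      have "g * T = g * S * H + g * x * q + (g * et) * r" unfolding that(1) by (simp add: algebra_simps)
      then show ?thesis unfolding that(2,3) by (simp add: algebra_simps)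
    qed
    have \<tau>': "\<tau> = left_factor Feq * left_factor s + xi * q + eta * r"
      using \<tau> by (simp add: s rhomD [OF rhom_left_factor])
    show ?thesis using lin [OF \<tau>' xi2 n1(2)] by (simp add: mult.assoc)
  qed
  moreover have "\<dots> \<in> NF" by (intro NF_add NF_mult NF_gen n1)
  ultimately show ?thesis by metis
qed

text \<open>One differentiation lowers the exponent: D (zeta^(k+1) q) is (k + 1) X_2 zeta^k q plus a
  term in \<open>Z (k + 1)\<close>. On the diagonal the factor (k + 1) X is nonzero in a domain of
  characteristic 0 and can be cancelled.\<close>

lemma zeta_power_Z: "zeta ^ k * q \<in> Z (Suc k) \<Longrightarrow> Feq dvd mu q"
proof (induction k arbitrary: q)
  case (Suc k)
  have "D (zeta ^ Suc k * q) \<in> Z (Suc k)" using Suc.prems by simp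
  moreover have "D (zeta ^ Suc k * q) = zeta ^ k * (of_nat (Suc k) * rc gx * q) + zeta ^ Suc k * D q"
    by (simp only: derivnD(2) [OF D] derivn_power [OF D] D_zeta mult_ac add.commute)
  moreover have "zeta ^ Suc k * D q \<in> Z (Suc k)"
    using Z_mult [OF Z_power [OF zeta_in_Z_1], of "D q" "Suc k"] by (simp add: mult.commute del: Z.simps power_Suc)
  ultimately have "zeta ^ k * (of_nat (Suc k) * rc gx * q) \<in> Z (Suc k)"
    using Z_add [of "zeta ^ k * (of_nat (Suc k) * rc gx * q) + zeta ^ Suc k * D q" "Suc k"
        "- (zeta ^ Suc k * D q)"] Z_uminus [of "zeta ^ Suc k * D q" "Suc k"]
    by (simp del: Z.simps power_Suc of_nat_Suc)
  then have "Feq dvd mu (of_nat (Suc k) * rc gx * q)" by (rule Suc.IH)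
  then have "eps (mu (of_nat (Suc k) * rc gx * q)) = 0" by (simp only: eps_eq_0_iff)
  moreover have "mu (of_nat n :: 'k fps fps fps fps fps) = of_nat n" for n by (induction n) (simp_all add: rhomD [OF rhom_mu])
  moreover have "eps (of_nat n :: 'k fps fps fps) = of_nat n" for n by (induction n) (simp_all add: eps_hom)
  moreover have "gx \<noteq> 0"
    using v uw by (auto simp: gx_def germ_x_def)
  ultimately have "eps (mu q) = 0" by (simp add: rhomD [OF rhom_mu] eps_hom del: of_nat_Suc)
  then show ?case by (simp only: eps_eq_0_iff)
qed simp

text \<open>Alternate the two preceding facts: the cofactor of zeta^k vanishes on the diagonal, and
  a further factor X_1 extracts one more zeta from it. So \<open>Z m\<close> and the m-th power of
  the diagonal ideal agree once X is inverted.\<close>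

lemma Z_torsion:
  assumes "\<tau> \<in> Z m"
  shows "\<exists>q. lc gx ^ m * \<tau> - zeta ^ m * q \<in> NF"
proof -
  have "\<exists>q. lc gx ^ k * \<tau> - zeta ^ k * q \<in> NF" if "k \<le> m" for k
    using that
  proof (induction k)
    case 0
    have "lc gx ^ 0 * \<tau> - zeta ^ 0 * \<tau> \<in> NF" using NF_mult [OF NF_gen(1), of 0] by simp
    then show ?case ..
  next
    case (Suc k)
    then obtain q where q: "lc gx ^ k * \<tau> - zeta ^ k * q \<in> NF" by auto
    have "lc gx ^ k * \<tau> \<in> Z (Suc k)" by (rule Z_mult) (rule Z_le [OF Suc.prems assms])
    then have "lc gx ^ k * \<tau> + - (lc gx ^ k * \<tau> - zeta ^ k * q) \<in> Z (Suc k)"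
      by (rule Z_add [OF _ Z_uminus [OF NF_Z [OF q]]])
    then have "Feq dvd mu q" by (intro zeta_power_Z [of k]) (simp del: Z.simps)
    then obtain r where r: "lc gx * q - zeta * r \<in> NF" using left_gx_ker by blast
    have "lc gx ^ Suc k * \<tau> - zeta ^ Suc k * r =
        lc gx * (lc gx ^ k * \<tau> - zeta ^ k * q) + zeta ^ k * (lc gx * q - zeta * r)"
      by (simp add: algebra_simps)
    then show ?case using q r by (metis NF_add NF_mult)
  qed
  then show ?thesis by blast
qed

text \<open>Linear forms on the principal parts, pulled back to power series and transported to
  k[[x,y]]. Of the diagonal power only zeta^m is imposed; the left equation is killed through eps
  Feq = 0.\<close>

definition linear_form :: "nat \<Rightarrow> ('k fps fps fps fps fps \<Rightarrow> 'k fps fps) \<Rightarrow> bool"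
  where "linear_form m \<Phi> \<longleftrightarrow> (\<forall>\<sigma> \<tau>. \<Phi> (\<sigma> + \<tau>) = \<Phi> \<sigma> + \<Phi> \<tau>) \<and>
    (\<forall>s \<tau>. \<Phi> (left_factor s * \<tau>) = eps s * \<Phi> \<tau>) \<and>
    (\<forall>\<tau>. \<Phi> (zeta ^ m * \<tau>) = 0) \<and> (\<forall>\<tau>. \<Phi> (right_factor Feq * \<tau>) = 0)"

lemma gx_nonzero: "gx \<noteq> 0"
  using v uw by (auto simp: gx_def germ_x_def)

text \<open>By \<open>Z_torsion\<close>, X^m times the element is a combination of terms killed by
  the form, and X^m can be cancelled in the domain k[[x,y]].\<close>

lemma linear_form_eq_0:
  assumes \<Phi>: "linear_form m \<Phi>" and "\<And>i. i < m \<Longrightarrow> e (bpol m i) \<tau> = 0"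
  shows "\<Phi> \<tau> = 0"
proof -
  have add: "\<Phi> (\<sigma> + \<tau>) = \<Phi> \<sigma> + \<Phi> \<tau>" and left: "\<Phi> (left_factor s * \<tau>) = eps s * \<Phi> \<tau>"
    and 0: "\<Phi> (zeta ^ m * \<tau>) = 0" "\<Phi> (right_factor Feq * \<tau>) = 0" for s \<sigma> \<tau>
    using \<Phi> by (simp_all add: linear_form_def)
  have "\<tau> \<in> Z m" using assms(2) by (simp add: Z_iff_e)
  then obtain q where "lc gx ^ m * \<tau> - zeta ^ m * q \<in> NF" using Z_torsion by blast
  then obtain a b where ab: "lc gx ^ m * \<tau> - zeta ^ m * q = left_factor Feq * a + right_factor Feq * b"
    unfolding NF_def by auto
  then have "lc gx ^ m * \<tau> = left_factor Feq * a + right_factor Feq * b + zeta ^ m * q"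
    by (simp add: diff_eq_eq)
  then have "\<Phi> (lc gx ^ m * \<tau>) = 0"
    using eps_eq_0_iff [of Feq] by (simp add: add left 0)
  moreover have "lc gx ^ m = lc (gx ^ m)"
    by (simp flip: rhomD [OF rhom_left_factor] fps_const_power)
  ultimately show ?thesis using gx_nonzero by (simp add: left)
qed

lemma linear_form_e: "m \<ge> 1 \<Longrightarrow> linear_form m (e (bpol m i))"
  unfolding linear_form_def
proof (intro conjI allI)
  fix \<tau> assume m: "m \<ge> 1"
  show "e (bpol m i) (zeta ^ m * \<tau>) = 0"
    using Z_mult [OF Z_power [OF zeta_in_Z_1], of \<tau> m] by (intro e_Z [OF _ degree_bpol [OF m]]) (simp add: mult.commute)
  show "e (bpol m i) (right_factor Feq * \<tau>) = 0"
    using Z_mult [OF Z_F(2), of \<tau> m] by (intro e_Z [OF _ degree_bpol [OF m]]) (simp add: mult.commute)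
qed (simp_all add: e_add e_left)

lemma linear_form_diff:
  assumes "linear_form m \<Phi>" "\<And>i. i \<in> A \<Longrightarrow> linear_form m (\<Psi> i)"
  shows "linear_form m (\<lambda>\<tau>. \<Phi> \<tau> - (\<Sum>i\<in>A. c i * \<Psi> i \<tau>))"
  using assms unfolding linear_form_def
  by (simp add: sum.distrib distrib_left right_diff_distrib sum_distrib_left mult_ac)

text \<open>The value on \<open>sig m n\<close> must be X^n times the n-th coefficient, so the
  coefficient exists once X^n divides this value; subtracting the resulting combination leaves a
  form that vanishes on every \<open>sig m n\<close>.\<close>

lemma linear_form_span:
  assumes \<Phi>: "linear_form m \<Phi>"
  shows "\<exists>c. \<forall>\<tau>. \<Phi> \<tau> = (\<Sum>i<m. c i * e (bpol m i) \<tau>)"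
proof (cases "m = 0")
  case True
  have "\<Phi> \<tau> = 0" for \<tau> by (rule linear_form_eq_0 [OF \<Phi>]) (simp add: True)
  then show ?thesis by (simp add: True)
next
  case False
  then have m: "m \<ge> 1" by simp
  have left: "\<Phi> (left_factor s * \<tau>) = eps s * \<Phi> \<tau>" for s \<tau>
    using \<Phi> by (simp add: linear_form_def)
  have "\<exists>c. \<Phi> (sig m n) = gx ^ n * c" if n: "n < m" for n
  proof (cases "n = 0")
    case False
    \<comment> \<open>Both terms take the value X^n y^(m-n) at index n and 0 elsewhere. The form
      vanishes on their difference, and coprimality of x^n and y^(m-n) gives the
      divisibility.\<close>
    let ?\<tau> = "lc (germ_y ^ (m - n)) * sig m n - lc (gx ^ n) * rho m n"
    have "\<Phi> ?\<tau> = 0"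
      using n False by (intro linear_form_eq_0 [OF \<Phi>]) (auto simp: e_diff e_lc e_sig e_rho)
    moreover have "\<Phi> (lc (germ_y ^ (m - n)) * sig m n) = \<Phi> ?\<tau> + \<Phi> (lc (gx ^ n) * rho m n)"
      using \<Phi> unfolding linear_form_def by (metis diff_add_cancel)
    ultimately have "germ_y ^ (m - n) * \<Phi> (sig m n) = gx ^ n * \<Phi> (rho m n)"
      by (simp add: left)
    then have "germ_x ^ n * (w ^ n * \<Phi> (rho m n)) = germ_y ^ (m - n) * \<Phi> (sig m n)"
      by (simp add: gx_def power_mult_distrib mult_ac)
    from germ_power_coprime [OF this] obtain c where "\<Phi> (sig m n) = germ_x ^ n * c" by blast
    then have "\<Phi> (sig m n) = gx ^ n * ((- u) ^ n * c)"
      by (subst (asm) germ_x_eq) (simp only: power_mult_distrib mult_ac)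
    then show ?thesis ..
  qed simp
  then obtain c where c: "\<Phi> (sig m n) = gx ^ n * c n" if "n < m" for n by metis
  define \<Psi> where "\<Psi> \<tau> = \<Phi> \<tau> - (\<Sum>i<m. c i * e (bpol m i) \<tau>)" for \<tau>
  have \<Psi>: "linear_form m \<Psi>"
    unfolding \<Psi>_def by (rule linear_form_diff [OF \<Phi> linear_form_e [OF m]])
  have \<Psi>_sig: "\<Psi> (sig m n) = 0" if "n < m" for n
  proof -
    have "(\<Sum>i<m. c i * e (bpol m i) (sig m n)) = (\<Sum>i<m. if n = i then c i * gx ^ n else 0)"
      using that by (intro sum.cong) (auto simp: e_sig)
    then show ?thesis using that by (simp add: \<Psi>_def c)
  qed
  have "\<Psi> \<tau> = 0" for \<tau>
  proof -
    \<comment> \<open>The elements \<open>sig m i\<close> reproduce the values of X^m \<tau>: the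
      missing power X^(m-i) is supplied by the coefficient.\<close>
    let ?S = "\<Sum>i<m. lc (gx ^ (m - i) * e (bpol m i) \<tau>) * sig m i"
    have "e (bpol m l) (lc (gx ^ m) * \<tau> - ?S) = 0" if l: "l < m" for l
    proof -
      have "e (bpol m l) ?S = (\<Sum>i<m. if i = l then gx ^ m * e (bpol m i) \<tau> else 0)"
        unfolding e_sum e_lc
      proof (rule sum.cong [OF refl])
        fix i assume "i \<in> {..<m}"
        then have "gx ^ m = gx ^ (m - i) * gx ^ i" by (simp flip: power_add)
        then show "gx ^ (m - i) * e (bpol m i) \<tau> * e (bpol m l) (sig m i) =
            (if i = l then gx ^ m * e (bpol m i) \<tau> else 0)"
          using l \<open>i \<in> {..<m}\<close> by (simp add: e_sig mult_ac)
      qed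
      then show ?thesis using l by (simp add: e_diff e_lc)
    qed
    then have 0: "\<Psi> (lc (gx ^ m) * \<tau> - ?S) = 0" by (intro linear_form_eq_0 [OF \<Psi>])
    have add: "\<Psi> (\<sigma> + \<tau>) = \<Psi> \<sigma> + \<Psi> \<tau>" and left: "\<Psi> (left_factor s * \<tau>) = eps s * \<Psi> \<tau>" for s \<sigma> \<tau>
      using \<Psi> by (simp_all add: linear_form_def)
    have \<Psi>0: "\<Psi> 0 = 0" using add [of 0 0] by simp
    have "\<Psi> (\<Sum>i\<in>A. f i) = (\<Sum>i\<in>A. \<Psi> (f i))" for A and f :: "nat \<Rightarrow> 'k fps fps fps fps fps"
      by (induction A rule: infinite_finite_induct) (simp_all add: \<Psi>0 add)
    then have "\<Psi> ?S = 0" by (simp add: left \<Psi>_sig)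
    then have "\<Psi> (lc (gx ^ m) * \<tau>) = 0" using add [of "lc (gx ^ m) * \<tau> - ?S" ?S] 0 by simp
    then show ?thesis using gx_nonzero by (simp add: left)
  qed
  then show ?thesis by (auto simp: \<Psi>_def)
qed

lemma linear_form_unique:
  assumes "\<And>\<tau>. (\<Sum>i<m. c i * e (bpol m i) \<tau>) = (\<Sum>i<m. d i * e (bpol m i) \<tau>)" "n < m"
  shows "c n = d n"
proof -
  have "(\<Sum>i<m. b i * e (bpol m i) (sig m n)) = b n * gx ^ n" for b
  proof -
    have "(\<Sum>i<m. b i * e (bpol m i) (sig m n)) = (\<Sum>i<m. if n = i then b i * gx ^ n else 0)"
      using assms(2) by (intro sum.cong) (auto simp: e_sig)
    then show ?thesis using assms(2) by simp
  qed
  then have "c n * gx ^ n = d n * gx ^ n" using assms(1) [of "sig m n"] by simp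
  then show ?thesis using gx_nonzero by simp
qed

end

lemma smoothing_exists:
  fixes u :: "'k::field_char_0 fps fps"
  assumes "cf u 0 0 \<noteq> 0"
  shows "\<exists>w v. smoothing u w v"
proof -
  obtain w' where w': "u * w' = 1" using unit_if_cf_nonzero [OF assms] by blast
  have "cf (u * w') 0 0 = cf u 0 0 * cf w' 0 0" by (simp add: cf_mult)
  then have w0: "cf (- w') 0 0 \<noteq> 0" using w' by (auto simp: cf_1)
  have "cf (- w' + germ_x * deriv_x (- w')) 0 0 = cf (- w') 0 0"
    by (simp add: cf_germ_x_mult)
  then obtain v where "(- w' + germ_x * deriv_x (- w')) * v = 1"
    using unit_if_cf_nonzero w0 by metis
  then have "smoothing u (- w') v" using w' by unfold_locales (simp_all add: mult.commute)
  then show ?thesis by blast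
qed

section \<open>Determinants with entries in monomial ideals\<close>

definition tdet :: "nat \<Rightarrow> (nat \<Rightarrow> nat \<Rightarrow> 'a::comm_ring_1) \<Rightarrow> 'a"
  where "tdet r A = (\<Sum>p | p permutes {..<r}. of_int (sign p) * (\<Prod>i<r. A i (p i)))"

text \<open>Composition with the transposition flips each sign and keeps each product, so the
  determinant equals its negative, and 2 is not a zero divisor.\<close>

lemma tdet_equal_rows:
  fixes A :: "nat \<Rightarrow> nat \<Rightarrow> 'a::{idom, semiring_char_0}"
  assumes ab: "a < r" "b < r" "a \<noteq> b" and eq: "A a = A b"
  shows "tdet r A = 0"
proof -
  let ?t = "Transposition.transpose a b"
  have t: "?t permutes {..<r}" using ab by (intro permutes_swap_id) auto
  have "tdet r A = (\<Sum>p | p permutes {..<r}. of_int (sign (p \<circ> ?t)) * (\<Prod>i<r. A i ((p \<circ> ?t) i)))"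
    unfolding tdet_def by (rule sum_permutations_compose_right [OF t])
  also have "\<dots> = (\<Sum>p | p permutes {..<r}. - (of_int (sign p) * (\<Prod>i<r. A i (p i))))"
  proof (rule sum.cong [OF refl])
    fix p assume "p \<in> {p. p permutes {..<r}}"
    then have p: "permutation p" by (metis finite_lessThan mem_Collect_eq permutation_permutes)
    have "sign (p \<circ> ?t) = - sign p"
      using ab(3) by (simp add: sign_compose [OF p permutation_swap_id] sign_swap_id)
    moreover have "(\<Prod>i<r. A i ((p \<circ> ?t) i)) = (\<Prod>i<r. A (?t i) ((p \<circ> ?t) i))"
    proof (rule prod.cong [OF refl])
      fix i
      have "A (?t i) = A i" using eq by (cases "i = a"; cases "i = b") auto
      then show "A i ((p \<circ> ?t) i) = A (?t i) ((p \<circ> ?t) i)" by simp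
    qed
    moreover have "(\<Prod>i<r. A (?t i) ((p \<circ> ?t) i)) = (\<Prod>i<r. A i (p i))"
      using prod.permute [OF t, of "\<lambda>i. A i (p i)"] by (simp add: comp_def)
    ultimately show "of_int (sign (p \<circ> ?t)) * (\<Prod>i<r. A i ((p \<circ> ?t) i)) =
        - (of_int (sign p) * (\<Prod>i<r. A i (p i)))" by simp
  qed
  also have "\<dots> = - tdet r A" by (simp add: tdet_def sum_negf)
  finally have "tdet r A + tdet r A = 0" by simp
  then have "2 * tdet r A = 0" by (simp only: mult_2)
  then show ?thesis by (simp only: mult_eq_0_iff) simp
qed

text \<open>A nonzero term of a permutation other than the identity would strictly lower the sum of
  \<open>h\<close>, which every permutation preserves. The potential \<open>h\<close> replaces
  reordering the matrix into triangular form.\<close>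

lemma tdet_acyclic:
  fixes h :: "nat \<Rightarrow> nat"
  assumes "\<And>i k. i < r \<Longrightarrow> k < r \<Longrightarrow> k \<noteq> i \<Longrightarrow> A i k \<noteq> 0 \<Longrightarrow> h k < h i"
  shows "tdet r A = (\<Prod>i<r. A i i)"
proof -
  have *: "(\<Prod>i<r. A i (p i)) = 0" if p: "p permutes {..<r}" "p \<noteq> id" for p
  proof (rule ccontr)
    assume n: "(\<Prod>i<r. A i (p i)) \<noteq> 0"
    have nz: "A i (p i) \<noteq> 0" if "i < r" for i
      using n that by (metis finite_lessThan lessThan_iff prod_zero)
    have less: "h (p i) < h i" if "i < r" "p i \<noteq> i" for i
      using assms [of i "p i"] nz that permutes_in_image [OF p(1), of i] by simp
    have "\<exists>i. p i \<noteq> i" using p(2) by (auto simp: fun_eq_iff)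
    then obtain i where i: "p i \<noteq> i" by blast
    then have "i < r" using p(1) by (metis lessThan_iff permutes_not_in)
    have "(\<Sum>i<r. h (p i)) < (\<Sum>i<r. h i)"
    proof (rule sum_strict_mono_ex1)
      show "\<forall>x\<in>{..<r}. h (p x) \<le> h x" using less by (metis lessThan_iff less_imp_le order_refl)
      show "\<exists>a\<in>{..<r}. h (p a) < h a" using less i \<open>i < r\<close> by blast
    qed simp
    moreover have "(\<Sum>i<r. h (p i)) = (\<Sum>i<r. h i)"
      using sum.permute [OF p(1), of h] by (simp add: comp_def)
    ultimately show False by simp
  qed
  have "tdet r A = (\<Sum>p\<in>{id}. of_int (sign p) * (\<Prod>i<r. A i (p i)))"
    unfolding tdet_def
    by (rule sum.mono_neutral_right) (auto simp: permutes_id finite_permutations *)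
  then show ?thesis by (simp add: sign_id)
qed

definition tri :: "nat \<Rightarrow> nat"
  where "tri n = \<Sum>{..n}"

lemma tri_simps [simp]: "tri 0 = 0" "tri (Suc n) = tri n + Suc n"
  by (simp_all add: tri_def)

lemma tri_mono: "m \<le> n \<Longrightarrow> tri m \<le> tri n"
  unfolding tri_def by (intro sum_mono2) auto

text \<open>The largest of n distinct positive integers is at least n; remove it and repeat.\<close>

lemma tri_card_le_sum:
  assumes "finite S" "\<And>s. s \<in> S \<Longrightarrow> 0 < s"
  shows "tri (card S) \<le> \<Sum>S"
  using assms
proof (induction "card S" arbitrary: S)
  case (Suc n)
  then have ne: "S \<noteq> {}" by auto
  define M where "M = Max S"
  have M: "M \<in> S" using Suc ne by (simp add: M_def)
  have "S \<subseteq> {1..M}" using Suc by (auto simp: M_def Suc_le_eq)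
  then have "card S \<le> M" using card_mono [of "{1..M}" S] by simp
  moreover have "tri (card (S - {M})) \<le> \<Sum>(S - {M})"
    by (rule Suc(1)) (use Suc(2-) M in auto)
  moreover have "\<Sum>S = M + \<Sum>(S - {M})" using Suc M by (simp add: sum.remove)
  moreover have "card (S - {M}) = n" and "card S = Suc n" using Suc M by simp_all
  ultimately show ?case by simp
qed simp

definition stair :: "nat \<Rightarrow> (nat \<times> nat) set"
  where "stair r = {(a, b). \<exists>p q. p + q + 1 = r \<and> tri p \<le> a \<and> tri q \<le> b}"

lemma upset_stair: "upset (stair r)"
  unfolding upset_def
proof (intro allI impI)
  fix a b i j assume "(a, b) \<in> stair r"
  then obtain p q where "p + q + 1 = r" "tri p \<le> a + i" "tri q \<le> b + j"
    unfolding stair_def using trans_le_add1 by auto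
  then show "(a + i, b + j) \<in> stair r" unfolding stair_def by blast
qed

text \<open>\<open>A\<close> records the rows in which the power of x was taken; the remaining rows
  contribute y^(m-i).\<close>

lemma prod_in_corners:
  fixes f :: "nat \<Rightarrow> 'k::field fps fps"
  assumes "finite G" "\<And>i. i \<in> G \<Longrightarrow> f i \<in> mon_ideal (corner m i)"
  shows "(\<Prod>i\<in>G. f i) \<in> mon_ideal {(a, b). \<exists>A\<subseteq>G. \<Sum>A \<le> a \<and> (\<Sum>i\<in>G - A. m - i) \<le> b}"
  using assms
proof (induction G rule: finite_induct)
  case (insert i G)
  have "f i * (\<Prod>i\<in>G. f i) \<in> mon_ideal {(a, b). \<exists>A\<subseteq>insert i G. \<Sum>A \<le> a \<and> (\<Sum>i\<in>insert i G - A. m - i) \<le> b}"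
  proof (rule mon_ideal_mult)
    show "f i \<in> mon_ideal (corner m i)" using insert by simp
    show "(\<Prod>i\<in>G. f i) \<in> mon_ideal {(a, b). \<exists>A\<subseteq>G. \<Sum>A \<le> a \<and> (\<Sum>i\<in>G - A. m - i) \<le> b}"
      using insert by simp
  next
    fix a b c d assume ab: "(a, b) \<in> corner m i"
      and "(c, d) \<in> {(a, b). \<exists>A\<subseteq>G. \<Sum>A \<le> a \<and> (\<Sum>i\<in>G - A. m - i) \<le> b}"
    then obtain A where A: "A \<subseteq> G" "\<Sum>A \<le> c" "(\<Sum>i\<in>G - A. m - i) \<le> d" by auto
    have iA: "i \<notin> A" and fin: "finite A" using A insert finite_subset by auto
    show "(a + c, b + d) \<in> {(a, b). \<exists>A\<subseteq>insert i G. \<Sum>A \<le> a \<and> (\<Sum>i\<in>insert i G - A. m - i) \<le> b}"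
    proof (cases "i \<le> a")
      case True
      have "insert i G - insert i A = G - A" using insert by auto
      then have "insert i A \<subseteq> insert i G \<and> \<Sum>(insert i A) \<le> a + c \<and> (\<Sum>i\<in>insert i G - insert i A. m - i) \<le> b + d"
        using A True iA fin by auto
      then show ?thesis by blast
    next
      case False
      then have "m - i \<le> b" using ab by simp
      moreover have "insert i G - A = insert i (G - A)" using iA by auto
      ultimately have "A \<subseteq> insert i G \<and> \<Sum>A \<le> a + c \<and> (\<Sum>i\<in>insert i G - A. m - i) \<le> b + d"
        using A insert by auto
      then show ?thesis by blast
    qed
  qed
  then show ?case using insert by simp
qed simp

lemma subset_sums_stair:
  assumes G: "G \<subseteq> {..<m}" "card G = r" "r \<ge> 1" and A: "A \<subseteq> G" "\<Sum>A \<le> a" "(\<Sum>i\<in>G - A. m - i) \<le> b"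
  shows "(a, b) \<in> stair r"
proof -
  have fin: "finite G" using G(1) finite_subset by blast
  then have fin: "finite G" "finite A" using A(1) finite_subset by auto
  \<comment> \<open>Row 0 contributes x^0, so it is left out of \<open>p\<close>. The exponents m -
    i are positive, so every row taken with a power of y counts towards \<open>q\<close>, and only p
    + q >= r - 1 is guaranteed.\<close>
  define p q where "p = card (A - {0})" and "q = card (G - A)"
  have "tri p \<le> \<Sum>(A - {0})" unfolding p_def using fin by (intro tri_card_le_sum) auto
  also have "\<dots> \<le> \<Sum>A" using fin by (intro sum_mono2) auto
  finally have p: "tri p \<le> a" using A by simp
  have inj: "inj_on (\<lambda>i. m - i) (G - A)" using G by (auto simp: inj_on_def)
  have "tri q = tri (card ((\<lambda>i. m - i) ` (G - A)))" using inj by (simp add: q_def card_image)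
  also have "\<dots> \<le> \<Sum>((\<lambda>i. m - i) ` (G - A))" using fin G by (intro tri_card_le_sum) auto
  also have "\<dots> = (\<Sum>i\<in>G - A. m - i)" using inj by (simp add: sum.reindex)
  finally have q: "tri q \<le> b" using A by simp
  have "card A + q = r" unfolding q_def using A fin G by (metis card_Diff_subset card_mono le_add_diff_inverse)
  moreover have "card A \<le> Suc p"
    unfolding p_def using fin card.remove [of A 0] by (cases "0 \<in> A") auto
  ultimately have pq: "r \<le> p + q + 1" by simp
  \<comment> \<open>Lowering \<open>p\<close> and then the second index makes the sum exactly r - 1,
    as the definition of \<open>stair\<close> demands; \<open>tri\<close> is monotone.\<close>
  define p' where "p' = min p (r - 1)"
  have "p' + (r - 1 - p') + 1 = r" using G by (auto simp: p'_def)
  moreover have "tri p' \<le> a" using tri_mono [of p' p] p by (simp add: p'_def)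
  moreover have "r - 1 - p' \<le> q" using pq by (auto simp: p'_def min_def)
  then have "tri (r - 1 - p') \<le> b" using tri_mono q le_trans by blast
  ultimately show ?thesis unfolding stair_def by blast
qed

lemma prod_in_stair:
  fixes f :: "nat \<Rightarrow> 'k::field fps fps"
  assumes "G \<subseteq> {..<m}" "card G = r" "r \<ge> 1" "\<And>i. i \<in> G \<Longrightarrow> f i \<in> mon_ideal (corner m i)"
  shows "(\<Prod>i\<in>G. f i) \<in> mon_ideal (stair r)"
  by (rule mon_ideal_mono [OF prod_in_corners [of G f m]])
     (use assms finite_subset subset_sums_stair in fastforce)+

text \<open>Cauchy-Binet style expansion of the product of \<open>P\<close> and \<open>A\<close>
  over all choices \<gamma> of rows. A repeated row gives determinant zero, and distinct rows make
  every term obey the subset bound.\<close>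

lemma tdet_in_stair:
  fixes A :: "nat \<Rightarrow> nat \<Rightarrow> 'k::field_char_0 fps fps"
  assumes r: "r \<ge> 1" and A: "\<And>l j. l < m \<Longrightarrow> j < r \<Longrightarrow> A l j \<in> mon_ideal (corner m l)"
    and B: "\<And>i j. i < r \<Longrightarrow> j < r \<Longrightarrow> B i j = (\<Sum>l<m. P i l * A l j)"
  shows "tdet r B \<in> mon_ideal (stair r)"
proof -
  let ?\<Gamma> = "{..<r} \<rightarrow>\<^sub>E {..<m}"
  have "tdet r B = (\<Sum>p | p permutes {..<r}. of_int (sign p) * (\<Sum>\<gamma>\<in>?\<Gamma>. \<Prod>i<r. P i (\<gamma> i) * A (\<gamma> i) (p i)))"
    unfolding tdet_def
  proof (rule sum.cong [OF refl], rule arg_cong2 [where f = "(*)", OF refl])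
    fix p assume "p \<in> {p. p permutes {..<r}}"
    then have "(\<Prod>i<r. B i (p i)) = (\<Prod>i<r. \<Sum>l<m. P i l * A l (p i))"
      by (intro prod.cong) (auto simp: B permutes_in_image [of p "{..<r}", simplified])
    then show "(\<Prod>i<r. B i (p i)) = (\<Sum>\<gamma>\<in>?\<Gamma>. \<Prod>i<r. P i (\<gamma> i) * A (\<gamma> i) (p i))"
      by (simp add: prod_sum_PiE)
  qed
  also have "\<dots> = (\<Sum>\<gamma>\<in>?\<Gamma>. (\<Prod>i<r. P i (\<gamma> i)) * tdet r (\<lambda>i j. A (\<gamma> i) j))"
    unfolding tdet_def sum_distrib_left
    by (subst sum.swap) (simp add: prod.distrib mult_ac)
  also have "\<dots> \<in> mon_ideal (stair r)"
  proof (intro mon_ideal_sum mon_ideal_mult_left upset_stair)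
    fix \<gamma> assume \<gamma>: "\<gamma> \<in> ?\<Gamma>"
    show "tdet r (\<lambda>i j. A (\<gamma> i) j) \<in> mon_ideal (stair r)"
    proof (cases "inj_on \<gamma> {..<r}")
      case True
      show ?thesis unfolding tdet_def
      proof (intro mon_ideal_sum mon_ideal_mult_left upset_stair)
        fix p assume p: "p \<in> {p. p permutes {..<r}}"
        have "(\<Prod>i<r. A (\<gamma> i) (p i)) = (\<Prod>l\<in>\<gamma> ` {..<r}. A l (p (the_inv_into {..<r} \<gamma> l)))"
          using True by (subst prod.reindex) (auto simp: the_inv_into_f_f)
        also have "\<dots> \<in> mon_ideal (stair r)"
        proof (rule prod_in_stair)
          show "\<gamma> ` {..<r} \<subseteq> {..<m}" using \<gamma> by auto
          show "card (\<gamma> ` {..<r}) = r" using True by (simp add: card_image)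
          fix l assume "l \<in> \<gamma> ` {..<r}"
          then obtain i where i: "i < r" "l = \<gamma> i" by auto
          then have "p (the_inv_into {..<r} \<gamma> l) < r"
            using True p by (simp add: the_inv_into_f_f permutes_in_image [of p "{..<r}", simplified])
          then show "A l (p (the_inv_into {..<r} \<gamma> l)) \<in> mon_ideal (corner m l)"
            using i \<gamma> by (intro A) auto
        qed (rule r)
        finally show "(\<Prod>i<r. A (\<gamma> i) (p i)) \<in> mon_ideal (stair r)" .
      qed
    next
      case False
      then obtain a b where "a < r" "b < r" "a \<noteq> b" "\<gamma> a = \<gamma> b" by (auto simp: inj_on_def)
      then have "tdet r (\<lambda>i j. A (\<gamma> i) j) = 0" by (intro tdet_equal_rows [of a r b]) auto
      then show ?thesis by simp
    qed
  qed
  finally show ?thesis .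
qed


section \<open>Colengths\<close>

lemma tri_eq_choose: "tri n = Suc n choose 2"
  by (induction n) (auto simp: numeral_2_eq_2)

text \<open>Passing from r to r + 1 adds the sum of (p + 1)(r - p), which is binom(r + 2, 3) by the
  same kind of induction; Pascal's rule finishes.\<close>

lemma sum_tri_eq_choose: "(\<Sum>p<r. Suc p * tri (r - 1 - p)) = (r + 2) choose 4"
proof (induction r)
  case (Suc r)
  have conv: "(\<Sum>p<r. Suc p * (r - p)) = (r + 2) choose 3" for r
  proof (induction r)
    case (Suc r)
    have "(\<Sum>p<Suc r. Suc p * (Suc r - p)) = (\<Sum>p<r. Suc p * (r - p) + Suc p) + Suc r"
      by (simp, rule sum.cong) (auto simp: Suc_diff_le)
    also have "\<dots> = ((r + 2) choose 3) + (\<Sum>p<Suc r. Suc p)"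
      using Suc by (simp only: sum.distrib) simp
    also have "(\<Sum>p<Suc r. Suc p) = tri (Suc r)"
      by (induction r) simp_all
    finally show ?case by (simp add: tri_eq_choose numeral_2_eq_2 numeral_3_eq_3)
  qed simp
  have "(\<Sum>p<Suc r. Suc p * tri (Suc r - 1 - p)) = (\<Sum>p<r. Suc p * tri (r - 1 - p) + Suc p * (r - p))"
  proof -
    have "tri (r - p) = tri (r - 1 - p) + (r - p)" if pr: "p < r" for p
    proof -
      obtain k where "r - p = Suc k" using pr by (cases "r - p") auto
      moreover from this have "r - 1 - p = k" by simp
      ultimately show ?thesis by (simp only: tri_simps)
    qed
    then have "Suc p * tri (r - p) = Suc p * tri (r - 1 - p) + Suc p * (r - p)" if "p < r" for p
      using that by (simp only: distrib_left)
    then show ?thesis by simp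
  qed
  also have "\<dots> = ((r + 2) choose 4) + ((r + 2) choose 3)"
    using Suc by (simp only: sum.distrib conv)
  finally show ?case by (simp add: eval_nat_numeral)
qed simp

lemma tri_interval: "\<exists>p. tri p \<le> a \<and> a < tri (Suc p)"
proof (induction a)
  case 0
  show ?case by (rule exI [of _ 0]) simp
next
  case (Suc a)
  then obtain p where p: "tri p \<le> a" "a < tri (Suc p)" by blast
  show ?case
  proof (cases "Suc a < tri (Suc p)")
    case True
    then show ?thesis using p by (intro exI [of _ p]) auto
  next
    case False
    then show ?thesis using p by (intro exI [of _ "Suc p"]) auto
  qed
qed

text \<open>For a from tri p up to tri (p + 1) the first admissible b is tri (r - 1 - p), so the
  complement is a union of rectangles of width p + 1.\<close>

lemma stair_complement:
  "- stair r = (\<Union>p<r. {tri p..<tri (Suc p)} \<times> {..<tri (r - 1 - p)})" if "r \<ge> 1"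
proof (intro Set.set_eqI iffI)
  fix ab assume ab: "ab \<in> - stair r"
  obtain a b where [simp]: "ab = (a, b)" by fastforce
  obtain p where p: "tri p \<le> a" "a < tri (Suc p)" using tri_interval by blast
  define p' where "p' = min p (r - 1)"
  have "tri p' \<le> a" using p tri_mono [of p' p] by (simp add: p'_def)
  moreover have e: "p' + (r - 1 - p') + 1 = r" using that by (simp add: p'_def)
  ultimately have b: "b < tri (r - 1 - p')" using ab unfolding stair_def
    by (metis (mono_tags, lifting) ComplD \<open>ab = (a, b)\<close> case_prodI mem_Collect_eq not_le)
  have "p < r"
  proof (rule ccontr)
    assume "\<not> p < r"
    then have "p' = r - 1" by (simp add: p'_def)
    with b show False by simp
  qed
  then have "p' = p" using that by (auto simp: p'_def)
  then show "ab \<in> (\<Union>p<r. {tri p..<tri (Suc p)} \<times> {..<tri (r - 1 - p)})"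
    using p b \<open>p < r\<close> by auto
next
  fix ab assume "ab \<in> (\<Union>p<r. {tri p..<tri (Suc p)} \<times> {..<tri (r - 1 - p)})"
  then obtain a b p where [simp]: "ab = (a, b)" and p: "p < r" "a < tri (Suc p)" "b < tri (r - 1 - p)"
    by auto
  show "ab \<in> - stair r"
  proof
    assume "ab \<in> stair r"
    then obtain p' q where q: "p' + q + 1 = r" "tri p' \<le> a" "tri q \<le> b" by (auto simp: stair_def)
    have "p' \<le> p"
      using p(2) q(2) tri_mono [of "Suc p" p'] by (meson leD le_less_trans not_less_eq_eq)
    then have "tri (r - 1 - p) \<le> tri q" using q(1) by (intro tri_mono) simp
    then show False using q(3) p(3) by simp
  qed
qed

lemma card_stair_complement:
  assumes "r \<ge> 1"
  shows "finite (- stair r)" "card (- stair r) = (r + 2) choose 4"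
proof -
  show "finite (- stair r)" unfolding stair_complement [OF assms] by simp
  have "card (- stair r) = (\<Sum>p<r. card ({tri p..<tri (Suc p)} \<times> {..<tri (r - 1 - p)}))"
    unfolding stair_complement [OF assms]
  proof (rule card_UN_disjoint)
    show "\<forall>i\<in>{..<r}. \<forall>j\<in>{..<r}. i \<noteq> j \<longrightarrow> ({tri i..<tri (Suc i)} \<times> {..<tri (r - 1 - i)}) \<inter>
        ({tri j..<tri (Suc j)} \<times> {..<tri (r - 1 - j)}) = {}"
    proof (intro ballI impI)
      fix i j :: nat assume "i \<noteq> j"
      then have "Suc i \<le> j \<or> Suc j \<le> i" by auto
      then have "{tri i..<tri (Suc i)} \<inter> {tri j..<tri (Suc j)} = {}"
        using tri_mono [of "Suc i" j] tri_mono [of "Suc j" i] by (auto simp del: tri_simps)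
      then show "({tri i..<tri (Suc i)} \<times> {..<tri (r - 1 - i)}) \<inter>
        ({tri j..<tri (Suc j)} \<times> {..<tri (r - 1 - j)}) = {}" by blast
    qed
  qed auto
  also have "\<dots> = (r + 2) choose 4" using sum_tri_eq_choose [of r] by (simp del: One_nat_def)
  finally show "card (- stair r) = (r + 2) choose 4" .
qed

text \<open>Coordinate vectors of length \<open>N\<close> are modelled by polynomials, an available
  vector space, where the \<open>N\<close> monomials are independent and lie in the span of n
  vectors.\<close>

lemma span_bound:
  fixes V :: "nat \<Rightarrow> nat \<Rightarrow> 'c::field"
  assumes "\<And>j. j < N \<Longrightarrow> \<exists>c. \<forall>j'<N. (\<Sum>i<n. c i * V i j') = (if j = j' then 1 else 0)"
  shows "N \<le> n"
proof -
  interpret vs: vector_space "Polynomial.smult :: 'c \<Rightarrow> 'c poly \<Rightarrow> 'c poly"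
    by unfold_locales (simp_all add: smult_add_right smult_add_left)
  define P where "P i = (\<Sum>j<N. Polynomial.monom (V i j) j)" for i
  let ?S = "(\<lambda>j. Polynomial.monom (1 :: 'c) j) ` {..<N}"
  have inj: "inj_on (\<lambda>j. Polynomial.monom (1 :: 'c) j) {..<N}"
    by (auto simp: inj_on_def monom_eq_iff')
  have "vs.independent ?S"
  proof (rule vs.independent_if_scalars_zero)
    fix f :: "'c poly \<Rightarrow> 'c" and x assume s: "(\<Sum>x\<in>?S. Polynomial.smult (f x) x) = 0" and "x \<in> ?S"
    then obtain j where j: "j < N" "x = Polynomial.monom 1 j" by auto
    have "0 = Polynomial.coeff (\<Sum>j<N. Polynomial.monom (f (Polynomial.monom 1 j)) j) j"
      using s inj by (simp add: sum.reindex smult_monom)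
    also have "\<dots> = f x" using j by (simp add: coeff_sum)
    finally show "f x = 0" by simp
  qed simp
  moreover have "?S \<subseteq> vs.span (P ` {..<n})"
  proof
    fix x assume "x \<in> ?S"
    then obtain j where j: "j < N" "x = Polynomial.monom 1 j" by auto
    obtain c where c: "\<And>j'. j' < N \<Longrightarrow> (\<Sum>i<n. c i * V i j') = (if j = j' then 1 else 0)"
      using assms [OF j(1)] by blast
    have "(\<Sum>i<n. Polynomial.smult (c i) (P i)) = x"
    proof (rule poly_eqI)
      fix l
      have "Polynomial.coeff (\<Sum>i<n. Polynomial.smult (c i) (P i)) l = (\<Sum>i<n. c i * (if l < N then V i l else 0))"
        by (simp add: coeff_sum P_def)
      also have "\<dots> = Polynomial.coeff x l"
        using c [of l] j by (cases "l < N") auto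
      finally show "Polynomial.coeff (\<Sum>i<n. Polynomial.smult (c i) (P i)) l = Polynomial.coeff x l" .
    qed
    then show "x \<in> vs.span (P ` {..<n})"
      by (metis (no_types, lifting) imageI vs.span_base vs.span_scale vs.span_sum)
  qed
  ultimately have "card ?S \<le> card (P ` {..<n})"
    using vs.independent_span_bound [of "P ` {..<n}" ?S] by simp
  also have "\<dots> \<le> n" using card_image_le [of "{..<n}" P] by simp
  finally show ?thesis using inj by (simp add: card_image)
qed

text \<open>A basis of k[[x,y]] / J expressed by representatives, without forming cosets. The
  extensional function space makes uniqueness of the coordinates literal.\<close>

definition quot_basis :: "'k::field fps fps set \<Rightarrow> nat \<Rightarrow> (nat \<Rightarrow> 'k fps fps) \<Rightarrow> bool"
  where "quot_basis J n b \<longleftrightarrow>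
    (\<forall>f. \<exists>!c. c \<in> {..<n} \<rightarrow>\<^sub>E UNIV \<and> f - (\<Sum>i<n. const2 (c i) * b i) \<in> J)"

definition klinear :: "('k::field fps fps \<Rightarrow> 'k) \<Rightarrow> bool"
  where "klinear l \<longleftrightarrow> (\<forall>f g. l (f + g) = l f + l g) \<and> (\<forall>c f. l (const2 c * f) = c * l f)"

lemma klinear_cf: "klinear (\<lambda>f. cf f a b)"
  by (simp add: klinear_def)

lemma klinear_lincomb: "klinear (\<lambda>f. c * cf f a b + d * cf f a' b')"
  by (simp add: klinear_def distrib_left right_diff_distrib mult.left_commute)

lemma klinear_sum:
  assumes "klinear l"
  shows "l (\<Sum>i\<in>A. const2 (c i) * b i) = (\<Sum>i\<in>A. c i * l (b i))" "l (f - g) = l f - l g"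
proof -
  have add: "l (f + g) = l f + l g" and sc: "l (const2 c * f) = c * l f" for f g c
    using assms by (simp_all add: klinear_def)
  have "l 0 = 0" using sc [of 0 0] by simp
  then show "l (\<Sum>i\<in>A. const2 (c i) * b i) = (\<Sum>i\<in>A. c i * l (b i))"
    by (induction A rule: infinite_finite_induct) (simp_all add: add sc)
  show "l (f - g) = l f - l g" using add [of "f - g" g] by simp
qed

text \<open>Functionals that vanish on \<open>J\<close> descend to the quotient, and a dual system
  of \<open>N\<close> of them forces dimension at least \<open>N\<close>.\<close>

lemma quot_basis_lower:
  assumes b: "quot_basis J n b" and l: "\<And>j. j < N \<Longrightarrow> klinear (l j)"
    and J: "\<And>j f. j < N \<Longrightarrow> f \<in> J \<Longrightarrow> l j f = 0"
    and dual: "\<And>j. j < N \<Longrightarrow> \<exists>f. \<forall>j'<N. l j' f = (if j = j' then 1 else 0)"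
  shows "N \<le> n"
proof (rule span_bound [where V = "\<lambda>i j. l j (b i)"])
  fix j assume "j < N"
  then obtain f where f: "\<forall>j'<N. l j' f = (if j = j' then 1 else 0)" using dual by blast
  obtain c where c: "f - (\<Sum>i<n. const2 (c i) * b i) \<in> J"
    using b unfolding quot_basis_def by blast
  have "l j' f = (\<Sum>i<n. c i * l j' (b i))" if "j' < N" for j'
    using J [OF that c] by (simp add: klinear_sum [OF l [OF that]])
  then show "\<exists>c. \<forall>j'<N. (\<Sum>i<n. c i * l j' (b i)) = (if j = j' then 1 else 0)"
    using f by auto
qed

lemma quot_basis_dual:
  assumes J: "\<And>f. f \<in> J \<longleftrightarrow> (\<forall>j<N. l j f = 0)" and l: "\<And>j. j < N \<Longrightarrow> klinear (l j)"
    and dual: "\<And>i j. i < N \<Longrightarrow> j < N \<Longrightarrow> l j (b i) = (if i = j then 1 else 0)"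
  shows "quot_basis J N b"
  unfolding quot_basis_def
proof (intro allI ex1I)
  have *: "l j (f - (\<Sum>i<N. const2 (c i) * b i)) = l j f - c j" if "j < N" for f c j
  proof -
    have "(\<Sum>i<N. c i * l j (b i)) = (\<Sum>i<N. if i = j then c i else 0)"
      using that by (intro sum.cong) (auto simp: dual)
    then show ?thesis using that by (simp add: klinear_sum [OF l [OF that]])
  qed
  fix f
  define d where "d = restrict (\<lambda>j. l j f) {..<N}"
  have d: "d j = l j f" if "j < N" for j using that by (simp add: d_def)
  show "d \<in> {..<N} \<rightarrow>\<^sub>E UNIV \<and> f - (\<Sum>i<N. const2 (d i) * b i) \<in> J"
    unfolding J by (simp add: * d) (simp add: d_def restrict_PiE_iff)
  fix c assume "c \<in> {..<N} \<rightarrow>\<^sub>E UNIV \<and> f - (\<Sum>i<N. const2 (c i) * b i) \<in> J"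
  then have "c j = l j f" if "j < N" for j using that unfolding J by (simp add: *)
  then show "c = d"
    using \<open>c \<in> _ \<and> _\<close> by (intro PiE_ext [of c "{..<N}" "\<lambda>_. UNIV"]) (auto simp: d_def)
qed

lemma quot_basis_mon_ideal:
  assumes "finite (- U)"
  shows "\<exists>b. quot_basis (mon_ideal U :: 'k::field fps fps set) (card (- U)) b"
proof -
  obtain h where h: "bij_betw h {..<card (- U)} (- U)"
    using ex_bij_betw_nat_finite [OF assms] by (auto simp: atLeast0LessThan)
  have inj: "h i = h j \<longleftrightarrow> i = j" if "i < card (- U)" "j < card (- U)" for i j
    using h that by (auto simp: bij_betw_def inj_on_def)
  have U: "(a, b) \<notin> U \<longleftrightarrow> (\<exists>j<card (- U). h j = (a, b))" for a b
    using h by (auto simp: bij_betw_def image_iff set_eq_iff) (metis ComplI imageE lessThan_iff)+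
  have "quot_basis (mon_ideal U :: 'k fps fps set) (card (- U)) (\<lambda>j. germ_x ^ fst (h j) * germ_y ^ snd (h j))"
  proof (rule quot_basis_dual [where l = "\<lambda>j f. cf f (fst (h j)) (snd (h j))"])
    show "f \<in> mon_ideal U \<longleftrightarrow> (\<forall>j<card (- U). cf f (fst (h j)) (snd (h j)) = 0)" for f :: "'k fps fps"
      unfolding mon_ideal_def using U by (auto simp: prod_eq_iff) (metis fst_conv snd_conv prod.collapse)+
  qed (auto simp: klinear_cf cf_monomial inj [symmetric] prod_eq_iff)
  then show ?thesis by blast
qed

lemma mon_ideal_colength_lower:
  fixes J :: "'k::field fps fps set"
  assumes "quot_basis J n b" "J \<subseteq> mon_ideal U" "finite (- U)"
  shows "card (- U) \<le> n"
proof -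
  obtain h where h: "bij_betw h {..<card (- U)} (- U)"
    using ex_bij_betw_nat_finite [OF assms(3)] by (auto simp: atLeast0LessThan)
  have inj: "h i = h j \<longleftrightarrow> i = j" if "i < card (- U)" "j < card (- U)" for i j
    using h that by (auto simp: bij_betw_def inj_on_def)
  show ?thesis
  proof (rule quot_basis_lower [OF assms(1), where l = "\<lambda>j f. cf f (fst (h j)) (snd (h j))"])
    fix j f assume "j < card (- U)" "f \<in> J"
    moreover from this have "(fst (h j), snd (h j)) \<notin> U" using h by (auto simp: bij_betw_def)
    ultimately show "cf f (fst (h j)) (snd (h j)) = 0" using assms(2) by (auto intro: mon_idealD)
  next
    fix j assume "j < card (- U)"
    then show "\<exists>f :: 'k fps fps. \<forall>j'<card (- U). cf f (fst (h j')) (snd (h j')) = (if j = j' then 1 else 0)"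
      by (intro exI [of _ "germ_x ^ fst (h j) * germ_y ^ snd (h j) :: 'k fps fps"])
         (auto simp: cf_monomial inj [symmetric] prod_eq_iff)
  qed (rule klinear_cf)
qed

lemma mon_ideal_generators:
  assumes "finite P" "f \<in> mon_ideal (\<Union>p\<in>P. {(a, b). \<alpha> p \<le> a \<and> \<beta> p \<le> b})"
  shows "\<exists>g. f = (\<Sum>p\<in>P. germ_x ^ \<alpha> p * germ_y ^ \<beta> p * g p)"
  using assms
proof (induction P arbitrary: f rule: finite_induct)
  case empty
  then have "f = 0" by (intro cf_eqI) (simp add: mon_ideal_def)
  then show ?case by simp
next
  case (insert p P)
  define h where "h = Abs_fps (\<lambda>b. Abs_fps (\<lambda>a. cf f (a + \<alpha> p) (b + \<beta> p)))"
  define f' where "f' = f - germ_x ^ \<alpha> p * germ_y ^ \<beta> p * h"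
  have "f' \<in> mon_ideal (\<Union>p\<in>P. {(a, b). \<alpha> p \<le> a \<and> \<beta> p \<le> b})"
  proof (rule mon_idealI)
    fix a b assume n: "(a, b) \<notin> (\<Union>p\<in>P. {(a, b). \<alpha> p \<le> a \<and> \<beta> p \<le> b})"
    show "cf f' a b = 0"
    proof (cases "\<alpha> p \<le> a \<and> \<beta> p \<le> b")
      case True
      then show ?thesis by (simp add: f'_def cf_monomial_mult h_def cf_Abs)
    next
      case False
      then have "cf f a b = 0" using n by (intro mon_idealD [OF insert.prems]) auto
      then show ?thesis using False by (auto simp: f'_def cf_monomial_mult)
    qed
  qed
  then obtain g where g: "f' = (\<Sum>p\<in>P. germ_x ^ \<alpha> p * germ_y ^ \<beta> p * g p)" using insert by blast
  have "(\<Sum>s\<in>P. germ_x ^ \<alpha> s * germ_y ^ \<beta> s * (g(p := h)) s) = f'"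
    unfolding g using insert.hyps by (intro sum.cong) auto
  then have "f = (\<Sum>s\<in>insert p P. germ_x ^ \<alpha> s * germ_y ^ \<beta> s * (g(p := h)) s)"
    using insert by (simp add: f'_def)
  then show ?case by blast
qed

section \<open>The degeneracy ideals\<close>

definition tideal :: "'a::comm_ring_1 set \<Rightarrow> bool"
  where "tideal J \<longleftrightarrow> 0 \<in> J \<and> (\<forall>a\<in>J. \<forall>b\<in>J. a + b \<in> J) \<and> (\<forall>a\<in>J. \<forall>b. b * a \<in> J)"

lemma tideal_add: "tideal J \<Longrightarrow> a \<in> J \<Longrightarrow> b \<in> J \<Longrightarrow> a + b \<in> J"
  and tideal_mult: "tideal J \<Longrightarrow> a \<in> J \<Longrightarrow> b * a \<in> J"
  and tideal_0: "tideal J \<Longrightarrow> 0 \<in> J"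
  by (simp_all add: tideal_def)

lemma tideal_mult_right: "tideal J \<Longrightarrow> a \<in> J \<Longrightarrow> a * b \<in> J"
  using tideal_mult [of J a b] by (simp add: mult.commute)

lemma tideal_diff: "tideal J \<Longrightarrow> a \<in> J \<Longrightarrow> b \<in> J \<Longrightarrow> a - b \<in> J"
  using tideal_add [of J a "- 1 * b"] tideal_mult [of J b "- 1"] by simp

lemma tideal_sum: "tideal J \<Longrightarrow> (\<And>i. i \<in> A \<Longrightarrow> f i \<in> J) \<Longrightarrow> (\<Sum>i\<in>A. f i) \<in> J"
  by (induction A rule: infinite_finite_induct) (auto simp: tideal_0 tideal_add)

lemma tideal_mon_ideal: "upset U \<Longrightarrow> tideal (mon_ideal U)"
  by (simp add: tideal_def mon_ideal_add mon_ideal_mult_left)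

lemma mon_ideal_subset:
  fixes J :: "'k::field fps fps set"
  assumes J: "tideal J" and "finite P"
    and "\<And>p. p \<in> P \<Longrightarrow> germ_x ^ \<alpha> p * germ_y ^ \<beta> p \<in> J"
  shows "mon_ideal (\<Union>p\<in>P. {(a, b). \<alpha> p \<le> a \<and> \<beta> p \<le> b}) \<subseteq> J"
proof
  fix f :: "'k fps fps" assume "f \<in> mon_ideal (\<Union>p\<in>P. {(a, b). \<alpha> p \<le> a \<and> \<beta> p \<le> b})"
  from mon_ideal_generators [OF assms(2) this] obtain g
    where "f = (\<Sum>p\<in>P. germ_x ^ \<alpha> p * germ_y ^ \<beta> p * g p)" by blast
  then show "f \<in> J" using tideal_sum [OF J tideal_mult_right [OF J assms(3)]] by simp
qed

lemma stair_subset: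
  fixes J :: "'k::field fps fps set"
  assumes J: "tideal J" and gen: "\<And>p q. p + q + 1 = r \<Longrightarrow> germ_x ^ tri p * germ_y ^ tri q \<in> J"
  shows "mon_ideal (stair r) \<subseteq> J"
proof -
  have "stair r = (\<Union>p<r. {(a, b). tri p \<le> a \<and> tri (r - 1 - p) \<le> b})"
  proof (intro Set.set_eqI iffI)
    fix ab assume "ab \<in> stair r"
    then obtain a b p q where [simp]: "ab = (a, b)" and *: "p + q + 1 = r" "tri p \<le> a" "tri q \<le> b"
      by (auto simp: stair_def)
    then have "p < r" "q = r - 1 - p" by auto
    then show "ab \<in> (\<Union>p<r. {(a, b). tri p \<le> a \<and> tri (r - 1 - p) \<le> b})" using * by auto
  next
    fix ab assume "ab \<in> (\<Union>p<r. {(a, b). tri p \<le> a \<and> tri (r - 1 - p) \<le> b})"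
    then obtain a b p where [simp]: "ab = (a, b)" and *: "p < r" "tri p \<le> a" "tri (r - 1 - p) \<le> b" by auto
    then have "p + (r - 1 - p) + 1 = r" by simp
    then show "ab \<in> stair r" using * unfolding stair_def \<open>ab = (a, b)\<close> by blast
  qed
  then show ?thesis using mon_ideal_subset [OF J, of "{..<r}" tri "\<lambda>p. tri (r - 1 - p)"] gen by auto
qed

section \<open>The special fibre: ideals of k[[x,y]] containing xy\<close>

definition cross :: "nat \<Rightarrow> (nat \<times> nat) set"
  where "cross T = {(a, b). T \<le> a \<or> T \<le> b \<or> (1 \<le> a \<and> 1 \<le> b)}"

lemma upset_cross: "upset (cross T)"
  by (auto simp: upset_def cross_def)

text \<open>If p and q are both positive, the generator x^(tri p) y^(tri q) is divisible by xy. Only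
  the two extreme generators survive, so \<open>cross T\<close> is the ideal (x^T, y^T, xy) with T =
  tri (m - 1).\<close>

lemma stair_cross: "stair m \<subseteq> cross (tri (m - 1))"
proof
  fix ab assume "ab \<in> stair m"
  then obtain a b p q where [simp]: "ab = (a, b)" and *: "p + q + 1 = m" "tri p \<le> a" "tri q \<le> b"
    by (auto simp: stair_def)
  show "ab \<in> cross (tri (m - 1))"
  proof (cases "p = 0 \<or> q = 0")
    case True
    then show ?thesis using * by (auto simp: cross_def)
  next
    case False
    then have "1 \<le> tri p" "1 \<le> tri q" using tri_mono [of 1 p] tri_mono [of 1 q] by auto
    then show ?thesis using * by (auto simp: cross_def)
  qed
qed

definition fib_ideal :: "'k::field fps fps \<Rightarrow> 'k fps fps set"
  where "fib_ideal d = {node * g + d * h |g h. True}"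

lemma tideal_fib: "tideal (fib_ideal d)"
proof -
  have a: "node * g + d * h + (node * g' + d * h') = node * (g + g') + d * (h + h')" for g h g' h'
    by (simp add: algebra_simps)
  have b: "b * (node * g + d * h) = node * (b * g) + d * (b * h)" for b g h
    by (simp add: algebra_simps)
  have "0 = node * 0 + d * 0" by simp
  then show ?thesis unfolding tideal_def fib_ideal_def using a b
    by (auto; (blast | metis))
qed

lemma cf_node_mult: "cf (node * g) a 0 = 0" "cf (node * g) 0 b = 0"
  by (simp_all add: node_def mult.assoc cf_germ_x_mult cf_germ_y_mult)

lemma node_dvd_iff: "node dvd f \<longleftrightarrow> (\<forall>a. cf f a 0 = 0) \<and> (\<forall>b. cf f 0 b = 0)"
proof
  assume *: "(\<forall>a. cf f a 0 = 0) \<and> (\<forall>b. cf f 0 b = 0)"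
  have "f = node * Abs_fps (\<lambda>b. Abs_fps (\<lambda>a. cf f (a + 1) (b + 1)))"
  proof (rule cf_eqI)
    fix a b
    show "cf f a b = cf (node * Abs_fps (\<lambda>b. Abs_fps (\<lambda>a. cf f (a + 1) (b + 1)))) a b"
      using * by (cases a; cases b) (simp_all add: node_def mult.assoc cf_germ_x_mult cf_germ_y_mult cf_Abs)
  qed
  then show "node dvd f" by (rule dvdI)
qed (auto simp: cf_node_mult)

text \<open>The coefficients of 1, x, ..., x^(T-1) and of y, ..., y^(T-1) give 2T - 1 functionals.
  The last one combines the coefficients of x^T and y^T, with weights to be chosen so that it kills
  the determinant.\<close>

definition axis_form :: "nat \<Rightarrow> 'k \<Rightarrow> 'k \<Rightarrow> nat \<Rightarrow> 'k::field fps fps \<Rightarrow> 'k"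
  where "axis_form T al be j f =
    (if j < T then cf f j 0 else if j < 2 * T - 1 then cf f 0 (j - T + 1)
     else al * cf f T 0 + be * cf f 0 T)"

lemma klinear_axis_form: "klinear (axis_form T al be j)"
  by (cases "j < T"; cases "j < 2 * T - 1") (simp_all add: axis_form_def [abs_def] klinear_cf klinear_lincomb)

definition axis_dual :: "nat \<Rightarrow> 'k \<Rightarrow> 'k \<Rightarrow> nat \<Rightarrow> 'k::field fps fps"
  where "axis_dual T al be j =
    (if j < T then germ_x ^ j else if j < 2 * T - 1 then germ_y ^ (j - T + 1)
     else if al \<noteq> 0 then const2 (inverse al) * germ_x ^ T else const2 (inverse be) * germ_y ^ T)"

lemma cf_germ_power:
  "cf (germ_x ^ i) a b = (if a = i \<and> b = 0 then 1 else 0 :: 'k::field)"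
  "cf (germ_y ^ i) a b = (if a = 0 \<and> b = i then 1 else 0 :: 'k::field)"
  using cf_monomial [of i 0 a b] cf_monomial [of 0 i a b] by simp_all

lemma axis_form_dual:
  assumes "T \<ge> 1" "al \<noteq> 0 \<or> be \<noteq> 0" "i < 2 * T" "j < 2 * T"
  shows "axis_form T al be j (axis_dual T al be i) = (if i = j then 1 else 0)"
proof -
  consider "i < T" | "T \<le> i" "i < 2 * T - 1" | "i = 2 * T - 1" using assms(3) by linarith
  then show ?thesis
    using assms(1,2,4) by cases (auto simp: axis_form_def axis_dual_def cf_germ_power simp del: power_Suc)
qed

text \<open>Multiples of xy have no terms on the axes. In d h the terms x^T and y^T see only the
  constant term of \<open>h\<close>, so the relation between the weights suffices.\<close>

lemma axis_form_fib:
  assumes T: "T \<ge> 1" and d: "d \<in> mon_ideal (cross T)" and lm: "al * cf d T 0 + be * cf d 0 T = 0"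
    and f: "f \<in> fib_ideal d"
  shows "axis_form T al be j f = 0"
proof -
  obtain g h where f: "f = node * g + d * h" using f by (auto simp: fib_ideal_def)
  have dh: "cf (d * h) a b = 0" if "(a, b) \<notin> cross T" for a b
    using mon_ideal_mult_right [OF upset_cross d, of h] that by (rule mon_idealD)
  have x: "cf f a 0 = cf (d * h) a 0" and y: "cf f 0 b = cf (d * h) 0 b" for a b
    by (simp_all add: f cf_node_mult)
  have "cf (d * h) T 0 = (\<Sum>i\<le>T. cf d i 0 * cf h (T - i) 0)"
    unfolding cf_mult by simp
  also have "\<dots> = (\<Sum>i\<in>{T}. cf d i 0 * cf h (T - i) 0)"
    by (intro sum.mono_neutral_right) (use T in \<open>auto intro!: mon_idealD [OF d] simp: cross_def\<close>)
  finally have xT: "cf (d * h) T 0 = cf d T 0 * cf h 0 0" by simp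
  have "cf (d * h) 0 T = (\<Sum>i\<le>T. cf d 0 i * cf h 0 (T - i))"
    unfolding cf_mult by simp
  also have "\<dots> = (\<Sum>i\<in>{T}. cf d 0 i * cf h 0 (T - i))"
    by (intro sum.mono_neutral_right) (use T in \<open>auto intro!: mon_idealD [OF d] simp: cross_def\<close>)
  finally have yT: "cf (d * h) 0 T = cf d 0 T * cf h 0 0" by simp
  have "al * (cf d T 0 * cf h 0 0) + be * (cf d 0 T * cf h 0 0) = (al * cf d T 0 + be * cf d 0 T) * cf h 0 0"
    by (simp add: algebra_simps)
  then show ?thesis using T lm unfolding axis_form_def x y xT yT
    by (auto intro!: dh simp: cross_def)
qed

lemma fib_colength_lower:
  fixes d :: "'k::field fps fps"
  assumes "d \<in> mon_ideal (stair m)" and b: "quot_basis (fib_ideal d) n b"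
  shows "2 * tri (m - 1) \<le> n"
proof (cases "tri (m - 1) = 0")
  case False
  define T where "T = tri (m - 1)"
  have T: "T \<ge> 1" using False by (simp add: T_def)
  have d: "d \<in> mon_ideal (cross T)" unfolding T_def by (rule mon_ideal_mono [OF assms(1) stair_cross])
  \<comment> \<open>One linear equation in two unknowns has a nonzero solution, even if both
    coefficients of \<open>d\<close> vanish.\<close>
  obtain al be where lm: "al \<noteq> 0 \<or> be \<noteq> 0" "al * cf d T 0 + be * cf d 0 T = 0"
  proof (cases "cf d T 0 = 0")
    case True
    then show ?thesis using that [of 1 0] by simp
  next
    case False
    then show ?thesis using that [of "- cf d 0 T" "cf d T 0"] by simp
  qed
  have "2 * T \<le> n"
  proof (rule quot_basis_lower [OF b, where l = "axis_form T al be"])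
    fix j assume "j < 2 * T"
    then show "\<exists>f. \<forall>j'<2 * T. axis_form T al be j' f = (if j = j' then 1 else 0)"
      using axis_form_dual [OF T lm(1)] by blast
  qed (use axis_form_fib [OF T d lm(2)] klinear_axis_form in auto)
  then show ?thesis by (simp add: T_def)
qed simp

text \<open>With nonzero coefficients at x^T and y^T the ideal contains x^(T+1) and y^(T+1), so it
  is exactly the common kernel of the 2T forms.\<close>

lemma fib_quot_basis:
  fixes d :: "'k::field fps fps"
  assumes T: "T \<ge> 1" and d: "d \<in> mon_ideal (cross T)" and nz: "cf d T 0 \<noteq> 0" "cf d 0 T \<noteq> 0"
  shows "\<exists>b. quot_basis (fib_ideal d) (2 * T) b"
proof -
  define al be where "al = cf d 0 T" and "be = - cf d T 0"
  have lm: "al \<noteq> 0 \<or> be \<noteq> 0" "al * cf d T 0 + be * cf d 0 T = 0" using nz by (auto simp: al_def be_def)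
  note J = tideal_fib [of d]
  have node: "node \<in> fib_ideal d" and dd: "d \<in> fib_ideal d"
  proof -
    have "node = node * 1 + d * 0" "d = node * 0 + d * 1" by simp_all
    then show "node \<in> fib_ideal d" "d \<in> fib_ideal d" unfolding fib_ideal_def by blast+
  qed
  \<comment> \<open>The three generators x^T, y^T, xy, indexed by list positions to fit
    \<open>mon_ideal_generators\<close>.\<close>
  have cr: "cross T = (\<Union>p\<in>{0, 1, 2::nat}. {(a, b). [T, 0, 1] ! p \<le> a \<and> [0, T, 1] ! p \<le> b})"
    by (auto simp: cross_def)
  from d [unfolded cr] obtain g where "d = (\<Sum>p\<in>{0, 1, 2}. germ_x ^ ([T, 0, 1] ! p) * germ_y ^ ([0, T, 1] ! p) * g p)"
    using mon_ideal_generators [of "{0, 1, 2::nat}" d "\<lambda>p. [T, 0, 1] ! p" "\<lambda>p. [0, T, 1] ! p"] by auto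
  then have dg: "d = germ_x ^ T * g 0 + germ_y ^ T * g 1 + node * g 2"
    by (simp add: node_def)
  have xT: "germ_x ^ Suc T \<in> fib_ideal d"
  proof -
    have "cf (g 0) 0 0 = cf d T 0"
      using T arg_cong [OF dg, of "\<lambda>f. cf f T 0"]
      by (simp add: cf_germ_x_power_mult cf_germ_y_power_mult cf_node_mult)
    then obtain c where c: "g 0 * c = 1" using unit_if_cf_nonzero [of "g 0"] nz by auto
    obtain T' where T': "T = Suc T'" using T by (cases T) auto
    \<comment> \<open>Multiplication of \<open>d\<close> by x turns its part in y^T into a multiple
      of xy, and the cofactor \<open>g 0\<close> is a unit.\<close>
    have "germ_x ^ Suc T * g 0 = germ_x * d - node * (germ_y ^ T' * g 1 + germ_x * g 2)"
      by (subst dg) (simp add: node_def T' algebra_simps)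
    then have "germ_x ^ Suc T * g 0 \<in> fib_ideal d"
      using tideal_diff [OF J tideal_mult [OF J dd] tideal_mult_right [OF J node]] by simp
    from tideal_mult_right [OF J this, of c] show ?thesis by (simp only: mult.assoc c mult_1_right)
  qed
  have yT: "germ_y ^ Suc T \<in> fib_ideal d"
  proof -
    have "cf (g 1) 0 0 = cf d 0 T"
      using T arg_cong [OF dg, of "\<lambda>f. cf f 0 T"]
      by (simp add: cf_germ_x_power_mult cf_germ_y_power_mult cf_node_mult)
    then obtain c where c: "g 1 * c = 1" using unit_if_cf_nonzero [of "g 1"] nz by auto
    obtain T' where T': "T = Suc T'" using T by (cases T) auto
    have "germ_y ^ Suc T * g 1 = germ_y * d - node * (germ_x ^ T' * g 0 + germ_y * g 2)"
      by (subst dg) (simp add: node_def T' algebra_simps)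
    then have "germ_y ^ Suc T * g 1 \<in> fib_ideal d"
      using tideal_diff [OF J tideal_mult [OF J dd] tideal_mult_right [OF J node]] by simp
    from tideal_mult_right [OF J this, of c] show ?thesis by (simp only: mult.assoc c mult_1_right)
  qed
  have sub: "mon_ideal (cross (Suc T)) \<subseteq> fib_ideal d"
  proof -
    have cr: "cross (Suc T) = (\<Union>p\<in>{0, 1, 2::nat}. {(a, b). [Suc T, 0, 1] ! p \<le> a \<and> [0, Suc T, 1] ! p \<le> b})"
      by (auto simp: cross_def)
    show ?thesis unfolding cr
      by (rule mon_ideal_subset [OF J]) (use xT yT node in \<open>auto simp: node_def\<close>)
  qed
  have rev: "f \<in> fib_ideal d" if f: "\<forall>j<2 * T. axis_form T al be j f = 0" for f
  proof -
    \<comment> \<open>Subtracting s d removes the x^T term; the last form then shows that the y^T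
      term disappears as well.\<close>
    define s where "s = cf f T 0 / cf d T 0"
    have x: "cf f a 0 = 0" if "a < T" for a
      using f [rule_format, of a] that by (simp add: axis_form_def)
    have y: "cf f 0 b = 0" if "b < T" for b
    proof (cases "b = 0")
      case True
      then show ?thesis using x [of 0] T by simp
    next
      case False
      then obtain b' where b': "b = Suc b'" by (cases b) auto
      then have "T + b' < 2 * T - 1" using that by simp
      with b' show ?thesis using f [rule_format, of "T + b'"] by (simp add: axis_form_def)
    qed
    have z: "cf f 0 T = s * cf d 0 T"
    proof -
      have "\<not> 2 * T - 1 < T" "\<not> 2 * T - 1 < 2 * T - 1" "2 * T - 1 < 2 * T" using T by auto
      then have "al * cf f T 0 + be * cf f 0 T = 0"
        using f [rule_format, of "2 * T - 1"] by (simp only: axis_form_def if_False)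
      then show ?thesis using nz by (simp add: s_def al_def be_def field_simps)
    qed
    have dx: "cf d a 0 = 0" "cf d 0 a = 0" if "a < T" for a
      using that by (auto intro!: mon_idealD [OF d] simp: cross_def)
    have "f - const2 s * d \<in> mon_ideal (cross (Suc T))"
    proof (rule mon_idealI)
      fix a b assume "(a, b) \<notin> cross (Suc T)"
      then have "a = 0 \<or> b = 0" "a \<le> T" "b \<le> T" by (auto simp: cross_def)
      then consider "b = 0" "a < T" | "b = 0" "a = T" | "a = 0" "b < T" | "a = 0" "b = T"
        by linarith
      then show "cf (f - const2 s * d) a b = 0"
        by cases (simp_all add: x y z dx, simp add: s_def nz)
    qed
    then have "f - const2 s * d \<in> fib_ideal d" using sub by blast
    then have "f - const2 s * d + const2 s * d \<in> fib_ideal d"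
      by (intro tideal_add [OF J] tideal_mult [OF J] dd)
    then show ?thesis by simp
  qed
  have "quot_basis (fib_ideal d) (2 * T) (axis_dual T al be)"
  proof (rule quot_basis_dual [where l = "axis_form T al be"])
    show "f \<in> fib_ideal d \<longleftrightarrow> (\<forall>j<2 * T. axis_form T al be j f = 0)" for f
      using rev axis_form_fib [OF T d lm(2)] by blast
  qed (use axis_form_dual [OF T lm(1)] klinear_axis_form in auto)
  then show ?thesis by blast
qed

lemma quot_basis_unique:
  assumes b: "quot_basis J n b" and "0 \<in> J" "(\<Sum>i<n. const2 (d i) * b i) \<in> J" "tideal J" "i < n"
  shows "d i = 0"
proof -
  define P where "P c \<longleftrightarrow> c \<in> {..<n} \<rightarrow>\<^sub>E UNIV \<and> 0 - (\<Sum>i<n. const2 (c i) * b i) \<in> J" for c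
  have *: "\<exists>!c. P c"
    using b unfolding quot_basis_def P_def by blast
  have eq: "(\<Sum>i<n. const2 (restrict (\<lambda>i. - d i) {..<n} i) * b i) = - (\<Sum>i<n. const2 (d i) * b i)"
    by (simp add: sum_negf)
  have 1: "P (restrict (\<lambda>i. - d i) {..<n})"
    unfolding P_def eq using assms by (simp add: restrict_PiE_iff)
  have "(\<Sum>i<n. const2 (restrict (\<lambda>i. 0) {..<n} i) * b i) = 0"
    by (intro sum.neutral) simp
  then have 2: "P (restrict (\<lambda>i. 0) {..<n})"
    unfolding P_def using assms by (simp only:) (simp add: restrict_PiE_iff)
  have "restrict (\<lambda>i. - d i) {..<n} = restrict (\<lambda>i. 0) {..<n}"
    using * 1 2 by blast
  from fun_cong [OF this, of i] show ?thesis using \<open>i < n\<close> by simp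
qed

text \<open>If \<open>d\<close> vanished on one axis, all powers of that axis variable would be
  independent in the quotient. So \<open>d\<close> is nonzero on both axes, each axis has a domain
  as its ring of series, and \<open>d\<close> is regular modulo xy.\<close>

lemma finite_fib_regular:
  fixes d :: "'k::field fps fps"
  assumes b: "quot_basis (fib_ideal d) n b" and s: "node dvd d * s"
  shows "node dvd s"
proof -
  have "\<exists>a. cf d a 0 \<noteq> 0"
  proof (rule ccontr)
    assume "\<not> ?thesis"
    then have d0: "fps_nth d 0 = 0" by (simp add: cf_def fps_eq_iff)
    have "Suc n \<le> n"
    proof (rule quot_basis_lower [OF b, where l = "\<lambda>j f. cf f j 0"])
      show "cf f j 0 = 0" if "f \<in> fib_ideal d" for f j
        using that d0 by (auto simp: fib_ideal_def cf_node_mult) (simp add: cf_def)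
      show "\<exists>f :: 'k fps fps. \<forall>j'<Suc n. cf f j' 0 = (if j = j' then 1 else 0)" for j
        by (rule exI [of _ "germ_x ^ j"]) (auto simp: cf_germ_power)
    qed (rule klinear_cf)
    then show False by simp
  qed
  then have x: "fps_nth d 0 \<noteq> 0" by (auto simp: cf_def)
  let ?r = "coeff_map (\<lambda>p. fps_nth p 0)"
  have hom: "rhom (?r :: 'k fps fps \<Rightarrow> 'k fps)" by (intro rhom_coeff_map rhomI) simp_all
  have "\<exists>a. cf d 0 a \<noteq> 0"
  proof (rule ccontr)
    assume "\<not> ?thesis"
    then have d0: "?r d = 0" by (simp add: cf_def fps_eq_iff)
    have dh: "cf (d * h) 0 a = 0" for h a
    proof -
      have "?r (d * h) = 0" by (simp add: rhomD [OF hom] d0)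
      then show ?thesis by (simp add: cf_def fps_eq_iff)
    qed
    have "Suc n \<le> n"
    proof (rule quot_basis_lower [OF b, where l = "\<lambda>j f. cf f 0 j"])
      show "cf f 0 j = 0" if "f \<in> fib_ideal d" for f j
        using that dh by (auto simp: fib_ideal_def cf_node_mult)
      show "\<exists>f :: 'k fps fps. \<forall>j'<Suc n. cf f 0 j' = (if j = j' then 1 else 0)" for j
        by (rule exI [of _ "germ_y ^ j"]) (auto simp: cf_germ_power)
    qed (rule klinear_cf)
    then show False by simp
  qed
  then have y: "?r d \<noteq> 0" by (auto simp: cf_def fps_eq_iff)
  have "fps_nth (d * s) 0 = 0" "?r (d * s) = 0"
    using s by (auto simp: node_dvd_iff cf_def fps_eq_iff)
  then have "fps_nth s 0 = 0" "?r s = 0" using x y by (simp_all add: rhomD [OF hom])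
  then show ?thesis by (auto simp: node_dvd_iff cf_def fps_eq_iff)
qed

section \<open>Freeness over k[[t]] of the quotient by a regular determinant\<close>

context smoothing
begin

lemma node_eq: "node = - u * t0"
proof -
  have "- u * t0 = - (u * w) * node" by (simp add: t0_def gx_def node_def mult_ac)
  then show ?thesis by (simp add: uw)
qed

lemma t0_eq: "t0 = w * node"
  by (simp add: t0_def gx_def node_def mult_ac)

lemma t0_nonzero: "t0 \<noteq> 0"
  using gx_nonzero by (simp add: t0_def germ_y_def)

text \<open>The structure map from k[[t]] to k[[x,y]], sending t to t0.\<close>

definition kap :: "'k fps \<Rightarrow> 'k fps fps"
  where "kap g = eps (coeff_map const2 g)"

lemma rhom_kap: "rhom kap"
  unfolding kap_def by (rule rhom_comp [OF rhom_ev [OF t0_mpow] rhom_coeff_map [OF rhom_const2]])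

lemma kap_rec: "kap g = const2 (fps_nth g 0) + t0 * kap (fps_shift 1 g)"
proof -
  have "fps_shift 1 (coeff_map const2 g) = coeff_map const2 (fps_shift 1 g)"
    by (simp add: fps_eq_iff)
  then show ?thesis using ev_rec [OF t0_mpow, of "coeff_map const2 g"] by (simp add: kap_def)
qed

text \<open>Nakayama's lemma in the complete case: a basis modulo t and the determinant spans over
  k[[t]], because the remainder after each step is again divisible by t0.\<close>

lemma kt_spanning:
  assumes b: "quot_basis (fib_ideal d) n b"
  shows "\<exists>c h. f = (\<Sum>i<n. kap (c i) * b i) + d * h"
proof -
  have "\<exists>c g h. f = (\<Sum>i<n. const2 (c i) * b i) + d * h + t0 * g" for f
  proof -
    obtain c where "f - (\<Sum>i<n. const2 (c i) * b i) \<in> fib_ideal d"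
      using b unfolding quot_basis_def by blast
    then obtain g h where "f - (\<Sum>i<n. const2 (c i) * b i) = node * g + d * h" by (auto simp: fib_ideal_def)
    then have "f = (\<Sum>i<n. const2 (c i) * b i) + d * h + t0 * (- u * g)"
      by (simp add: node_eq algebra_simps)
    then show ?thesis by blast
  qed
  then obtain C G K where CG: "f = (\<Sum>i<n. const2 (C f i) * b i) + d * K f + t0 * G f" for f
    by metis
  \<comment> \<open>Successive remainders: s_l equals its basis part plus a multiple of
    \<open>d\<close> plus t0 s_(l+1). The series \<open>S\<close> has coefficients s_l - t0 s_(l+1),
    so its partial sums at t0 telescope.\<close>
  define s where "s l = (G ^^ l) f" for l
  define S where "S = (\<Sum>i<n. coeff_map const2 (Abs_fps (\<lambda>l. C (s l) i)) * fps_const (b i))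
      + fps_const d * Abs_fps (\<lambda>l. K (s l))"
  have nth: "fps_nth S l = s l - t0 * s (Suc l)" for l
  proof -
    have "(\<Sum>i<n. const2 (C (s l) i) * b i) + d * K (s l) + t0 * s (Suc l) = s l"
      using CG [of "s l", symmetric] by (simp only: s_def funpow.simps o_apply)
    then show ?thesis by (simp add: S_def fps_sum_nth eq_diff_eq)
  qed
  have "eps S = f"
  proof (rule ev_eqI [OF t0_mpow])
    fix N
    have "f - (\<Sum>l<N. fps_nth S l * t0 ^ l) = t0 ^ N * s N"
    proof (induction N)
      case (Suc N)
      then show ?case by (simp add: nth algebra_simps)
    qed (simp add: s_def)
    then show "f - (\<Sum>l<N. fps_nth S l * t0 ^ l) \<in> mpow N"
      using mon_ideal_mult_right [OF upset_deg mpow_power [OF t0_mpow]] by metis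
  qed
  then have "f = (\<Sum>i<n. kap (Abs_fps (\<lambda>l. C (s l) i)) * b i) + d * eps (Abs_fps (\<lambda>l. K (s l)))"
    by (simp add: S_def eps_hom kap_def)
  then show ?thesis
    by (intro exI [of _ "\<lambda>i. Abs_fps (\<lambda>l. C (s l) i)"] exI [of _ "eps (Abs_fps (\<lambda>l. K (s l)))"])
qed

text \<open>Reduction modulo t0 kills the constant terms of the coefficients. Then t0 divides d h,
  regularity moves the factor into \<open>h\<close>, and cancelling t0 gives a relation among the
  shifted coefficients.\<close>

lemma kt_independent:
  assumes b: "quot_basis (fib_ideal d) n b" and "(\<Sum>i<n. kap (c i) * b i) = d * h" "i < n"
  shows "c i = 0"
proof -
  have split: "(\<Sum>i<n. kap (c i) * b i) = (\<Sum>i<n. const2 (fps_nth (c i) 0) * b i)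
      + t0 * (\<Sum>i<n. kap (fps_shift 1 (c i)) * b i)" for c
    by (subst kap_rec) (simp only: distrib_right sum.distrib sum_distrib_left mult.assoc)
  have zero: "fps_nth (c i) 0 = 0" if "(\<Sum>i<n. kap (c i) * b i) = d * h" "i < n" for c h i
  proof -
    have "(\<Sum>i<n. const2 (fps_nth (c i) 0) * b i) = node * (- w * (\<Sum>i<n. kap (fps_shift 1 (c i)) * b i)) + d * h"
      using that(1) unfolding split [of c] by (simp add: t0_eq algebra_simps)
    then have "(\<Sum>i<n. const2 (fps_nth (c i) 0) * b i) \<in> fib_ideal d" unfolding fib_ideal_def by blast
    from quot_basis_unique [OF b tideal_0 [OF tideal_fib] this tideal_fib \<open>i < n\<close>]
    show ?thesis .
  qed
  have "fps_nth (c i) l = 0" for l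
    using assms(2)
  proof (induction l arbitrary: c h)
    case (0 c h)
    from zero [OF this \<open>i < n\<close>] show ?case .
  next
    case (Suc l c h)
    have e: "t0 * (\<Sum>i<n. kap (fps_shift 1 (c i)) * b i) = d * h"
      using Suc.prems zero [OF Suc.prems] unfolding split [of c] by simp
    moreover have "node dvd t0 * g" for g unfolding t0_eq by simp
    ultimately have "node dvd d * h" by metis
    then have "node dvd h" by (rule finite_fib_regular [OF b])
    then obtain h' where "h = node * h'" by blast
    then have "d * h = t0 * (d * (- u * h'))" by (simp only: node_eq mult_ac)
    then have "t0 * (\<Sum>i<n. kap (fps_shift 1 (c i)) * b i) = t0 * (d * (- u * h'))"
      using e by (simp only:)
    then have "(\<Sum>i<n. kap (fps_shift 1 (c i)) * b i) = d * (- u * h')"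
      using t0_nonzero by (simp only: mult_cancel_left) simp
    from Suc.IH [OF this] show ?case by simp
  qed
  then show ?thesis by (simp add: fps_eq_iff)
qed

end

lemma two_tri: "2 * tri (m - 1) = m * (m - 1)"
proof (cases m)
  case (Suc k)
  have "2 * tri k = Suc k * k" by (induction k) simp_all
  then show ?thesis by (simp add: Suc)
qed simp

lemma prod_power_tri: "(\<Prod>i<j. (z :: 'a::comm_monoid_mult) ^ i) = z ^ tri (j - 1)"
proof -
  have "(\<Sum>i<j. i) = tri (j - 1)" by (cases j) (simp_all add: tri_def lessThan_Suc_atMost)
  then show ?thesis by (simp flip: power_sum)
qed

lemma prod_power_tri_rev:
  "(\<Prod>i=j..<m. (z :: 'a::comm_monoid_mult) ^ (m - i)) = z ^ tri (m - j)"
proof -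
  have "(\<Sum>i=j..<m. m - i) = \<Sum>{1..m - j}"
    by (rule sum.reindex_bij_witness [of _ "\<lambda>i. m - i" "\<lambda>i. m - i"]) auto
  also have "\<dots> = tri (m - j)"
    unfolding tri_def by (rule sum.mono_neutral_left) auto
  finally have "(\<Sum>i=j..<m. m - i) = tri (m - j)" .
  then show ?thesis by (simp flip: power_sum)
qed

section \<open>Lists of principal parts attaining the bounds\<close>

context smoothing
begin

text \<open>\<open>rho\<close> enters only for n >= 1, where its values are controlled;
  \<open>sig m 0\<close> already has the value 1. The pairing is diagonal, and each entry X^n +
  y^(m-n) is nonzero on both branches.\<close>

definition tau1 :: "nat \<Rightarrow> nat \<Rightarrow> 'k fps fps fps fps fps"
  where "tau1 m n = (if n = 0 then sig m 0 else sig m n + rho m n)"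

text \<open>Column n carries X^n in row n and, for n >= 1, y^(m-n-1) in row n + 1. Deleting row j
  leaves powers of X as pivots before the gap and powers of y after it, so each monomial generator
  is one minor.\<close>

definition tau2 :: "nat \<Rightarrow> nat \<Rightarrow> 'k fps fps fps fps fps"
  where "tau2 m n = (if n = 0 then sig m 0 else sig m n + rho m (n + 1))"

text \<open>Column n carries X^n in row n for n < m, and y^(m-n+1) in row n - 1 for n >= 2. Here a
  deleted column separates the two kinds of pivots.\<close>

definition tau11 :: "nat \<Rightarrow> nat \<Rightarrow> 'k fps fps fps fps fps"
  where "tau11 m n = (if n = 0 then sig m 0
    else (if n < m then sig m n else 0) + (if 2 \<le> n then rho m (n - 1) else 0))"

lemma e_tau1:
  assumes "i < m" "n < m"
  shows "e (bpol m i) (tau1 m n) = (if n = i then if n = 0 then 1 else gx ^ n + germ_y ^ (m - n) else 0)"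
  using assms by (auto simp: tau1_def e_sig e_rho e_add)

lemma e_tau2:
  assumes "i < m" "n < m - 1"
  shows "e (bpol m i) (tau2 m n) =
    (if i = n then gx ^ n else 0) + (if 1 \<le> n \<and> i = n + 1 then germ_y ^ (m - i) else 0)"
  using assms by (auto simp: tau2_def e_sig e_rho e_add)

lemma e_tau11:
  assumes "i < m" "n \<le> m"
  shows "e (bpol m i) (tau11 m n) =
    (if i = n then gx ^ n else 0) + (if 2 \<le> n \<and> n = i + 1 then germ_y ^ (m - i) else 0)"
  using assms by (auto simp: tau11_def e_sig e_rho e_add e_0)

definition det1 :: "nat \<Rightarrow> 'k fps fps"
  where "det1 m = (\<Prod>n<m. if n = 0 then 1 else gx ^ n + germ_y ^ (m - n))"

lemma tdet_tau1: "tdet m (\<lambda>i j. e (bpol m i) (tau1 m j)) = det1 m"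
proof -
  have "tdet m (\<lambda>i j. e (bpol m i) (tau1 m j)) = (\<Prod>i<m. e (bpol m i) (tau1 m i))"
    by (rule tdet_acyclic) (simp add: e_tau1 split: if_splits)
  then show ?thesis by (simp add: e_tau1 det1_def)
qed

lemma tdet_tau2:
  assumes j: "1 \<le> j" "j \<le> m - 1"
  shows "tdet (m - 1) (\<lambda>i k. e (bpol m (if i < j then i else i + 1)) (tau2 m k)) =
    gx ^ tri (j - 1) * germ_y ^ tri (m - 1 - j)"
proof -
  let ?A = "\<lambda>i k. e (bpol m (if i < j then i else i + 1)) (tau2 m k)"
  have A: "?A i k = (if (if i < j then i else i + 1) = k then gx ^ k else 0) +
      (if 1 \<le> k \<and> (if i < j then i else i + 1) = k + 1 then germ_y ^ (m - (if i < j then i else i + 1)) else 0)"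
    if "i < m - 1" "k < m - 1" for i k
    using that by (intro e_tau2) auto
  have "tdet (m - 1) ?A = (\<Prod>i<m - 1. ?A i i)"
  \<comment> \<open>The block before \<open>j\<close> is lower triangular and the block from
    \<open>j\<close> on is upper triangular, so the potential increases on the first and decreases
    on the second.\<close>
  proof (rule tdet_acyclic [where h = "\<lambda>i. if i < j then i else m + j - i"])
    fix i k assume "i < m - 1" "k < m - 1" "k \<noteq> i" "?A i k \<noteq> 0"
    with A [of i k] show "(if k < j then k else m + j - k) < (if i < j then i else m + j - i)"
      by (auto split: if_splits)
  qed
  also have "\<dots> = (\<Prod>i<j. ?A i i) * (\<Prod>i=j..<m - 1. ?A i i)"
    using j by (subst prod.union_disjoint [symmetric]) (auto intro!: prod.cong)
  also have "(\<Prod>i<j. ?A i i) = (\<Prod>i<j. gx ^ i)"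
  proof (rule prod.cong [OF refl])
    fix i assume "i \<in> {..<j}"
    then show "?A i i = gx ^ i" using j by (subst A) auto
  qed
  also have "(\<Prod>i=j..<m - 1. ?A i i) = (\<Prod>i=j..<m - 1. germ_y ^ (m - 1 - i))"
  proof (rule prod.cong [OF refl])
    fix i assume "i \<in> {j..<m - 1}"
    then show "?A i i = germ_y ^ (m - 1 - i)" using j by (subst A) auto
  qed
  finally show ?thesis by (simp only: prod_power_tri prod_power_tri_rev)
qed

lemma tdet_tau11:
  assumes j: "1 \<le> j" "j \<le> m"
  shows "tdet m (\<lambda>i k. e (bpol m i) (tau11 m (if k < j then k else k + 1))) =
    gx ^ tri (j - 1) * germ_y ^ tri (m - j)"
proof -
  let ?A = "\<lambda>i k. e (bpol m i) (tau11 m (if k < j then k else k + 1))"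
  have A: "?A i k = (if i = (if k < j then k else k + 1) then gx ^ (if k < j then k else k + 1) else 0) +
      (if 2 \<le> (if k < j then k else k + 1) \<and> (if k < j then k else k + 1) = i + 1 then germ_y ^ (m - i) else 0)"
    if "i < m" "k < m" for i k
    using that by (intro e_tau11) auto
  have "tdet m ?A = (\<Prod>i<m. ?A i i)"
  \<comment> \<open>The orientations are opposite to those of the preceding list, hence so are the
    monotonicities of the potential.\<close>
  proof (rule tdet_acyclic [where h = "\<lambda>i. if i < j then m - i else i"])
    fix i k assume "i < m" "k < m" "k \<noteq> i" "?A i k \<noteq> 0"
    with A [of i k] show "(if k < j then m - k else k) < (if i < j then m - i else i)"
      by (auto split: if_splits)
  qed
  also have "\<dots> = (\<Prod>i<j. ?A i i) * (\<Prod>i=j..<m. ?A i i)"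
    using j by (subst prod.union_disjoint [symmetric]) (auto intro!: prod.cong)
  also have "(\<Prod>i<j. ?A i i) = (\<Prod>i<j. gx ^ i)"
  proof (rule prod.cong [OF refl])
    fix i assume "i \<in> {..<j}"
    then show "?A i i = gx ^ i" using j by (subst A) auto
  qed
  also have "(\<Prod>i=j..<m. ?A i i) = (\<Prod>i=j..<m. germ_y ^ (m - i))"
  proof (rule prod.cong [OF refl])
    fix i assume "i \<in> {j..<m}"
    then show "?A i i = germ_y ^ (m - i)" using j by (subst A) auto
  qed
  finally show ?thesis by (simp only: prod_power_tri prod_power_tri_rev)
qed

lemma minor_in_stair:
  assumes r: "r \<ge> 1" and B: "\<And>i j. i < r \<Longrightarrow> j < r \<Longrightarrow> B i j = (\<Sum>l<m. P i l * e (bpol m l) (\<tau> j))"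
  shows "tdet r B \<in> mon_ideal (stair r)"
  by (rule tdet_in_stair [OF r e_bpol_in_corner B])

lemma det1_in_stair: "m \<ge> 1 \<Longrightarrow> det1 m \<in> mon_ideal (stair m)"
  unfolding tdet_tau1 [symmetric]
  by (rule minor_in_stair [where P = "\<lambda>i l. if i = l then 1 else 0" and m = m])
     (auto simp: if_distrib [of "\<lambda>a. a * _"] cong: if_cong)

text \<open>Restrict each factor to an axis: X^n + y^(m-n) becomes (w x)^n for y = 0 and y^(m-n) for
  x = 0. The exponents add up to tri (m - 1) in both cases.\<close>

lemma det1_cf:
  assumes m: "m \<ge> 2"
  shows "cf (det1 m) (tri (m - 1)) 0 \<noteq> 0" "cf (det1 m) 0 (tri (m - 1)) \<noteq> 0"
proof -
  have w0: "cf w 0 0 \<noteq> 0"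
  proof
    assume "cf w 0 0 = 0"
    then have "cf (u * w) 0 0 = 0" by (simp add: cf_mult)
    then show False by (simp add: uw cf_1)
  qed
  \<comment> \<open>The coefficient at outer index 0 is restriction to y = 0.\<close>
  have hom0: "rhom (\<lambda>f :: 'k fps fps. fps_nth f 0)" by (intro rhomI) simp_all
  have prod0: "fps_nth (prod f A) 0 = (\<Prod>i\<in>A. fps_nth (f i) 0)" for f :: "nat \<Rightarrow> 'k fps fps" and A
    by (induction A rule: infinite_finite_induct) simp_all
  have "fps_nth (det1 m) 0 = (\<Prod>n<m. (fps_X * fps_nth w 0) ^ n)"
    unfolding det1_def prod0
  proof (rule prod.cong [OF refl])
    fix n assume "n \<in> {..<m}"
    then have "0 < m - n" by simp
    then show "fps_nth (if n = 0 then 1 else gx ^ n + germ_y ^ (m - n)) 0 = (fps_X * fps_nth w 0 :: 'k fps) ^ n"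
      by (simp add: gx_def germ_x_def germ_y_def rhomD(7) [OF hom0] zero_power)
  qed
  then have "fps_nth (det1 m) 0 = fps_X ^ tri (m - 1) * fps_nth w 0 ^ tri (m - 1)"
    unfolding prod_power_tri by (simp only: power_mult_distrib)
  then have "cf (det1 m) (tri (m - 1)) 0 = fps_nth (fps_nth w 0 ^ tri (m - 1)) 0"
    by (simp add: cf_def fps_X_power_mult_nth)
  then show "cf (det1 m) (tri (m - 1)) 0 \<noteq> 0" using w0 by (simp add: cf_def fps_power_zeroth)
  \<comment> \<open>Taking constant terms in the inner variable is restriction to x = 0.\<close>
  let ?r = "coeff_map (\<lambda>p. fps_nth p 0)"
  have hom: "rhom (?r :: 'k fps fps \<Rightarrow> 'k fps)" by (intro rhom_coeff_map rhomI) simp_all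
  have prod1: "?r (prod f A) = (\<Prod>i\<in>A. ?r (f i))" for f :: "nat \<Rightarrow> 'k fps fps" and A
    by (induction A rule: infinite_finite_induct) (simp_all add: rhomD [OF hom])
  have rx: "?r gx = 0" and ry: "?r germ_y = fps_X"
    by (simp_all add: gx_def rhomD [OF hom] germ_x_def germ_y_def coeff_map_const coeff_map_X)
  have "?r (det1 m) = (\<Prod>n\<in>{1..<m}. ?r (if n = 0 then 1 else gx ^ n + germ_y ^ (m - n)))"
    unfolding det1_def prod1 using m
    by (intro prod.mono_neutral_right) (auto simp: rhomD [OF hom])
  also have "\<dots> = (\<Prod>n=1..<m. fps_X ^ (m - n))"
    by (rule prod.cong [OF refl]) (auto simp: rhomD [OF hom] rx ry zero_power)
  also have "\<dots> = fps_X ^ tri (m - 1)" by (rule prod_power_tri_rev)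
  finally have "fps_nth (?r (det1 m)) (tri (m - 1)) = 1" by simp
  then show "cf (det1 m) 0 (tri (m - 1)) \<noteq> 0" by (simp add: cf_def)
qed

lemma det1_quot_basis:
  assumes m: "m \<ge> 1"
  shows "\<exists>b. quot_basis (fib_ideal (det1 m)) (m * (m - 1)) b"
proof (cases "m = 1")
  case True
  have "g = node * 0 + det1 1 * g" for g by (simp add: det1_def)
  then have "fib_ideal (det1 m) = UNIV" unfolding fib_ideal_def True by blast
  then show ?thesis by (simp add: True quot_basis_def)
next
  case False
  have "det1 m \<in> mon_ideal (cross (tri (m - 1)))"
    by (rule mon_ideal_mono [OF det1_in_stair [OF m] stair_cross])
  moreover have "tri (m - 1) \<ge> 1" using False m tri_mono [of 1 "m - 1"] by simp
  ultimately show ?thesis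
    using fib_quot_basis [of "tri (m - 1)" "det1 m"] det1_cf [of m] False m by (simp only: two_tri) auto
qed

lemma stair_subset_gx:
  assumes J: "tideal J" and gen: "\<And>p q. p + q + 1 = r \<Longrightarrow> gx ^ tri p * germ_y ^ tri q \<in> J"
  shows "mon_ideal (stair r) \<subseteq> J"
proof (rule stair_subset [OF J])
  fix p q assume "p + q + 1 = r"
  from tideal_mult [OF J gen [OF this], of "(- u) ^ tri p"]
  have "(- u * gx) ^ tri p * germ_y ^ tri q \<in> J" by (simp only: power_mult_distrib mult.assoc)
  then show "germ_x ^ tri p * germ_y ^ tri q \<in> J" by (simp only: germ_x_eq [symmetric])
qed

end

section \<open>Quotients of type-class rings as records\<close>

lemma type_ring_simps [simp]:
  "carrier type_ring = UNIV" "x \<otimes>\<^bsub>type_ring\<^esub> y = x * y" "\<one>\<^bsub>type_ring\<^esub> = 1" "\<zero>\<^bsub>type_ring\<^esub> = 0"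
  "x \<oplus>\<^bsub>type_ring\<^esub> y = x + y"
  by (simp_all add: ring_of_type_algebra_def)

lemma cring_type_ring: "cring (type_ring :: 'a::comm_ring_1 ring)"
  by (rule cring_from_type_algebra)

lemma ring_type_ring: "ring (type_ring :: 'a::comm_ring_1 ring)"
  by (rule ring_from_type_algebra)

lemma a_inv_type_ring [simp]: "\<ominus>\<^bsub>type_ring\<^esub> x = - (x :: 'a::comm_ring_1)"
proof -
  interpret cring "type_ring :: 'a ring" by (rule cring_type_ring)
  show ?thesis by (rule minus_equality) simp_all
qed

lemma inv_add_monoid:
  "m_inv \<lparr>carrier = carrier E, monoid.mult = add E, one = ring.zero E\<rparr> x = \<ominus>\<^bsub>E\<^esub> x"
  by (simp add: a_inv_def m_inv_def)

lemma ideal_type_ring_iff: "ideal J (type_ring :: 'a::comm_ring_1 ring) \<longleftrightarrow> tideal J"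
proof
  assume "ideal J (type_ring :: 'a ring)"
  then interpret ideal J "type_ring :: 'a ring" .
  show "tideal J"
    using additive_subgroup.zero_closed [OF is_additive_subgroup]
      additive_subgroup.a_closed [OF is_additive_subgroup] I_l_closed by (auto simp: tideal_def)
next
  assume J: "tideal J"
  have "- a \<in> J" if "a \<in> J" for a using tideal_mult [OF J that, of "- 1"] by simp
  then show "ideal J (type_ring :: 'a ring)"
    using J tideal_mult_right [OF J]
    by (intro idealI ring_type_ring group.subgroupI abelian_group.a_group ring.is_abelian_group)
       (auto simp: tideal_def inv_add_monoid [of type_ring, simplified])
qed

lemma PIdl_type_ring: "PIdl\<^bsub>type_ring\<^esub> F = {s. F dvd (s :: 'a::comm_ring_1)}"
  by (auto simp: cgenideal_def dvd_def mult.commute)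

lemma genideal_type_ring:
  fixes S :: "'a::comm_ring_1 set"
  shows "tideal (genideal type_ring S)" "S \<subseteq> genideal type_ring S"
    "tideal J \<Longrightarrow> S \<subseteq> J \<Longrightarrow> genideal type_ring S \<subseteq> J"
proof -
  interpret ring "type_ring :: 'a ring" by (rule ring_type_ring)
  show "tideal (genideal type_ring S)" unfolding ideal_type_ring_iff [symmetric] by (rule genideal_ideal) simp
  show "S \<subseteq> genideal type_ring S" by (rule genideal_self) simp
  show "tideal J \<Longrightarrow> S \<subseteq> J \<Longrightarrow> genideal type_ring S \<subseteq> J"
    unfolding ideal_type_ring_iff [symmetric] by (rule genideal_minimal)
qed

lemma tideal_dvd: "tideal {s. F dvd (s :: 'a::comm_ring_1)}"
  by (auto simp: tideal_def)

text \<open>A presentation of the record ring \<open>E\<close> as a quotient of a type-class ring by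
  \<open>J\<close>. It passes through iterated quotients, so that O_X, the principal parts and the
  degeneracy quotients are all computed on representatives.\<close>

definition surj_hom :: "('b::comm_ring_1 \<Rightarrow> 'c) \<Rightarrow> 'c ring \<Rightarrow> 'b set \<Rightarrow> bool"
  where "surj_hom \<gamma> E J \<longleftrightarrow> cring E \<and> \<gamma> \<in> ring_hom type_ring E \<and> range \<gamma> = carrier E \<and>
    (\<forall>f g. \<gamma> f = \<gamma> g \<longleftrightarrow> f - g \<in> J)"

lemma surj_homD:
  assumes "surj_hom \<gamma> E J"
  shows "cring E" "\<gamma> f \<in> carrier E" "\<gamma> (f + g) = \<gamma> f \<oplus>\<^bsub>E\<^esub> \<gamma> g" "\<gamma> (f * g) = \<gamma> f \<otimes>\<^bsub>E\<^esub> \<gamma> g"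
    "\<gamma> 1 = \<one>\<^bsub>E\<^esub>" "\<gamma> 0 = \<zero>\<^bsub>E\<^esub>" "\<gamma> (- f) = \<ominus>\<^bsub>E\<^esub> \<gamma> f" "carrier E = range \<gamma>"
    "\<gamma> f = \<gamma> g \<longleftrightarrow> f - g \<in> J" "\<gamma> f = \<zero>\<^bsub>E\<^esub> \<longleftrightarrow> f \<in> J"
proof -
  show E: "cring E" using assms by (simp add: surj_hom_def)
  interpret E: cring E by fact
  have h: "\<gamma> \<in> ring_hom type_ring E" using assms by (simp add: surj_hom_def)
  interpret ring_hom_cring "type_ring :: 'a ring" E \<gamma>
    using h by (intro ring_hom_cringI ring_hom_ringI2 ring_type_ring E.ring_axioms cring_type_ring E)
  show "\<gamma> f \<in> carrier E" by simp
  show "\<gamma> (f + g) = \<gamma> f \<oplus>\<^bsub>E\<^esub> \<gamma> g" using hom_add [of f g] by simp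
  show "\<gamma> (f * g) = \<gamma> f \<otimes>\<^bsub>E\<^esub> \<gamma> g" using hom_mult [of f g] by simp
  show "\<gamma> 1 = \<one>\<^bsub>E\<^esub>" using hom_one by simp
  show 0: "\<gamma> 0 = \<zero>\<^bsub>E\<^esub>" using hom_zero by simp
  show "\<gamma> (- f) = \<ominus>\<^bsub>E\<^esub> \<gamma> f" using hom_a_inv [of f] by simp
  show "carrier E = range \<gamma>" using assms by (simp add: surj_hom_def)
  show k: "\<gamma> f = \<gamma> g \<longleftrightarrow> f - g \<in> J" for g using assms by (simp add: surj_hom_def)
  show "\<gamma> f = \<zero>\<^bsub>E\<^esub> \<longleftrightarrow> f \<in> J" using k [of 0] by (simp add: 0)
qed

lemma surj_hom_finsum:
  assumes "surj_hom \<gamma> E J" "finite A"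
  shows "\<gamma> (\<Sum>i\<in>A. f i) = (\<Oplus>\<^bsub>E\<^esub>i\<in>A. \<gamma> (f i))"
  using assms(2)
proof (induction A rule: finite_induct)
  interpret E: cring E using surj_homD(1) [OF assms(1)] .
  note h = surj_homD [OF assms(1)]
  { case empty show ?case by (simp add: h) }
  { case (insert i A) then show ?case by (simp add: h(1-7) Pi_def) }
qed

lemma surj_hom_finprod:
  assumes "surj_hom \<gamma> E J" "finite A"
  shows "\<gamma> (\<Prod>i\<in>A. f i) = (\<Otimes>\<^bsub>E\<^esub>i\<in>A. \<gamma> (f i))"
  using assms(2)
proof (induction A rule: finite_induct)
  interpret E: cring E using surj_homD(1) [OF assms(1)] .
  note h = surj_homD [OF assms(1)]
  { case empty show ?case by (simp add: h) }
  { case (insert i A) then show ?case by (simp add: h(1-7) Pi_def) }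
qed

lemma surj_hom_det:
  assumes "surj_hom \<gamma> E J"
  shows "ring_det E r (\<lambda>i j. \<gamma> (B i j)) = \<gamma> (tdet r B)"
proof -
  interpret E: cring E using surj_homD(1) [OF assms] .
  have fin: "finite {p. p permutes {..<r}}" by (rule finite_permutations) simp
  have sgn: "(if evenperm p then \<gamma> (\<Prod>i<r. B i (p i)) else \<ominus>\<^bsub>E\<^esub> \<gamma> (\<Prod>i<r. B i (p i))) =
      \<gamma> (of_int (sign p) * (\<Prod>i<r. B i (p i)))" for p
    by (simp add: sign_def surj_homD(1-7) [OF assms] E.l_minus)
  show ?thesis
    unfolding ring_det_def tdet_def Let_def
    by (simp only: surj_hom_finsum [OF assms fin] surj_hom_finprod [OF assms finite_lessThan, symmetric] sgn)
qed

lemma ideal_cosets: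
  assumes "cring E" "ideal I E" "x \<in> carrier E" "y \<in> carrier E"
  shows "I +>\<^bsub>E\<^esub> x = I +>\<^bsub>E\<^esub> y \<longleftrightarrow> x \<ominus>\<^bsub>E\<^esub> y \<in> I"
  using ring.quotient_eq_iff_same_a_r_cos [OF cring.axioms(1) [OF assms(1)] assms(2,3,4)] by auto

lemma surj_hom_quot:
  assumes \<gamma>: "surj_hom \<gamma> E J" and I: "ideal I E"
  shows "surj_hom (\<lambda>f. I +>\<^bsub>E\<^esub> \<gamma> f) (E Quot I) {f. \<gamma> f \<in> I}"
proof -
  interpret E: cring E using surj_homD(1) [OF \<gamma>] .
  interpret I: ideal I E by fact
  note h = surj_homD [OF \<gamma>]
  show ?thesis unfolding surj_hom_def
  proof (intro conjI allI)
    show "cring (E Quot I)" by (rule I.quotient_is_cring) (rule E.is_cring)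
    have "(\<lambda>x. I +>\<^bsub>E\<^esub> x) \<in> ring_hom E (E Quot I)" by (rule I.rcos_ring_hom)
    moreover have "\<gamma> \<in> ring_hom type_ring E" using \<gamma> by (simp add: surj_hom_def)
    ultimately show "(\<lambda>f. I +>\<^bsub>E\<^esub> \<gamma> f) \<in> ring_hom type_ring (E Quot I)"
      using ring_hom_trans [of \<gamma> type_ring E "\<lambda>x. I +>\<^bsub>E\<^esub> x" "E Quot I"] by (simp add: comp_def)
    show "range (\<lambda>f. I +>\<^bsub>E\<^esub> \<gamma> f) = carrier (E Quot I)"
      by (auto simp: FactRing_def A_RCOSETS_def' a_r_coset_def' h(8))
    fix f g
    have "\<gamma> f \<ominus>\<^bsub>E\<^esub> \<gamma> g = \<gamma> (f - g)" using h(3) [of f "- g"] by (simp add: a_minus_def h(7))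
    then show "I +>\<^bsub>E\<^esub> \<gamma> f = I +>\<^bsub>E\<^esub> \<gamma> g \<longleftrightarrow> f - g \<in> {f. \<gamma> f \<in> I}"
      using ideal_cosets [OF E.is_cring I h(2) h(2)] by simp
  qed
qed

lemma surj_hom_id: "surj_hom (\<lambda>f. f) (type_ring :: 'a::comm_ring_1 ring) {0}"
  by (simp add: surj_hom_def cring_type_ring ring_hom_def)

lemma surj_hom_type_quot:
  "tideal J \<Longrightarrow> surj_hom (\<lambda>f. J +>\<^bsub>type_ring\<^esub> f) (type_ring Quot J) (J :: 'a::comm_ring_1 set)"
  using surj_hom_quot [OF surj_hom_id] by (simp add: ideal_type_ring_iff)

text \<open>If every class has a representative in the image of \<open>h\<close>, the smaller ring
  presents the same quotient. This replaces k[[x,y]][[t]] by k[[x,y]] as a source for O_X.\<close>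

lemma surj_hom_comp:
  assumes \<gamma>: "surj_hom \<gamma> E J" and h: "rhom h" and s: "\<And>b. \<exists>a. b - h a \<in> J"
  shows "surj_hom (\<lambda>a. \<gamma> (h a)) E {a. h a \<in> J}"
proof -
  note g = surj_homD [OF \<gamma>]
  show ?thesis unfolding surj_hom_def
  proof (intro conjI allI)
    show "(\<lambda>a. \<gamma> (h a)) \<in> ring_hom type_ring E"
      by (rule ring_hom_memI) (simp_all add: g(2-5) rhomD [OF h])
    have "\<gamma> b \<in> range (\<lambda>a. \<gamma> (h a))" for b
      using s [of b] g(9) by blast
    then show "range (\<lambda>a. \<gamma> (h a)) = carrier E" by (auto simp: g(8))
  qed (simp_all add: g(1) g(9) rhomD [OF h])
qed

lemma surj_hom_ideal_image:
  assumes \<gamma>: "surj_hom \<gamma> E K" and J: "tideal J" "K \<subseteq> J"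
  shows "ideal (\<gamma> ` J) E" "\<gamma> f \<in> \<gamma> ` J \<longleftrightarrow> f \<in> J"
proof -
  interpret E: cring E using surj_homD(1) [OF \<gamma>] .
  note h = surj_homD [OF \<gamma>]
  show "ideal (\<gamma> ` J) E"
  proof (rule idealI)
    show "ring E" by (rule E.ring_axioms)
    show "subgroup (\<gamma> ` J) (add_monoid E)"
    proof (rule group.subgroupI)
      show "Group.group (add_monoid E)" by (rule E.a_group)
      show "\<gamma> ` J \<subseteq> carrier (add_monoid E)" by (auto simp: h(2))
      show "\<gamma> ` J \<noteq> {}" using tideal_0 [OF J(1)] by auto
      fix a assume "a \<in> \<gamma> ` J"
      then obtain f where "f \<in> J" "a = \<gamma> f" by auto
      moreover from this have "- f \<in> J" using tideal_mult [OF J(1), of f "- 1"] by simp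
      ultimately show "inv\<^bsub>add_monoid E\<^esub> a \<in> \<gamma> ` J" by (auto simp: h(7) [symmetric] inv_add_monoid)
      fix b assume "b \<in> \<gamma> ` J"
      then show "a \<otimes>\<^bsub>add_monoid E\<^esub> b \<in> \<gamma> ` J"
        using \<open>a \<in> \<gamma> ` J\<close> tideal_add [OF J(1)] by (auto simp flip: h(3))
    qed
  qed (use tideal_mult [OF J(1)] tideal_mult_right [OF J(1)] in \<open>auto simp: h(8) simp flip: h(4)\<close>)
  show "\<gamma> f \<in> \<gamma> ` J \<longleftrightarrow> f \<in> J"
  proof
    assume "\<gamma> f \<in> \<gamma> ` J"
    then obtain g where "g \<in> J" "f - g \<in> J" using h(9) J(2) by blast
    then show "f \<in> J" using tideal_add [OF J(1), of "f - g" g] by simp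
  qed simp
qed

lemma surj_hom_ideal_preimage:
  assumes \<gamma>: "surj_hom \<gamma> E K" and I: "ideal I E"
  shows "tideal {f. \<gamma> f \<in> I}"
proof -
  interpret I: ideal I E by fact
  note h = surj_homD [OF \<gamma>]
  show ?thesis unfolding tideal_def
    using h(2) by (auto simp: h(3,4,6) I.I_l_closed)
qed

section \<open>Bases and minors in quotient rings\<close>

lemma alg_module_finsum: "finsum (alg_module h E) f A = finsum E f A"
  by (simp add: finsum_def finprod_def alg_module_def)

lemma free_basis_cong:
  assumes "abelian_monoid M" "\<And>i a. i < n \<Longrightarrow> a \<in> carrier R \<Longrightarrow> a \<odot>\<^bsub>M\<^esub> e i \<in> carrier M"
    and "\<And>i. i < n \<Longrightarrow> e i = e' i"
  shows "free_basis R M n e \<longleftrightarrow> free_basis R M n e'"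
proof -
  interpret abelian_monoid M by fact
  have "(\<Oplus>\<^bsub>M\<^esub>i\<in>{..<n}. c i \<odot>\<^bsub>M\<^esub> e i) = (\<Oplus>\<^bsub>M\<^esub>i\<in>{..<n}. c i \<odot>\<^bsub>M\<^esub> e' i)" if "c \<in> {..<n} \<rightarrow>\<^sub>E carrier R" for c
    using that assms(2,3) by (intro finsum_cong') (auto simp: Pi_def PiE_def)
  then have "(c \<in> {..<n} \<rightarrow>\<^sub>E carrier R \<and> x = (\<Oplus>\<^bsub>M\<^esub>i\<in>{..<n}. c i \<odot>\<^bsub>M\<^esub> e i)) \<longleftrightarrow>
      (c \<in> {..<n} \<rightarrow>\<^sub>E carrier R \<and> x = (\<Oplus>\<^bsub>M\<^esub>i\<in>{..<n}. c i \<odot>\<^bsub>M\<^esub> e' i))" for c x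
    by auto
  moreover have "(\<forall>i<n. e i \<in> carrier M) \<longleftrightarrow> (\<forall>i<n. e' i \<in> carrier M)" using assms(3) by simp
  ultimately show ?thesis unfolding free_basis_def by simp
qed

lemma alg_module_free_basis:
  assumes \<gamma>: "surj_hom \<gamma> E J" and h: "\<And>a. h a = \<gamma> (\<kappa> a)"
  shows "free_basis type_ring (alg_module h E) n (\<lambda>i. \<gamma> (b i)) \<longleftrightarrow>
    (\<forall>f. \<exists>!c. c \<in> {..<n} \<rightarrow>\<^sub>E UNIV \<and> f - (\<Sum>i<n. \<kappa> (c i) * b i) \<in> J)"
proof -
  note g = surj_homD [OF \<gamma>]
  have s: "(\<Oplus>\<^bsub>alg_module h E\<^esub>i\<in>{..<n}. c i \<odot>\<^bsub>alg_module h E\<^esub> \<gamma> (b i)) = \<gamma> (\<Sum>i<n. \<kappa> (c i) * b i)" for c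
    by (simp add: alg_module_finsum surj_hom_finsum [OF \<gamma>] g(4)) (simp add: alg_module_def h)
  have c: "carrier (alg_module h E) = range \<gamma>" by (simp add: alg_module_def g(8))
  show ?thesis unfolding free_basis_def s c by (simp add: g(9) rangeI)
qed

lemma alg_module_free_basis_lift:
  assumes \<gamma>: "surj_hom \<gamma> E J" and h: "\<And>a. h a = \<gamma> (\<kappa> a)"
    and e: "free_basis type_ring (alg_module h E) n e"
  shows "\<exists>b. (\<forall>i<n. e i = \<gamma> (b i)) \<and>
    (\<forall>f. \<exists>!c. c \<in> {..<n} \<rightarrow>\<^sub>E UNIV \<and> f - (\<Sum>i<n. \<kappa> (c i) * b i) \<in> J)"
proof -
  interpret E: cring E using surj_homD(1) [OF \<gamma>] .
  note g = surj_homD [OF \<gamma>]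
  have "\<forall>i<n. \<exists>b. e i = \<gamma> b" using e g(8) by (auto simp: free_basis_def alg_module_def)
  then obtain b where b: "\<forall>i<n. e i = \<gamma> (b i)" by metis
  have "abelian_monoid (alg_module h E)"
    by (rule abelian_monoidI) (simp_all add: alg_module_def E.a_ac)
  then have "free_basis type_ring (alg_module h E) n e \<longleftrightarrow> free_basis type_ring (alg_module h E) n (\<lambda>i. \<gamma> (b i))"
    by (rule free_basis_cong) (use b e in \<open>auto simp: alg_module_def h g(2) free_basis_def\<close>)
  then show ?thesis using e b alg_module_free_basis [of \<gamma> E J h \<kappa> n b, OF \<gamma> h] by blast
qed

lemma vdim_alg_module:
  fixes h :: "'k::field \<Rightarrow> 'c"
  assumes \<gamma>: "surj_hom \<gamma> E J" and h: "\<And>a. h a = \<gamma> (const2 a)"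
  shows "vdim type_ring (alg_module h E) = Inf {enat n |n. \<exists>b. quot_basis J n b}"
proof -
  have "(\<exists>e. free_basis type_ring (alg_module h E) n e) \<longleftrightarrow> (\<exists>b. quot_basis J n b)" for n
  proof
    assume "\<exists>e. free_basis type_ring (alg_module h E) n e"
    then obtain e where "free_basis type_ring (alg_module h E) n e" ..
    from alg_module_free_basis_lift [of \<gamma> E J h const2, OF \<gamma> h this]
    show "\<exists>b. quot_basis J n b" unfolding quot_basis_def by auto
  next
    assume "\<exists>b. quot_basis J n b"
    then obtain b where "quot_basis J n b" ..
    then have "free_basis type_ring (alg_module h E) n (\<lambda>i. \<gamma> (b i))"
      unfolding quot_basis_def alg_module_free_basis [of \<gamma> E J h const2, OF \<gamma> h] .
    then show "\<exists>e. free_basis type_ring (alg_module h E) n e" by (intro exI [of _ "\<lambda>i. \<gamma> (b i)"])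
  qed
  then show ?thesis by (simp add: vdim_def)
qed

lemma maximal_minors_in:
  assumes \<gamma>: "surj_hom \<gamma> E J" and A: "\<And>i j. i < m \<Longrightarrow> j < n \<Longrightarrow> A i j = \<gamma> (B i j)"
  shows "maximal_minors E m n A =
    {\<gamma> (tdet (min m n) (\<lambda>i j. B (\<rho> i) (\<sigma> j))) |\<rho> \<sigma>.
      strict_mono_on {..<min m n} \<rho> \<and> \<rho> ` {..<min m n} \<subseteq> {..<m} \<and>
      strict_mono_on {..<min m n} \<sigma> \<and> \<sigma> ` {..<min m n} \<subseteq> {..<n}}"
proof -
  interpret E: cring E using surj_homD(1) [OF \<gamma>] .
  have "ring_det E (min m n) (\<lambda>i j. A (\<rho> i) (\<sigma> j)) = \<gamma> (tdet (min m n) (\<lambda>i j. B (\<rho> i) (\<sigma> j)))"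
    if "\<rho> ` {..<min m n} \<subseteq> {..<m}" "\<sigma> ` {..<min m n} \<subseteq> {..<n}" for \<rho> \<sigma>
  proof -
    let ?r = "min m n"
    have *: "A (\<rho> i) (\<sigma> j) = \<gamma> (B (\<rho> i) (\<sigma> j))" if "i < ?r" "j < ?r" for i j
      using that \<open>\<rho> ` _ \<subseteq> _\<close> \<open>\<sigma> ` _ \<subseteq> _\<close> by (intro A) (simp_all add: image_subset_iff)
    have "(\<Otimes>\<^bsub>E\<^esub>i\<in>{..<?r}. A (\<rho> i) (\<sigma> (p i))) = (\<Otimes>\<^bsub>E\<^esub>i\<in>{..<?r}. \<gamma> (B (\<rho> i) (\<sigma> (p i))))"
      if "p permutes {..<?r}" for p
      using permutes_in_image [OF that] by (intro E.finprod_cong') (auto simp: * surj_homD(2) [OF \<gamma>])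
    then have "ring_det E ?r (\<lambda>i j. A (\<rho> i) (\<sigma> j)) = ring_det E ?r (\<lambda>i j. \<gamma> (B (\<rho> i) (\<sigma> j)))"
      unfolding ring_det_def Let_def
      by (intro E.finsum_cong') (auto intro!: E.finprod_closed simp: surj_homD(2) [OF \<gamma>])
    then show ?thesis by (simp only: surj_hom_det [OF \<gamma>])
  qed
  then show ?thesis unfolding maximal_minors_def by (intro Collect_cong) metis
qed

lemma strict_mono_on_full:
  fixes \<rho> :: "nat \<Rightarrow> nat"
  assumes "strict_mono_on {..<r} \<rho>" "\<rho> ` {..<r} \<subseteq> {..<r}" "i < r"
  shows "\<rho> i = i"
proof -
  have ge: "j \<le> \<rho> j" if "j < r" for j
    using that
  proof (induction j)
    case (Suc j)
    then have "\<rho> j < \<rho> (Suc j)" using assms(1) by (auto simp: strict_mono_on_def)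
    then show ?case using Suc by simp
  qed simp
  have "\<rho> (r - 1 - j) \<le> r - 1 - j" if "j < r" for j
    using that
  proof (induction j)
    case 0
    then have "\<rho> (r - 1) < r" using assms(2) by (simp add: image_subset_iff)
    then show ?case by simp
  next
    case (Suc j)
    then have "\<rho> (r - 1 - Suc j) < \<rho> (r - 1 - j)" using assms(1) by (auto simp: strict_mono_on_def)
    then show ?case using Suc by simp
  qed
  from this [of "r - 1 - i"] have "\<rho> i \<le> i" using assms(3) by simp
  then show ?thesis using ge [OF assms(3)] by simp
qed

section \<open>Principal parts and their dual\<close>

lemma surj_hom_OX: "surj_hom (OX_class F) (OX F) {s. F dvd s}"
  unfolding OX_def OX_class_def [abs_def] PIdl_type_ring
  by (rule surj_hom_type_quot [OF tideal_dvd])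

lemma surj_hom_OXX: "surj_hom (OXX_class F) (OXX F) (OXX_ideal F)"
  unfolding OXX_def OXX_class_def [abs_def] OXX_ideal_def
  by (rule surj_hom_type_quot [OF genideal_type_ring(1)])

lemma ideal_diagonal: "ideal (diagonal_ideal F) (OXX F)"
proof -
  interpret cring "OXX F" by (rule surj_homD(1) [OF surj_hom_OXX])
  show ?thesis unfolding diagonal_ideal_def
    by (rule genideal_ideal) (auto simp: surj_homD(2) [OF surj_hom_OXX])
qed

lemma diagonal_gen: "OXX_class F (left_factor g - right_factor g) \<in> diagonal_ideal F"
proof -
  interpret cring "OXX F" by (rule surj_homD(1) [OF surj_hom_OXX])
  have "range (\<lambda>g. OXX_class F (left_factor g - right_factor g)) \<subseteq> diagonal_ideal F"
    unfolding diagonal_ideal_def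
    by (rule genideal_self) (auto simp: surj_homD(2) [OF surj_hom_OXX])
  then show ?thesis by blast
qed

lemma ideal_ideal_power: "cring R \<Longrightarrow> ideal I R \<Longrightarrow> ideal (ideal_power R I n) R"
  by (induction n) (auto simp: ring.oneideal ring.ideal_prod_is_ideal cring.axioms(1))

text \<open>The m-th power of the diagonal ideal together with the two equations, pulled back to
  power series: the kernel of the presentation of the principal parts.\<close>

definition KN :: "nat \<Rightarrow> 'k::field fps fps fps \<Rightarrow> 'k fps fps fps fps fps set"
  where "KN m F = {w. OXX_class F w \<in> ideal_power (OXX F) (diagonal_ideal F) m}"

lemma ideal_diagonal_power: "ideal (ideal_power (OXX F) (diagonal_ideal F) m) (OXX F)"
  by (rule ideal_ideal_power [OF surj_homD(1) [OF surj_hom_OXX] ideal_diagonal])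

lemma surj_hom_PP: "surj_hom (PP_class m F) (PP_ring m F) (KN m F)"
  unfolding PP_ring_def PP_class_def [abs_def] KN_def
  by (rule surj_hom_quot [OF surj_hom_OXX ideal_diagonal_power])

lemma tideal_KN: "tideal (KN m F)"
  unfolding KN_def by (rule surj_hom_ideal_preimage [OF surj_hom_OXX ideal_diagonal_power])

lemma OXX_ideal_KN: "w \<in> OXX_ideal F \<Longrightarrow> w \<in> KN m F"
proof -
  assume w: "w \<in> OXX_ideal F"
  interpret ideal "ideal_power (OXX F) (diagonal_ideal F) m" "OXX F" by (rule ideal_diagonal_power)
  have "OXX_class F w = \<zero>\<^bsub>OXX F\<^esub>" using w by (simp add: surj_homD(10) [OF surj_hom_OXX])
  then show ?thesis unfolding KN_def using additive_subgroup.zero_closed [OF is_additive_subgroup] by simp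
qed

lemma factors_in_OXX_ideal: "left_factor F \<in> OXX_ideal F" "right_factor F \<in> OXX_ideal F"
  using genideal_type_ring(2) [of "{left_factor F, right_factor F}"] by (auto simp: OXX_ideal_def)

lemma factors_in_KN: "left_factor F \<in> KN m F" "right_factor F \<in> KN m F"
  by (simp_all add: OXX_ideal_KN factors_in_OXX_ideal)

lemma diff_power_KN: "(left_factor g - right_factor g) ^ m \<in> KN m F"
proof (induction m)
  case 0
  show ?case by (simp add: KN_def surj_homD(2) [OF surj_hom_OXX])
next
  case (Suc m)
  have "OXX_class F ((left_factor g - right_factor g) ^ m * (left_factor g - right_factor g))
      \<in> ideal_prod (OXX F) (ideal_power (OXX F) (diagonal_ideal F) m) (diagonal_ideal F)"
    using Suc diagonal_gen unfolding surj_homD(4) [OF surj_hom_OXX] KN_def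
    by (intro ideal_prod.prod) auto
  then show ?case by (simp add: KN_def mult.commute)
qed

lemma (in rel_derivation) tideal_Z: "tideal (Z n)"
  unfolding tideal_def by (auto intro: Z_add Z_mult Z_mult [of _ n 0, simplified])
    (use Z_mult [OF Z_F(1), of 0] in simp)

text \<open>Generators of the diagonal ideal lie in \<open>Z 1\<close>, and a product with an
  element of \<open>Z 1\<close> raises the level by one. As \<open>Z n\<close> contains the
  equations, membership of a class passes back to its representatives.\<close>

lemma (in rel_derivation) KN_Z: "KN n F \<subseteq> Z n"
proof -
  have sub: "OXX_ideal F \<subseteq> Z n" for n
    unfolding OXX_ideal_def by (rule genideal_type_ring(3) [OF tideal_Z]) (auto simp: Z_F simp del: Z.simps)
  note im = surj_hom_ideal_image [OF surj_hom_OXX tideal_Z sub]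
  interpret cring "OXX F" by (rule surj_homD(1) [OF surj_hom_OXX])
  have d: "diagonal_ideal F \<subseteq> OXX_class F ` Z 1"
    unfolding diagonal_ideal_def
  proof (rule genideal_minimal [OF im(1)])
    show "range (\<lambda>g. OXX_class F (left_factor g - right_factor g)) \<subseteq> OXX_class F ` Z 1"
      using diff_in_Z_1 by blast
  qed
  have "ideal_power (OXX F) (diagonal_ideal F) n \<subseteq> OXX_class F ` Z n"
  proof (induction n)
    case 0
    then show ?case using surj_homD(8) [OF surj_hom_OXX, of F] by simp
  next
    case (Suc n)
    show ?case
    proof
      fix s assume "s \<in> ideal_power (OXX F) (diagonal_ideal F) (Suc n)"
      then have "s \<in> ideal_prod (OXX F) (ideal_power (OXX F) (diagonal_ideal F) n) (diagonal_ideal F)" by simp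
      then show "s \<in> OXX_class F ` Z (Suc n)"
      proof (induction rule: ideal_prod.induct)
        case (prod i j)
        then obtain v w where "v \<in> Z n" "w \<in> Z 1" "i = OXX_class F v" "j = OXX_class F w"
          using Suc d by blast
        then show ?case
          using Z_mult_1 by (auto simp flip: surj_homD(4) [OF surj_hom_OXX] simp del: Z.simps)
      next
        case (sum s1 s2)
        then show ?case
          using Z_add by (auto simp flip: surj_homD(3) [OF surj_hom_OXX] simp del: Z.simps)
      qed
    qed
  qed
  then have "OXX_class F w \<in> OXX_class F ` Z n" if "w \<in> KN n F" for w using that by (auto simp: KN_def)
  then show ?thesis using im(2) by blast
qed

lemma carrier_PP: "carrier (PP m F) = range (PP_class m F)"
  by (simp add: PP_def alg_module_def surj_homD(8) [OF surj_hom_PP])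

lemma add_PP: "PP_class m F v \<oplus>\<^bsub>PP m F\<^esub> PP_class m F w = PP_class m F (v + w)"
  by (simp add: PP_def alg_module_def surj_homD(3) [OF surj_hom_PP])

text \<open>Scalar multiplication is defined through the image of a whole coset. That image is a
  singleton because the left copy of the equation vanishes in the principal parts.\<close>

lemma smult_PP: "OX_class F s \<odot>\<^bsub>PP m F\<^esub> PP_class m F w = PP_class m F (left_factor s * w)"
proof -
  have "PP_class m F (left_factor r) = PP_class m F (left_factor s)" if r: "r \<in> OX_class F s" for r
  proof -
    obtain q where "r = F * q + s"
      using r by (auto simp: OX_class_def a_r_coset_def' PIdl_type_ring dvd_def)
    then have "left_factor r - left_factor s = left_factor F * left_factor q"
      by (simp add: rhomD [OF rhom_left_factor])
    then show ?thesis
      by (simp add: surj_homD(9) [OF surj_hom_PP] tideal_mult_right [OF tideal_KN factors_in_KN(1)])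
  qed
  moreover have "s \<in> OX_class F s"
    by (force simp: OX_class_def a_r_coset_def' PIdl_type_ring)
  ultimately have "(\<lambda>r. PP_class m F (left_factor r)) ` OX_class F s = {PP_class m F (left_factor s)}"
    by blast
  then show ?thesis
    by (simp add: PP_def alg_module_def surj_homD(4) [OF surj_hom_PP])
qed

lemma dual_carrier_iff:
  "\<phi> \<in> carrier (dual_module (OX F) (PP m F)) \<longleftrightarrow>
    \<phi> \<in> carrier (PP m F) \<rightarrow>\<^sub>E carrier (OX F) \<and>
    (\<forall>v w. \<phi> (PP_class m F (v + w)) = \<phi> (PP_class m F v) \<oplus>\<^bsub>OX F\<^esub> \<phi> (PP_class m F w)) \<and>
    (\<forall>s w. \<phi> (PP_class m F (left_factor s * w)) = OX_class F s \<otimes>\<^bsub>OX F\<^esub> \<phi> (PP_class m F w))"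
  unfolding dual_module_def carrier_PP surj_homD(8) [OF surj_hom_OX]
  by (simp add: add_PP smult_PP)

section \<open>Duals of modules given as records\<close>

lemma dual_memI:
  assumes "\<And>x. x \<in> carrier M \<Longrightarrow> f x \<in> carrier R"
    "\<And>x y. x \<in> carrier M \<Longrightarrow> y \<in> carrier M \<Longrightarrow> x \<oplus>\<^bsub>M\<^esub> y \<in> carrier M"
    "\<And>a x. a \<in> carrier R \<Longrightarrow> x \<in> carrier M \<Longrightarrow> a \<odot>\<^bsub>M\<^esub> x \<in> carrier M"
    "\<And>x y. x \<in> carrier M \<Longrightarrow> y \<in> carrier M \<Longrightarrow> f (x \<oplus>\<^bsub>M\<^esub> y) = f x \<oplus>\<^bsub>R\<^esub> f y"
    "\<And>a x. a \<in> carrier R \<Longrightarrow> x \<in> carrier M \<Longrightarrow> f (a \<odot>\<^bsub>M\<^esub> x) = a \<otimes>\<^bsub>R\<^esub> f x"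
  shows "restrict f (carrier M) \<in> carrier (dual_module R M)"
  using assms by (simp add: dual_module_def restrict_PiE_iff)

lemma dual_memD:
  assumes "\<phi> \<in> carrier (dual_module R M)"
  shows "x \<in> carrier M \<Longrightarrow> \<phi> x \<in> carrier R"
    "x \<in> carrier M \<Longrightarrow> y \<in> carrier M \<Longrightarrow> \<phi> (x \<oplus>\<^bsub>M\<^esub> y) = \<phi> x \<oplus>\<^bsub>R\<^esub> \<phi> y"
    "a \<in> carrier R \<Longrightarrow> x \<in> carrier M \<Longrightarrow> \<phi> (a \<odot>\<^bsub>M\<^esub> x) = a \<otimes>\<^bsub>R\<^esub> \<phi> x"
    "\<phi> = restrict \<phi> (carrier M)"
  using assms by (auto simp: dual_module_def extensional_restrict PiE_iff)

lemma dual_ops: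
  "\<phi> \<oplus>\<^bsub>dual_module R M\<^esub> \<psi> = restrict (\<lambda>x. \<phi> x \<oplus>\<^bsub>R\<^esub> \<psi> x) (carrier M)"
  "\<zero>\<^bsub>dual_module R M\<^esub> = restrict (\<lambda>x. \<zero>\<^bsub>R\<^esub>) (carrier M)"
  "a \<odot>\<^bsub>dual_module R M\<^esub> \<phi> = restrict (\<lambda>x. a \<otimes>\<^bsub>R\<^esub> \<phi> x) (carrier M)"
  by (simp_all add: dual_module_def)

lemma dual_abelian_monoid:
  assumes "cring R" and M: "\<And>x y. x \<in> carrier M \<Longrightarrow> y \<in> carrier M \<Longrightarrow> x \<oplus>\<^bsub>M\<^esub> y \<in> carrier M"
    "\<And>a x. a \<in> carrier R \<Longrightarrow> x \<in> carrier M \<Longrightarrow> a \<odot>\<^bsub>M\<^esub> x \<in> carrier M"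
  shows "abelian_monoid (dual_module R M)"
proof -
  interpret R: cring R by fact
  show ?thesis
  proof (rule abelian_monoidI)
    fix \<phi> \<psi> assume *: "\<phi> \<in> carrier (dual_module R M)" "\<psi> \<in> carrier (dual_module R M)"
    note d = dual_memD(1-3) [OF *(1)] dual_memD(1-3) [OF *(2)]
    show "\<phi> \<oplus>\<^bsub>dual_module R M\<^esub> \<psi> \<in> carrier (dual_module R M)"
      unfolding dual_ops by (rule dual_memI) (simp_all add: d M R.r_distr R.a_ac)
    show "\<phi> \<oplus>\<^bsub>dual_module R M\<^esub> \<psi> = \<psi> \<oplus>\<^bsub>dual_module R M\<^esub> \<phi>"
      unfolding dual_ops by (rule restrict_ext) (simp add: d R.a_comm)
    show "\<zero>\<^bsub>dual_module R M\<^esub> \<oplus>\<^bsub>dual_module R M\<^esub> \<phi> = \<phi>"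
      unfolding dual_ops by (subst (2) dual_memD(4) [OF *(1)], rule restrict_ext) (simp add: d)
    fix \<chi> assume \<chi>: "\<chi> \<in> carrier (dual_module R M)"
    show "\<phi> \<oplus>\<^bsub>dual_module R M\<^esub> \<psi> \<oplus>\<^bsub>dual_module R M\<^esub> \<chi> = \<phi> \<oplus>\<^bsub>dual_module R M\<^esub> (\<psi> \<oplus>\<^bsub>dual_module R M\<^esub> \<chi>)"
      unfolding dual_ops by (rule restrict_ext) (simp add: d dual_memD(1) [OF \<chi>] R.a_assoc)
  next
    show "\<zero>\<^bsub>dual_module R M\<^esub> \<in> carrier (dual_module R M)"
      unfolding dual_ops by (rule dual_memI) (simp_all add: M)
  qed
qed

lemma dual_finsum_apply:
  assumes "cring R" "abelian_monoid (dual_module R M)" "finite A"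
    "f \<in> A \<rightarrow> carrier (dual_module R M)" "x \<in> carrier M"
  shows "(\<Oplus>\<^bsub>dual_module R M\<^esub>i\<in>A. f i) x = (\<Oplus>\<^bsub>R\<^esub>i\<in>A. f i x)"
  using assms(3,4)
proof (induction A rule: finite_induct)
  interpret R: cring R by fact
  interpret D: abelian_monoid "dual_module R M" by fact
  { case empty
    then show ?case using assms(5) by (simp add: dual_ops) }
  { case (insert i A)
    have v: "g x \<in> carrier R" if "g \<in> carrier (dual_module R M)" for g
      using that assms(5) by (auto simp: dual_module_def)
    have f: "f i \<in> carrier (dual_module R M)" "f \<in> A \<rightarrow> carrier (dual_module R M)" using insert by auto
    have "(\<Oplus>\<^bsub>dual_module R M\<^esub>i\<in>insert i A. f i) x = (f i \<oplus>\<^bsub>dual_module R M\<^esub> (\<Oplus>\<^bsub>dual_module R M\<^esub>i\<in>A. f i)) x"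
      using insert f by simp
    also have "\<dots> = f i x \<oplus>\<^bsub>R\<^esub> (\<Oplus>\<^bsub>dual_module R M\<^esub>i\<in>A. f i) x"
      using assms(5) by (simp add: dual_ops)
    also have "\<dots> = (\<Oplus>\<^bsub>R\<^esub>i\<in>insert i A. f i x)"
      using insert f v by (simp add: Pi_def)
    finally show ?case . }
qed

lemma dual_smult_closed:
  assumes "cring R" "\<And>x y. x \<in> carrier M \<Longrightarrow> y \<in> carrier M \<Longrightarrow> x \<oplus>\<^bsub>M\<^esub> y \<in> carrier M"
    "\<And>a x. a \<in> carrier R \<Longrightarrow> x \<in> carrier M \<Longrightarrow> a \<odot>\<^bsub>M\<^esub> x \<in> carrier M"
    and "c \<in> carrier R" "\<phi> \<in> carrier (dual_module R M)"
  shows "c \<odot>\<^bsub>dual_module R M\<^esub> \<phi> \<in> carrier (dual_module R M)"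
proof -
  interpret R: cring R by fact
  note d = dual_memD(1-3) [OF assms(5)]
  show ?thesis unfolding dual_ops
    by (rule dual_memI) (simp_all add: d assms(2-4) R.r_distr R.m_lcomm)
qed

lemma PP_closed:
  "x \<in> carrier (PP m F) \<Longrightarrow> y \<in> carrier (PP m F) \<Longrightarrow> x \<oplus>\<^bsub>PP m F\<^esub> y \<in> carrier (PP m F)"
  "a \<in> carrier (OX F) \<Longrightarrow> x \<in> carrier (PP m F) \<Longrightarrow> a \<odot>\<^bsub>PP m F\<^esub> x \<in> carrier (PP m F)"
  by (auto simp: carrier_PP surj_homD(8) [OF surj_hom_OX] add_PP smult_PP)

lemmas dual_PP_monoid = dual_abelian_monoid [OF surj_homD(1) [OF surj_hom_OX] PP_closed]
lemmas dual_PP_smult = dual_smult_closed [OF surj_homD(1) [OF surj_hom_OX] PP_closed]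

lemma dual_combination_apply:
  fixes n :: nat
  assumes "\<And>i. i < n \<Longrightarrow> c i \<in> carrier (OX F)" "\<And>i. i < n \<Longrightarrow> e i \<in> carrier (dual_module (OX F) (PP m F))"
  shows "(\<Oplus>\<^bsub>dual_module (OX F) (PP m F)\<^esub>i\<in>{..<n}. c i \<odot>\<^bsub>dual_module (OX F) (PP m F)\<^esub> e i) (PP_class m F w)
    = (\<Oplus>\<^bsub>OX F\<^esub>i\<in>{..<n}. c i \<otimes>\<^bsub>OX F\<^esub> e i (PP_class m F w))"
proof -
  interpret R: cring "OX F" by (rule surj_homD(1) [OF surj_hom_OX])
  have w: "PP_class m F w \<in> carrier (PP m F)" by (simp add: carrier_PP)
  have "(\<Oplus>\<^bsub>dual_module (OX F) (PP m F)\<^esub>i\<in>{..<n}. c i \<odot>\<^bsub>dual_module (OX F) (PP m F)\<^esub> e i) (PP_class m F w)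
      = (\<Oplus>\<^bsub>OX F\<^esub>i\<in>{..<n}. (c i \<odot>\<^bsub>dual_module (OX F) (PP m F)\<^esub> e i) (PP_class m F w))"
    using assms by (intro dual_finsum_apply R.is_cring dual_PP_monoid w) (auto intro!: dual_PP_smult)
  also have "\<dots> = (\<Oplus>\<^bsub>OX F\<^esub>i\<in>{..<n}. c i \<otimes>\<^bsub>OX F\<^esub> e i (PP_class m F w))"
    using w by (simp add: dual_module_def)
  finally show ?thesis .
qed

lemma dual_combination_closed:
  fixes n :: nat
  assumes "\<And>i. i < n \<Longrightarrow> c i \<in> carrier (OX F)" "\<And>i. i < n \<Longrightarrow> e i \<in> carrier (dual_module (OX F) (PP m F))"
  shows "(\<Oplus>\<^bsub>dual_module (OX F) (PP m F)\<^esub>i\<in>{..<n}. c i \<odot>\<^bsub>dual_module (OX F) (PP m F)\<^esub> e i)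
    \<in> carrier (dual_module (OX F) (PP m F))"
proof -
  interpret abelian_monoid "dual_module (OX F) (PP m F)" by (rule dual_PP_monoid)
  show ?thesis using assms by (intro finsum_closed) (auto intro!: dual_PP_smult)
qed

lemma dual_eqI:
  assumes "\<phi> \<in> carrier (dual_module (OX F) (PP m F))" "\<psi> \<in> carrier (dual_module (OX F) (PP m F))"
    "\<And>w. \<phi> (PP_class m F w) = \<psi> (PP_class m F w)"
  shows "\<phi> = \<psi>"
  using assms by (intro PiE_ext [of \<phi> "carrier (PP m F)" "\<lambda>_. carrier (OX F)" \<psi>])
    (auto simp: dual_carrier_iff carrier_PP)

text \<open>The form induced on classes by a map on power series. The chosen representative is
  immaterial if the map sends \<open>KN m F\<close> into the multiples of \<open>F\<close>.\<close>

definition dual_of :: "nat \<Rightarrow> 'k::field fps fps fps \<Rightarrow> ('k fps fps fps fps fps \<Rightarrow> 'k fps fps fps) \<Rightarrow>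
    'k fps fps fps fps fps set set \<Rightarrow> 'k fps fps fps set"
  where "dual_of m F G = (\<lambda>C\<in>carrier (PP m F). OX_class F (G (SOME w. PP_class m F w = C)))"

lemma dual_of:
  assumes add: "\<And>v w. G (v + w) = G v + G w" and left: "\<And>s w. G (left_factor s * w) = s * G w"
    and ker: "\<And>w. w \<in> KN m F \<Longrightarrow> F dvd G w"
  shows "dual_of m F G (PP_class m F w) = OX_class F (G w)"
    "dual_of m F G \<in> carrier (dual_module (OX F) (PP m F))"
proof -
  have v: "dual_of m F G (PP_class m F w) = OX_class F (G w)" for w
  proof -
    let ?v = "SOME v. PP_class m F v = PP_class m F w"
    have "PP_class m F ?v = PP_class m F w" by (rule someI) simp
    then have "?v - w \<in> KN m F" by (simp add: surj_homD(9) [OF surj_hom_PP])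
    moreover have "G ?v = G (?v - w) + G w" using add [of "?v - w" w] by simp
    ultimately have "F dvd G ?v - G w" using ker by simp
    then show ?thesis by (simp add: dual_of_def carrier_PP surj_homD(9) [OF surj_hom_OX])
  qed
  show "dual_of m F G (PP_class m F w) = OX_class F (G w)" by (rule v)
  show "dual_of m F G \<in> carrier (dual_module (OX F) (PP m F))"
    unfolding dual_carrier_iff v
    by (auto simp: add left surj_homD(3,4) [OF surj_hom_OX] carrier_PP)
       (auto simp: dual_of_def carrier_PP restrict_PiE_iff surj_homD(2) [OF surj_hom_OX])
qed

section \<open>The dual basis for the smoothing\<close>

context smoothing
begin

text \<open>The isomorphism from k[[x,y]] to O_X, inverse to the map that \<open>eps\<close>
  induces.\<close>

definition iot :: "'k fps fps \<Rightarrow> 'k fps fps fps set"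
  where "iot f = OX_class Feq (fps_const f)"

lemma OX_class_eq_iot: "OX_class Feq s = iot (eps s)"
  unfolding iot_def surj_homD(9) [OF surj_hom_OX] using Feq_dvd_diff_eps by simp

lemma surj_hom_iot: "surj_hom iot (OX Feq) {0}"
proof -
  have "surj_hom (\<lambda>f. OX_class Feq (fps_const f)) (OX Feq) {f. fps_const f \<in> {s. Feq dvd s}}"
    by (rule surj_hom_comp [OF surj_hom_OX rhom_fps_const]) (use Feq_dvd_diff_eps in blast)
  moreover have "{f. fps_const f \<in> {s. Feq dvd s}} = {0}" by (auto simp flip: eps_eq_0_iff)
  ultimately show ?thesis by (simp add: iot_def [abs_def])
qed

lemmas iot = surj_homD [OF surj_hom_iot]

lemma iot_inject: "iot f = iot g \<longleftrightarrow> f = g"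
  by (simp add: iot(9))

lemma dual_coords:
  assumes \<phi>: "\<phi> \<in> carrier (dual_module (OX Feq) (PP m Feq))"
  shows "\<exists>c. \<forall>\<tau>. \<phi> (PP_class m Feq \<tau>) = iot (\<Sum>i<m. c i * e (bpol m i) \<tau>)"
proof -
  interpret R: cring "OX Feq" by (rule iot(1))
  have \<phi>add: "\<phi> (PP_class m Feq (\<sigma> + \<tau>)) = \<phi> (PP_class m Feq \<sigma>) \<oplus>\<^bsub>OX Feq\<^esub> \<phi> (PP_class m Feq \<tau>)"
    and \<phi>left: "\<phi> (PP_class m Feq (left_factor s * \<tau>)) = OX_class Feq s \<otimes>\<^bsub>OX Feq\<^esub> \<phi> (PP_class m Feq \<tau>)"
    and carr: "\<phi> (PP_class m Feq \<tau>) \<in> range iot" for \<sigma> \<tau> s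
    using \<phi> unfolding dual_carrier_iff by (auto simp: carrier_PP PiE_mem simp flip: iot(8))
  from carr have "\<exists>f. \<phi> (PP_class m Feq \<tau>) = iot f" for \<tau> by blast
  then obtain \<Phi> where \<Phi>: "\<phi> (PP_class m Feq \<tau>) = iot (\<Phi> \<tau>)" for \<tau> by metis
  have add: "\<Phi> (\<sigma> + \<tau>) = \<Phi> \<sigma> + \<Phi> \<tau>" for \<sigma> \<tau>
    using \<phi>add [of \<sigma> \<tau>] by (simp add: \<Phi> iot_inject flip: iot(3))
  have left: "\<Phi> (left_factor s * \<tau>) = eps s * \<Phi> \<tau>" for s \<tau>
    using \<phi>left [of s \<tau>] by (simp add: \<Phi> OX_class_eq_iot iot_inject flip: iot(4))
  have zero: "\<Phi> 0 = 0" using add [of 0 0] by simp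
  have KN: "\<Phi> \<tau> = 0" if "\<tau> \<in> KN m Feq" for \<tau>
  proof -
    have "PP_class m Feq \<tau> = PP_class m Feq 0" using that by (simp add: surj_homD(9) [OF surj_hom_PP])
    then have "iot (\<Phi> \<tau>) = iot (\<Phi> 0)" by (simp flip: \<Phi>)
    then show ?thesis by (simp add: iot_inject zero)
  qed
  \<comment> \<open>The diagonal ideal is generated by differences left minus right, so
    \<open>zeta\<close> appears as the difference of the copies of -X.\<close>
  have "zeta = left_factor (fps_const (- gx)) - right_factor (fps_const (- gx))"
    by (simp only: rc_hom lc_hom zeta_def) simp
  then have "zeta ^ m \<in> KN m Feq" by (simp only: diff_power_KN)
  then have "linear_form m \<Phi>" unfolding linear_form_def
    by (auto simp: add left intro!: KN tideal_mult_right [OF tideal_KN] factors_in_KN)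
  from linear_form_span [OF this] show ?thesis by (auto simp: \<Phi> iot_inject)
qed

definition edual :: "nat \<Rightarrow> nat \<Rightarrow> 'k fps fps fps fps fps set set \<Rightarrow> 'k fps fps fps set"
  where "edual m i = dual_of m Feq (E (bpol m i))"

lemma edual:
  assumes "m \<ge> 1"
  shows "edual m i (PP_class m Feq \<tau>) = iot (e (bpol m i) \<tau>)"
    "edual m i \<in> carrier (dual_module (OX Feq) (PP m Feq))"
proof -
  have ker: "Feq dvd E (bpol m i) \<tau>" if "\<tau> \<in> KN m Feq" for \<tau>
    using that KN_Z by (intro E_Z [OF _ degree_bpol [OF assms]]) blast
  note d = dual_of [where G = "E (bpol m i)" and F = Feq and m = m, OF E_add E_left ker]
  show "edual m i (PP_class m Feq \<tau>) = iot (e (bpol m i) \<tau>)"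
    by (simp add: edual_def d OX_class_eq_iot e_def)
  show "edual m i \<in> carrier (dual_module (OX Feq) (PP m Feq))" unfolding edual_def by (rule d)
qed

lemma edual_basis:
  assumes m: "m \<ge> 1"
  shows "PP_dual_basis m Feq (edual m)"
  unfolding PP_dual_basis_def free_basis_def
proof (intro conjI allI impI ballI)
  fix i show "edual m i \<in> carrier (dual_module (OX Feq) (PP m Feq))" by (rule edual [OF m])
next
  let ?D = "dual_module (OX Feq) (PP m Feq)"
  fix \<phi> assume \<phi>: "\<phi> \<in> carrier ?D"
  obtain c where c: "\<And>\<tau>. \<phi> (PP_class m Feq \<tau>) = iot (\<Sum>i<m. c i * e (bpol m i) \<tau>)"
    using dual_coords [OF \<phi>] by blast
  have comb: "(\<Oplus>\<^bsub>?D\<^esub>i\<in>{..<m}. b i \<odot>\<^bsub>?D\<^esub> edual m i) (PP_class m Feq \<tau>) = iot (\<Sum>i<m. d i * e (bpol m i) \<tau>)"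
    if b: "\<And>i. i < m \<Longrightarrow> b i = iot (d i)" for b d \<tau>
  proof -
    interpret R: cring "OX Feq" by (rule iot(1))
    have "(\<Oplus>\<^bsub>?D\<^esub>i\<in>{..<m}. b i \<odot>\<^bsub>?D\<^esub> edual m i) (PP_class m Feq \<tau>)
        = (\<Oplus>\<^bsub>OX Feq\<^esub>i\<in>{..<m}. b i \<otimes>\<^bsub>OX Feq\<^esub> edual m i (PP_class m Feq \<tau>))"
      by (rule dual_combination_apply) (auto simp: b iot(2) edual [OF m])
    also have "\<dots> = (\<Oplus>\<^bsub>OX Feq\<^esub>i\<in>{..<m}. iot (d i * e (bpol m i) \<tau>))"
      by (rule R.finsum_cong') (auto simp: b iot(2) iot(4) edual [OF m])
    finally show ?thesis by (simp add: surj_hom_finsum [OF surj_hom_iot])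
  qed
  show "\<exists>!b. b \<in> {..<m} \<rightarrow>\<^sub>E carrier (OX Feq) \<and> \<phi> = (\<Oplus>\<^bsub>?D\<^esub>i\<in>{..<m}. b i \<odot>\<^bsub>?D\<^esub> edual m i)"
  proof (rule ex1I)
    let ?b = "\<lambda>i\<in>{..<m}. iot (c i)"
    have "?b \<in> {..<m} \<rightarrow>\<^sub>E carrier (OX Feq)" by (simp add: restrict_PiE_iff iot(2))
    moreover have "\<phi> = (\<Oplus>\<^bsub>?D\<^esub>i\<in>{..<m}. ?b i \<odot>\<^bsub>?D\<^esub> edual m i)"
    proof (rule dual_eqI [OF \<phi>])
      show "(\<Oplus>\<^bsub>?D\<^esub>i\<in>{..<m}. ?b i \<odot>\<^bsub>?D\<^esub> edual m i) \<in> carrier ?D"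
        by (rule dual_combination_closed) (auto simp: iot(2) edual [OF m])
      show "\<phi> (PP_class m Feq \<tau>) = (\<Oplus>\<^bsub>?D\<^esub>i\<in>{..<m}. ?b i \<odot>\<^bsub>?D\<^esub> edual m i) (PP_class m Feq \<tau>)" for \<tau>
        unfolding c by (rule comb [symmetric]) simp
    qed
    ultimately show "?b \<in> {..<m} \<rightarrow>\<^sub>E carrier (OX Feq) \<and> \<phi> = (\<Oplus>\<^bsub>?D\<^esub>i\<in>{..<m}. ?b i \<odot>\<^bsub>?D\<^esub> edual m i)" ..
    fix b assume b: "b \<in> {..<m} \<rightarrow>\<^sub>E carrier (OX Feq) \<and> \<phi> = (\<Oplus>\<^bsub>?D\<^esub>i\<in>{..<m}. b i \<odot>\<^bsub>?D\<^esub> edual m i)"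
    then have "b i \<in> range iot" if "i < m" for i using that iot(8) by (auto simp: PiE_iff)
    then have "\<forall>i<m. \<exists>d. b i = iot d" by blast
    then obtain d where d: "\<And>i. i < m \<Longrightarrow> b i = iot (d i)" by metis
    have "\<phi> (PP_class m Feq \<tau>) = iot (\<Sum>i<m. d i * e (bpol m i) \<tau>)" for \<tau>
      using b comb [of b d \<tau>] d by metis
    then have "(\<Sum>i<m. d i * e (bpol m i) \<tau>) = (\<Sum>i<m. c i * e (bpol m i) \<tau>)" for \<tau>
      using c by (simp add: iot_inject)
    from linear_form_unique [OF this] have "d i = c i" if "i < m" for i using that by blast
    then show "b = ?b" using b d by (intro PiE_ext [of b "{..<m}" "\<lambda>_. carrier (OX Feq)"])
      (auto simp: restrict_PiE_iff iot(2))
  qed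
qed

end

section \<open>Dimensions of the degeneracy loci of the smoothing\<close>

lemma surj_hom_genideal_subset:
  assumes \<gamma>: "surj_hom \<gamma> E K" and J: "tideal J" "K \<subseteq> J" and S: "S \<subseteq> \<gamma> ` J"
    and f: "\<gamma> f \<in> genideal E S"
  shows "f \<in> J"
proof -
  interpret cring E by (rule surj_homD(1) [OF \<gamma>])
  have "genideal E S \<subseteq> \<gamma> ` J"
    by (rule genideal_minimal [OF surj_hom_ideal_image(1) [OF \<gamma> J] S])
  then show ?thesis using f surj_hom_ideal_image(2) [OF \<gamma> J] by blast
qed

lemma tdet_cong:
  assumes "\<And>i j. i < r \<Longrightarrow> j < r \<Longrightarrow> A i j = B i j"
  shows "tdet r A = tdet r B"
  unfolding tdet_def
proof (rule sum.cong [OF refl], rule arg_cong2 [where f = "(*)", OF refl], rule prod.cong [OF refl])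
  fix p i assume "p \<in> {p. p permutes {..<r}}" "i \<in> {..<r}"
  then show "A i (p i) = B i (p i)"
    using permutes_in_image [of p "{..<r}" i] by (intro assms) auto
qed

definition colength :: "'k::field fps fps set \<Rightarrow> enat"
  where "colength J = Inf {enat n |n. \<exists>b. quot_basis J n b}"

lemma colength_ge: "(\<And>n b. quot_basis J n b \<Longrightarrow> N \<le> n) \<Longrightarrow> enat N \<le> colength J"
  unfolding colength_def by (rule Inf_greatest) auto

lemma colength_le: "quot_basis J n b \<Longrightarrow> colength J \<le> enat n"
  unfolding colength_def by (rule Inf_lower) auto

lemma colength_attained:
  assumes "colength J = enat n"
  shows "\<exists>b. quot_basis J n b"
proof -
  let ?S = "{enat n |n. \<exists>b. quot_basis J n b}"
  have "?S \<noteq> {}"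
  proof
    assume "?S = {}"
    then have "colength J = \<infinity>" by (simp only: colength_def) (simp add: top_enat_def)
    then show False using assms by simp
  qed
  then have "Inf ?S \<in> ?S" by (metis (no_types, lifting) Inf_enat_def LeastI_ex ex_in_conv)
  then show ?thesis using assms by (auto simp: colength_def)
qed

context smoothing
begin

lemma dim_k_quot_eq:
  assumes I: "ideal I (OX Feq)"
  shows "dim_k_quot Feq I = colength {f. iot f \<in> I}"
  unfolding dim_k_quot_def colength_def
  by (rule vdim_alg_module [OF surj_hom_quot [OF surj_hom_iot I]]) (simp add: iot_def)

text \<open>Any basis of the dual is a combination of the operators e_l, so the matrix of values
  factors through the one with rows in the corner ideals. This makes the lower bounds uniform in the
  basis and the list.\<close>

lemma values_matrix:
  assumes e: "PP_dual_basis m Feq e'" and \<tau>: "\<forall>j<n. \<tau> j \<in> carrier (PP m Feq)"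
  shows "\<exists>P T. \<forall>i<m. \<forall>j<n. e' i (\<tau> j) = iot (\<Sum>l<m. P i l * e (bpol m l) (T j))"
proof -
  have "\<forall>j<n. \<exists>t. \<tau> j = PP_class m Feq t" using \<tau> by (auto simp: carrier_PP)
  then obtain T where T: "\<And>j. j < n \<Longrightarrow> \<tau> j = PP_class m Feq (T j)" by metis
  have "\<forall>i<m. \<exists>c. \<forall>t. e' i (PP_class m Feq t) = iot (\<Sum>l<m. c l * e (bpol m l) t)"
    using e dual_coords unfolding PP_dual_basis_def free_basis_def by blast
  then obtain P where "\<And>i t. i < m \<Longrightarrow> e' i (PP_class m Feq t) = iot (\<Sum>l<m. P i l * e (bpol m l) t)" by metis
  then show ?thesis using T by metis
qed

lemma degeneracy_subset_stair:
  assumes e: "PP_dual_basis m Feq e'" and \<tau>: "\<forall>j<n. \<tau> j \<in> carrier (PP m Feq)"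
    and r: "min m n \<ge> 1"
  shows "{f. iot f \<in> degeneracy_ideal m n Feq e' \<tau>} \<subseteq> mon_ideal (stair (min m n))"
proof -
  obtain P T where PT: "\<And>i j. i < m \<Longrightarrow> j < n \<Longrightarrow> e' i (\<tau> j) = iot (\<Sum>l<m. P i l * e (bpol m l) (T j))"
    using values_matrix [OF e \<tau>] by blast
  have "tdet (min m n) (\<lambda>i j. \<Sum>l<m. P (\<rho> i) l * e (bpol m l) (T (\<sigma> j))) \<in> mon_ideal (stair (min m n))" for \<rho> \<sigma>
    by (rule minor_in_stair [OF r, where \<tau> = "\<lambda>j. T (\<sigma> j)" and P = "\<lambda>i. P (\<rho> i)"]) simp
  then have "maximal_minors (OX Feq) m n (\<lambda>i j. e' i (\<tau> j)) \<subseteq> iot ` mon_ideal (stair (min m n))"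
    by (subst maximal_minors_in [OF surj_hom_iot, where A = "\<lambda>i j. e' i (\<tau> j)" and B = "\<lambda>i j. \<Sum>l<m. P i l * e (bpol m l) (T j)"]) (auto simp: PT)
  then show ?thesis unfolding degeneracy_ideal_def
    using surj_hom_genideal_subset [OF surj_hom_iot tideal_mon_ideal [OF upset_stair]] by fastforce
qed

lemma ideal_degeneracy:
  assumes "PP_dual_basis m Feq e'" "\<forall>j<n. \<tau> j \<in> carrier (PP m Feq)"
  shows "ideal (degeneracy_ideal m n Feq e' \<tau>) (OX Feq)"
    "maximal_minors (OX Feq) m n (\<lambda>i j. e' i (\<tau> j)) \<subseteq> degeneracy_ideal m n Feq e' \<tau>"
proof -
  interpret cring "OX Feq" by (rule iot(1))
  obtain P T where PT: "\<And>i j. i < m \<Longrightarrow> j < n \<Longrightarrow> e' i (\<tau> j) = iot (\<Sum>l<m. P i l * e (bpol m l) (T j))"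
    using values_matrix [OF assms] by blast
  have "maximal_minors (OX Feq) m n (\<lambda>i j. e' i (\<tau> j)) \<subseteq> carrier (OX Feq)"
    by (subst maximal_minors_in [OF surj_hom_iot, where A = "\<lambda>i j. e' i (\<tau> j)" and B = "\<lambda>i j. \<Sum>l<m. P i l * e (bpol m l) (T j)"]) (auto simp: PT iot(2))
  then show "ideal (degeneracy_ideal m n Feq e' \<tau>) (OX Feq)"
    "maximal_minors (OX Feq) m n (\<lambda>i j. e' i (\<tau> j)) \<subseteq> degeneracy_ideal m n Feq e' \<tau>"
    unfolding degeneracy_ideal_def by (rule genideal_ideal, rule genideal_self)
qed

lemma degeneracy_dim_lower:
  assumes e: "PP_dual_basis m Feq e'" and \<tau>: "\<forall>j<n. \<tau> j \<in> carrier (PP m Feq)"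
    and r: "min m n \<ge> 1"
  shows "enat ((min m n + 2) choose 4) \<le> dim_k_quot Feq (degeneracy_ideal m n Feq e' \<tau>)"
  unfolding dim_k_quot_eq [OF ideal_degeneracy(1) [OF e \<tau>]]
  using mon_ideal_colength_lower [OF _ degeneracy_subset_stair [OF e \<tau> r] card_stair_complement(1) [OF r]]
  by (intro colength_ge) (simp add: card_stair_complement(2) [OF r])

text \<open>If every generator x^(tri p) y^(tri q), up to a unit, is a maximal minor, the degeneracy
  ideal is the whole monomial ideal of \<open>stair\<close> and its colength is the number of
  missing monomials.\<close>

lemma degeneracy_dim_upper:
  assumes m: "m \<ge> 1" and r: "min m n \<ge> 1"
    and minors: "\<And>p q. p + q + 1 = min m n \<Longrightarrow> \<exists>\<rho> \<sigma>. strict_mono_on {..<min m n} \<rho> \<and> \<rho> ` {..<min m n} \<subseteq> {..<m} \<and>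
      strict_mono_on {..<min m n} \<sigma> \<and> \<sigma> ` {..<min m n} \<subseteq> {..<n} \<and>
      tdet (min m n) (\<lambda>i j. e (bpol m (\<rho> i)) (T (\<sigma> j))) = gx ^ tri p * germ_y ^ tri q"
  shows "dim_k_quot Feq (degeneracy_ideal m n Feq (edual m) (\<lambda>j. PP_class m Feq (T j)))
    \<le> enat ((min m n + 2) choose 4)"
proof -
  let ?J = "degeneracy_ideal m n Feq (edual m) (\<lambda>j. PP_class m Feq (T j))"
  note e = edual_basis [OF m]
  have \<tau>: "\<forall>j<n. PP_class m Feq (T j) \<in> carrier (PP m Feq)" by (simp add: carrier_PP)
  have mm: "maximal_minors (OX Feq) m n (\<lambda>i j. edual m i (PP_class m Feq (T j))) \<subseteq> ?J"
    by (rule ideal_degeneracy [OF e \<tau>])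
  note eq = maximal_minors_in [OF surj_hom_iot, where A = "\<lambda>i j. edual m i (PP_class m Feq (T j))"
      and B = "\<lambda>i j. e (bpol m i) (T j)" and m = m and n = n, OF edual(1) [OF m]]
  have gen: "gx ^ tri p * germ_y ^ tri q \<in> {f. iot f \<in> ?J}" if pq: "p + q + 1 = min m n" for p q
  proof -
    obtain \<rho> \<sigma> where "strict_mono_on {..<min m n} \<rho> \<and> \<rho> ` {..<min m n} \<subseteq> {..<m} \<and>
      strict_mono_on {..<min m n} \<sigma> \<and> \<sigma> ` {..<min m n} \<subseteq> {..<n}"
      and d: "tdet (min m n) (\<lambda>i j. e (bpol m (\<rho> i)) (T (\<sigma> j))) = gx ^ tri p * germ_y ^ tri q"
      using minors [OF pq] by blast
    then have "iot (tdet (min m n) (\<lambda>i j. e (bpol m (\<rho> i)) (T (\<sigma> j)))) \<in>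
        maximal_minors (OX Feq) m n (\<lambda>i j. edual m i (PP_class m Feq (T j)))"
      unfolding eq by blast
    then show ?thesis using mm by (auto simp: d)
  qed
  have ti: "tideal {f. iot f \<in> ?J}"
    by (rule surj_hom_ideal_preimage [OF surj_hom_iot ideal_degeneracy(1) [OF e \<tau>]])
  have "{f. iot f \<in> ?J} = mon_ideal (stair (min m n))"
    using stair_subset_gx [OF ti gen] degeneracy_subset_stair [OF e \<tau> r] by blast
  then show ?thesis unfolding dim_k_quot_eq [OF ideal_degeneracy(1) [OF e \<tau>]]
    using quot_basis_mon_ideal [OF card_stair_complement(1) [OF r]] colength_le
    by (metis card_stair_complement(2) [OF r])
qed

lemma strict_mono_skip: "strict_mono_on A (\<lambda>i :: nat. if i < j then i else i + 1)"
  by (auto simp: strict_mono_on_def)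

lemma degeneracy_dim_2:
  assumes m: "m \<ge> 2"
  shows "dim_k_quot Feq (degeneracy_ideal m (m - 1) Feq (edual m) (\<lambda>j. PP_class m Feq (tau2 m j)))
    \<le> enat ((m + 1) choose 4)"
proof -
  have mn: "min m (m - 1) = m - 1" by simp
  have "dim_k_quot Feq (degeneracy_ideal m (m - 1) Feq (edual m) (\<lambda>j. PP_class m Feq (tau2 m j)))
    \<le> enat ((min m (m - 1) + 2) choose 4)"
  proof (rule degeneracy_dim_upper)
    fix p q assume "p + q + 1 = min m (m - 1)"
    then have pq: "1 \<le> p + 1" "p + 1 \<le> m - 1" "m - 1 - (p + 1) = q" by auto
    let ?\<rho> = "\<lambda>i. if i < p + 1 then i else i + 1"
    have "strict_mono_on {..<m - 1} ?\<rho> \<and> ?\<rho> ` {..<m - 1} \<subseteq> {..<m} \<and>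
      strict_mono_on {..<m - 1} (\<lambda>i. i) \<and> (\<lambda>i. i) ` {..<m - 1} \<subseteq> {..<m - 1} \<and>
      tdet (m - 1) (\<lambda>i j. e (bpol m (?\<rho> i)) (tau2 m j)) = gx ^ tri p * germ_y ^ tri q"
      using tdet_tau2 [OF pq(1,2)] pq(3) by (auto simp: strict_mono_skip strict_mono_on_def)
    then show "\<exists>\<rho> \<sigma>. strict_mono_on {..<min m (m - 1)} \<rho> \<and> \<rho> ` {..<min m (m - 1)} \<subseteq> {..<m} \<and>
      strict_mono_on {..<min m (m - 1)} \<sigma> \<and> \<sigma> ` {..<min m (m - 1)} \<subseteq> {..<m - 1} \<and>
      tdet (min m (m - 1)) (\<lambda>i j. e (bpol m (\<rho> i)) (tau2 m (\<sigma> j))) = gx ^ tri p * germ_y ^ tri q"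
      unfolding mn by (intro exI [of _ ?\<rho>] exI [of _ "\<lambda>i. i"])
  qed (use m in auto)
  moreover have "min m (m - 1) + 2 = m + 1" using m by simp
  ultimately show ?thesis by simp
qed

lemma degeneracy_dim_11:
  assumes m: "m \<ge> 1"
  shows "dim_k_quot Feq (degeneracy_ideal m (m + 1) Feq (edual m) (\<lambda>j. PP_class m Feq (tau11 m j)))
    \<le> enat ((m + 2) choose 4)"
proof -
  have mn: "min m (m + 1) = m" by simp
  have "dim_k_quot Feq (degeneracy_ideal m (m + 1) Feq (edual m) (\<lambda>j. PP_class m Feq (tau11 m j)))
    \<le> enat ((min m (m + 1) + 2) choose 4)"
  proof (rule degeneracy_dim_upper)
    fix p q assume "p + q + 1 = min m (m + 1)"
    then have pq: "1 \<le> p + 1" "p + 1 \<le> m" "m - (p + 1) = q" by auto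
    let ?\<sigma> = "\<lambda>i. if i < p + 1 then i else i + 1"
    have "strict_mono_on {..<m} (\<lambda>i. i) \<and> (\<lambda>i. i) ` {..<m} \<subseteq> {..<m} \<and>
      strict_mono_on {..<m} ?\<sigma> \<and> ?\<sigma> ` {..<m} \<subseteq> {..<m + 1} \<and>
      tdet m (\<lambda>i j. e (bpol m i) (tau11 m (?\<sigma> j))) = gx ^ tri p * germ_y ^ tri q"
      using tdet_tau11 [OF pq(1,2)] pq(3) by (auto simp: strict_mono_skip strict_mono_on_def)
    then show "\<exists>\<rho> \<sigma>. strict_mono_on {..<min m (m + 1)} \<rho> \<and> \<rho> ` {..<min m (m + 1)} \<subseteq> {..<m} \<and>
      strict_mono_on {..<min m (m + 1)} \<sigma> \<and> \<sigma> ` {..<min m (m + 1)} \<subseteq> {..<m + 1} \<and>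
      tdet (min m (m + 1)) (\<lambda>i j. e (bpol m (\<rho> i)) (tau11 m (\<sigma> j))) = gx ^ tri p * germ_y ^ tri q"
      unfolding mn by (intro exI [of _ ?\<sigma>] exI [of _ "\<lambda>i. i"])
  qed (use m in auto)
  then show ?thesis by simp
qed

text \<open>A square matrix has a single maximal minor, since a strictly increasing self-map of {0,
  ..., m - 1} is the identity.\<close>

lemma degeneracy_principal:
  assumes e: "PP_dual_basis m Feq e'" and \<tau>: "\<forall>j<m. \<tau> j \<in> carrier (PP m Feq)"
    and B: "\<And>i j. i < m \<Longrightarrow> j < m \<Longrightarrow> e' i (\<tau> j) = iot (B i j)"
  shows "{f. iot f \<in> degeneracy_ideal m m Feq e' \<tau>} = {s. tdet m B dvd s}"
proof -
  have id_minor: "tdet m (\<lambda>i j. B (\<rho> i) (\<sigma> j)) = tdet m B"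
    if "strict_mono_on {..<m} \<rho> \<and> \<rho> ` {..<m} \<subseteq> {..<m} \<and> strict_mono_on {..<m} \<sigma> \<and> \<sigma> ` {..<m} \<subseteq> {..<m}" for \<rho> \<sigma>
  proof (rule tdet_cong)
    fix i j assume "i < m" "j < m"
    then have "\<rho> i = i" "\<sigma> j = j" using that strict_mono_on_full by blast+
    then show "B (\<rho> i) (\<sigma> j) = B i j" by simp
  qed
  let ?M = "{iot (tdet m (\<lambda>i j. B (\<rho> i) (\<sigma> j))) |\<rho> \<sigma>.
      strict_mono_on {..<m} \<rho> \<and> \<rho> ` {..<m} \<subseteq> {..<m} \<and>
      strict_mono_on {..<m} \<sigma> \<and> \<sigma> ` {..<m} \<subseteq> {..<m}}"
  have "maximal_minors (OX Feq) m m (\<lambda>i j. e' i (\<tau> j)) = ?M"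
    by (subst maximal_minors_in [OF surj_hom_iot, where A = "\<lambda>i j. e' i (\<tau> j)" and B = B]) (simp_all add: B)
  also have "?M = {iot (tdet m B)}"
  proof (intro subset_antisym subsetI)
    fix x assume "x \<in> ?M"
    then obtain \<rho> \<sigma> where "x = iot (tdet m (\<lambda>i j. B (\<rho> i) (\<sigma> j)))"
      "strict_mono_on {..<m} \<rho> \<and> \<rho> ` {..<m} \<subseteq> {..<m} \<and> strict_mono_on {..<m} \<sigma> \<and> \<sigma> ` {..<m} \<subseteq> {..<m}"
      by blast
    then show "x \<in> {iot (tdet m B)}" by (simp add: id_minor)
  next
    fix x assume "x \<in> {iot (tdet m B)}"
    then show "x \<in> ?M"
      by (intro CollectI exI [of _ "\<lambda>i. i"]) (simp add: strict_mono_on_def)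
  qed
  finally have mm: "maximal_minors (OX Feq) m m (\<lambda>i j. e' i (\<tau> j)) = {iot (tdet m B)}" .
  have "f \<in> {s. tdet m B dvd s}" if "iot f \<in> degeneracy_ideal m m Feq e' \<tau>" for f
    using that unfolding degeneracy_ideal_def mm
    by (rule surj_hom_genideal_subset [OF surj_hom_iot tideal_dvd, rotated 2]) auto
  moreover have "iot s \<in> degeneracy_ideal m m Feq e' \<tau>" if "tdet m B dvd s" for s
  proof -
    have "tdet m B \<in> {f. iot f \<in> degeneracy_ideal m m Feq e' \<tau>}"
      using ideal_degeneracy(2) [OF e \<tau>] by (simp add: mm)
    then have "s \<in> {f. iot f \<in> degeneracy_ideal m m Feq e' \<tau>}"
      using that tideal_mult_right [OF surj_hom_ideal_preimage [OF surj_hom_iot ideal_degeneracy(1) [OF e \<tau>]]]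
      by (metis dvdE)
    then show ?thesis by simp
  qed
  ultimately show ?thesis by blast
qed

text \<open>Under \<open>iot\<close> the parameter t becomes t0, a unit multiple of xy, so adding
  the special fibre turns the principal ideal of the determinant into (xy, det).\<close>

lemma dim_special_fiber:
  assumes e: "PP_dual_basis m Feq e'" and \<tau>: "\<forall>j<m. \<tau> j \<in> carrier (PP m Feq)"
    and B: "\<And>i j. i < m \<Longrightarrow> j < m \<Longrightarrow> e' i (\<tau> j) = iot (B i j)"
  shows "dim_k_quot Feq (set_add (OX Feq) (special_fiber_ideal Feq) (degeneracy_ideal m m Feq e' \<tau>))
    = colength (fib_ideal (tdet m B))"
proof -
  interpret cring "OX Feq" by (rule iot(1))
  let ?D = "degeneracy_ideal m m Feq e' \<tau>"
  have t: "OX_class Feq fps_X = iot t0" by (simp add: OX_class_eq_iot ev_X [OF t0_mpow])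
  have sp: "special_fiber_ideal Feq = {iot (r * t0) |r. True}"
    unfolding special_fiber_ideal_def t cgenideal_def by (auto simp: iot(8) iot(4))
  have spi: "ideal (special_fiber_ideal Feq) (OX Feq)"
    unfolding special_fiber_ideal_def by (rule cgenideal_ideal) (simp add: t iot(2))
  note I = add_ideals [OF spi ideal_degeneracy(1) [OF e \<tau>]]
  have D: "g \<in> ?D \<longleftrightarrow> (\<exists>s. g = iot (tdet m B * s))" for g
  proof
    assume "g \<in> ?D"
    moreover from this obtain f where "g = iot f"
      using ideal.Icarr [OF ideal_degeneracy(1) [OF e \<tau>]] iot(8) by blast
    ultimately have "f \<in> {f. iot f \<in> ?D}" by simp
    then have "f \<in> {s. tdet m B dvd s}" by (simp only: degeneracy_principal [OF e \<tau>, of B, OF B])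
    then show "\<exists>s. g = iot (tdet m B * s)" using \<open>g = iot f\<close> by (auto elim: dvdE)
  next
    assume "\<exists>s. g = iot (tdet m B * s)"
    then obtain s where g: "g = iot (tdet m B * s)" ..
    have "tdet m B * s \<in> {s. tdet m B dvd s}" by simp
    then have "tdet m B * s \<in> {f. iot f \<in> ?D}" by (simp only: degeneracy_principal [OF e \<tau>, of B, OF B])
    then show "g \<in> ?D" by (simp add: g)
  qed
  have "{f. iot f \<in> set_add (OX Feq) (special_fiber_ideal Feq) ?D} = fib_ideal (tdet m B)"
  proof (intro Set.set_eqI iffI)
    fix f assume "f \<in> {f. iot f \<in> set_add (OX Feq) (special_fiber_ideal Feq) ?D}"
    then obtain r s where "iot f = iot (r * t0) \<oplus>\<^bsub>OX Feq\<^esub> iot (tdet m B * s)"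
      by (auto simp: set_add_def' sp D)
    then have "f = r * t0 + tdet m B * s" by (simp add: iot_inject flip: iot(3))
    also have "r * t0 = node * (r * w)" by (simp add: t0_eq mult_ac)
    finally show "f \<in> fib_ideal (tdet m B)" unfolding fib_ideal_def by blast
  next
    fix f assume "f \<in> fib_ideal (tdet m B)"
    then obtain g h where f: "f = node * g + tdet m B * h" by (auto simp: fib_ideal_def)
    have "node * g = - u * g * t0" by (simp add: node_eq mult_ac)
    then have "iot f = iot (- u * g * t0) \<oplus>\<^bsub>OX Feq\<^esub> iot (tdet m B * h)" by (simp only: f iot(3) [symmetric])
    moreover have "iot (- u * g * t0) \<in> special_fiber_ideal Feq" unfolding sp by blast
    moreover have "iot (tdet m B * h) \<in> ?D" unfolding D by blast
    ultimately show "f \<in> {f. iot f \<in> set_add (OX Feq) (special_fiber_ideal Feq) ?D}"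
      by (auto simp: set_add_def')
  qed
  then show ?thesis by (simp add: dim_k_quot_eq [OF I])
qed

lemma dim_special_fiber_lower:
  assumes m: "m \<ge> 1" and e: "PP_dual_basis m Feq e'" and \<tau>: "\<forall>j<m. \<tau> j \<in> carrier (PP m Feq)"
  shows "enat (m * (m - 1)) \<le>
    dim_k_quot Feq (set_add (OX Feq) (special_fiber_ideal Feq) (degeneracy_ideal m m Feq e' \<tau>))"
proof -
  obtain P T where PT: "\<And>i j. i < m \<Longrightarrow> j < m \<Longrightarrow> e' i (\<tau> j) = iot (\<Sum>l<m. P i l * e (bpol m l) (T j))"
    using values_matrix [OF e \<tau>] by blast
  have "tdet m (\<lambda>i j. \<Sum>l<m. P i l * e (bpol m l) (T j)) \<in> mon_ideal (stair m)"
    by (rule minor_in_stair [OF m]) simp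
  from fib_colength_lower [OF this]
  have "enat (m * (m - 1)) \<le> colength (fib_ideal (tdet m (\<lambda>i j. \<Sum>l<m. P i l * e (bpol m l) (T j))))"
    unfolding two_tri by (rule colength_ge)
  then show ?thesis
    by (subst dim_special_fiber [OF e \<tau>, where B = "\<lambda>i j. \<Sum>l<m. P i l * e (bpol m l) (T j)"])
      (simp_all add: PT)
qed

lemma dim_special_fiber_upper:
  assumes m: "m \<ge> 1"
  shows "dim_k_quot Feq (set_add (OX Feq) (special_fiber_ideal Feq)
    (degeneracy_ideal m m Feq (edual m) (\<lambda>j. PP_class m Feq (tau1 m j)))) \<le> enat (m * (m - 1))"
proof -
  have \<tau>: "\<forall>j<m. PP_class m Feq (tau1 m j) \<in> carrier (PP m Feq)" by (simp add: carrier_PP)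
  show ?thesis
    unfolding dim_special_fiber [OF edual_basis [OF m] \<tau> edual(1) [OF m]] tdet_tau1
    using det1_quot_basis [OF m] colength_le by blast
qed

end

section \<open>First-order deformations of the node\<close>

lemma Def1_ideal_node: "Def1_ideal node = (mpow 1 :: 'k::field fps fps set)"
proof -
  have d: "deriv_x node = germ_y" "deriv_y node = (germ_x :: 'k fps fps)"
    by (simp_all add: node_def derivnD [OF derivn_deriv_x] derivnD [OF derivn_deriv_y] deriv_germs)
  have m: "tideal (mpow 1 :: 'k fps fps set)" by (rule tideal_mon_ideal [OF upset_deg])
  note g = genideal_type_ring(1,2) [of "{node, germ_y, germ_x :: 'k fps fps}"]
  have "f \<in> genideal type_ring {node, germ_y, germ_x}" if "f \<in> mpow 1" for f :: "'k fps fps"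
  proof -
    obtain p q where "f = const2 (cf f 0 0) + germ_x * p + germ_y * q" using germ_division by blast
    moreover have "cf f 0 0 = 0" using that by (simp only: mpow_1_iff)
    ultimately have "f = germ_x * p + germ_y * q" by simp
    then show ?thesis using g(1,2) by (auto intro!: tideal_add tideal_mult_right)
  qed
  moreover have "genideal type_ring {node, germ_y, germ_x} \<subseteq> (mpow 1 :: 'k fps fps set)"
    by (rule genideal_type_ring(3) [OF m]) (auto simp: node_def intro!: tideal_mult_right [OF m, unfolded One_nat_def])
  ultimately show ?thesis unfolding Def1_ideal_def d by blast
qed

text \<open>The partial derivatives of xy are y and x, so the quotient is the residue field: it has
  dimension one, and a representative of a basis is a unit.\<close>

lemma Def1_node_basis:
  fixes \<delta> :: "nat \<Rightarrow> 'k::field fps fps"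
  assumes "represents_Def1_basis node d \<delta>"
  shows "d = 1" "cf (\<delta> 0) 0 0 \<noteq> 0"
proof -
  let ?J = "mpow 1 :: 'k fps fps set"
  have m: "tideal ?J" by (rule tideal_mon_ideal [OF upset_deg])
  have b: "quot_basis ?J d \<delta>"
    using assms unfolding represents_Def1_basis_def Def1_def Def1_ideal_node quot_basis_def
    by (subst (asm) alg_module_free_basis [OF surj_hom_type_quot [OF m], where \<kappa> = const2]) auto
  have nz: "cf (\<delta> i) 0 0 \<noteq> 0" if i: "i < d" for i
  proof
    assume "cf (\<delta> i) 0 0 = 0"
    then have "\<delta> i \<in> ?J" by (simp only: mpow_1_iff)
    moreover have "(\<Sum>j<d. const2 (if j = i then 1 else 0) * \<delta> j) = (\<Sum>j<d. if j = i then \<delta> j else 0)"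
      by (rule sum.cong) auto
    ultimately have "(\<Sum>j<d. const2 (if j = i then 1 else 0) * \<delta> j) \<in> ?J" using i by simp
    from quot_basis_unique [OF b tideal_0 [OF m] this m i] show False by simp
  qed
  have "1 \<le> d"
  proof (rule quot_basis_lower [OF b, where l = "\<lambda>j f. cf f 0 0"])
    show "\<exists>f :: 'k fps fps. \<forall>j'<1. cf f 0 0 = (if j = j' then 1 else 0)" if "j < 1" for j :: nat
      by (rule exI [of _ 1]) (use that in \<open>simp add: cf_1\<close>)
  qed (auto simp: klinear_cf mpow_1_iff [unfolded One_nat_def])
  moreover have "\<not> 2 \<le> d"
  proof
    assume d: "2 \<le> d"
    define c where "c j = (if j = 0 then cf (\<delta> 1) 0 0 else if j = 1 then - cf (\<delta> 0) 0 0 else 0)" for j :: nat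
    have "(\<Sum>j<d. const2 (c j) * \<delta> j) = (\<Sum>j\<in>{0, 1}. const2 (c j) * \<delta> j)"
      using d by (intro sum.mono_neutral_right) (auto simp: c_def)
    then have "cf (\<Sum>j<d. const2 (c j) * \<delta> j) 0 0 = 0" by (simp add: c_def)
    then have "(\<Sum>j<d. const2 (c j) * \<delta> j) \<in> ?J" by (simp only: mpow_1_iff)
    from quot_basis_unique [OF b tideal_0 [OF m] this m, of 0] d have "c 0 = 0" by simp
    then show False using nz [of 1] d by (simp add: c_def)
  qed
  ultimately show "d = 1" by simp
  then show "cf (\<delta> 0) 0 0 \<noteq> 0" using nz by simp
qed

section \<open>The trivial deformation\<close>

lemma fps_const_x_dvd_cancel:
  fixes s :: "'k::field fps fps fps"
  assumes "fps_const germ_x * q = fps_const germ_y ^ m * s"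
  shows "fps_const germ_x dvd s"
proof -
  have "\<exists>c. fps_nth s n = germ_x * c" for n
  proof -
    have "germ_x ^ 1 * fps_nth q n = germ_y ^ m * fps_nth s n"
      using arg_cong [OF assms, of "\<lambda>f. fps_nth f n"] by (simp add: fps_const_power)
    from germ_power_coprime [OF this] show ?thesis by simp
  qed
  then obtain c where "\<And>n. fps_nth s n = germ_x * c n" by metis
  then have "s = fps_const germ_x * Abs_fps c" by (intro fps_ext) simp
  then show ?thesis by (rule dvdI)
qed

text \<open>
  In the dual of the principal parts of the node, \<open>x\<partial>\<^sub>x\<close> is annihilated by \<open>y\<close> but is not
  divisible by \<open>x\<close>, which is impossible in a free module.
\<close>

lemma node_dual_not_free:
  fixes e :: "nat \<Rightarrow> 'k::field fps fps fps fps fps set set \<Rightarrow> 'k fps fps fps set"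
  assumes m: "m \<ge> 2"
  shows "\<not> PP_dual_basis m (fps_const node) e"
proof
  let ?F = "fps_const node :: 'k fps fps fps"
  let ?x = "fps_const germ_x :: 'k fps fps fps" and ?y = "fps_const germ_y :: 'k fps fps fps"
  let ?M = "dual_module (OX ?F) (PP m ?F)"
  let ?D = "Theta germ_x 0 :: 'k fps fps fps fps fps \<Rightarrow> _"
  let ?cl = "OX_class ?F"
  assume "PP_dual_basis m ?F e"
  then have ec: "\<And>i. i < m \<Longrightarrow> e i \<in> carrier ?M"
    and basis: "\<And>\<phi>. \<phi> \<in> carrier ?M \<Longrightarrow>
      \<exists>!c. c \<in> {..<m} \<rightarrow>\<^sub>E carrier (OX ?F) \<and> \<phi> = (\<Oplus>\<^bsub>?M\<^esub>i\<in>{..<m}. c i \<odot>\<^bsub>?M\<^esub> e i)"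
    by (auto simp: PP_dual_basis_def free_basis_def)
  interpret R: cring "OX ?F" by (rule surj_homD(1) [OF surj_hom_OX])
  note cl = surj_homD [OF surj_hom_OX, of ?F]
  have F: "?F = ?x * ?y" by (simp add: node_def)
  have x0: "?x \<noteq> 0" and y0: "?y \<noteq> 0" by (simp_all add: germ_x_def germ_y_def)
  have thx: "theta germ_x 0 germ_x = (germ_x :: 'k fps fps)" "theta germ_x 0 node = (node :: 'k fps fps)"
    "theta germ_x 0 0 = (0 :: 'k fps fps)"
    by (simp_all add: theta_def deriv_germs node_def derivnD [OF derivn_deriv_x])
  have rd: "rel_derivation ?F ?D"
  proof
    show "\<exists>c. ?D (right_factor ?F) = right_factor ?F * c"
      by (rule exI [of _ 1]) (simp add: Theta_right coeff_map_const thx)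
  qed (rule derivn_Theta Theta_left)+
  interpret rel_derivation ?F ?D by (rule rd)
  \<comment> \<open>The hypothesis m >= 2 makes an operator of order one well defined on the
    principal parts.\<close>
  have KN2: "w \<in> KN m ?F \<Longrightarrow> ?F dvd mu w \<and> ?F dvd mu (?D w)" for w
    using KN_Z [of m] Z_le [OF m, of w] by (auto simp: numeral_2_eq_2)
  define G where "G w = mu (?D w)" for w
  have Gl: "G (left_factor s * w) = s * G w" and Ga: "G (v + w) = G v + G w" for s v w
    by (simp_all add: G_def derivnD [OF D] D_left rhomD [OF rhom_mu])
  note dG = dual_of [where G = G and F = ?F and m = m, OF Ga Gl]
  define \<phi> where "\<phi> = dual_of m ?F G"
  have \<phi>v: "\<phi> (PP_class m ?F w) = ?cl (G w)" for w
    unfolding \<phi>_def by (rule dG) (simp add: KN2 G_def)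
  have \<phi>: "\<phi> \<in> carrier ?M" unfolding \<phi>_def by (rule dG) (simp add: KN2 G_def)
  obtain c where c: "c \<in> {..<m} \<rightarrow>\<^sub>E carrier (OX ?F)" "\<phi> = (\<Oplus>\<^bsub>?M\<^esub>i\<in>{..<m}. c i \<odot>\<^bsub>?M\<^esub> e i)"
    using ex1_implies_ex [OF basis [OF \<phi>]] by blast
  have "\<forall>i<m. \<exists>s. c i = ?cl s" using c(1) cl(8) by (auto simp: PiE_iff) blast
  then obtain s where s: "\<And>i. i < m \<Longrightarrow> c i = ?cl (s i)" by metis
  have ev: "\<exists>t. \<forall>i<m. e i (PP_class m ?F w) = ?cl (t i)" for w
  proof -
    have "e i (PP_class m ?F w) \<in> range ?cl" if "i < m" for i
      using ec [OF that] unfolding dual_carrier_iff cl(8) [symmetric] by (auto simp: carrier_PP)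
    then have "\<forall>i<m. \<exists>t. e i (PP_class m ?F w) = ?cl t" by blast
    then show ?thesis by metis
  qed
  have comb: "(\<Oplus>\<^bsub>?M\<^esub>i\<in>{..<m}. b i \<odot>\<^bsub>?M\<^esub> e i) (PP_class m ?F w) = ?cl (\<Sum>i<m. r i * t i)"
    if b: "\<And>i. i < m \<Longrightarrow> b i = ?cl (r i)" and t: "\<And>i. i < m \<Longrightarrow> e i (PP_class m ?F w) = ?cl (t i)" for b r w t
  proof -
    have "(\<Oplus>\<^bsub>?M\<^esub>i\<in>{..<m}. b i \<odot>\<^bsub>?M\<^esub> e i) (PP_class m ?F w) =
        (\<Oplus>\<^bsub>OX ?F\<^esub>i\<in>{..<m}. b i \<otimes>\<^bsub>OX ?F\<^esub> e i (PP_class m ?F w))"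
      by (rule dual_combination_apply) (auto simp: b cl(2) ec)
    also have "\<dots> = (\<Oplus>\<^bsub>OX ?F\<^esub>i\<in>{..<m}. ?cl (r i * t i))"
      by (rule R.finsum_cong') (auto simp: b t cl(2) cl(4))
    finally show ?thesis by (simp add: surj_hom_finsum [OF surj_hom_OX])
  qed
  \<comment> \<open>y \<phi> = 0, as xy vanishes on X. Uniqueness of coordinates forces y s_i into
    (xy), so x divides s_i.\<close>
  have x_dvd_s: "?x dvd s i" if i: "i < m" for i
  proof -
    let ?z = "\<zero>\<^bsub>?M\<^esub>"
    let ?c1 = "\<lambda>i\<in>{..<m}. ?cl (?y * s i)" and ?c0 = "\<lambda>i\<in>{..<m}. ?cl 0"
    interpret M: abelian_monoid ?M by (rule dual_PP_monoid)
    have z: "?z (PP_class m ?F w) = ?cl 0" for w by (simp add: dual_ops carrier_PP cl(6))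
    have "?z = (\<Oplus>\<^bsub>?M\<^esub>i\<in>{..<m}. ?c1 i \<odot>\<^bsub>?M\<^esub> e i)"
    proof (rule dual_eqI [OF M.zero_closed])
      show "(\<Oplus>\<^bsub>?M\<^esub>i\<in>{..<m}. ?c1 i \<odot>\<^bsub>?M\<^esub> e i) \<in> carrier ?M"
        by (rule dual_combination_closed) (auto simp: cl(2) ec)
      fix w
      obtain t where t: "\<And>i. i < m \<Longrightarrow> e i (PP_class m ?F w) = ?cl (t i)" using ev by blast
      have "?cl (\<Sum>i<m. s i * t i) = ?cl (G w)"
        using comb [of c s w t, OF s t] c(2) \<phi>v by simp
      then have "?F dvd (\<Sum>i<m. s i * t i) - G w" by (simp add: cl(9))
      moreover have "?F dvd ?y * G w"
      proof -
        have "?D w = right_factor ?x * coeff_map (coeff_map fps_deriv) w"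
          by (rule fps_ext) (simp add: Theta_def right_factor_const rhomD [OF rhom_right0])
        then show ?thesis by (simp add: G_def rhomD [OF rhom_mu] node_def flip: fps_const_mult)
      qed
      ultimately have "?F dvd ?y * ((\<Sum>i<m. s i * t i) - G w) + ?y * G w" by (rule dvd_add [OF dvd_mult])
      also have "\<dots> = (\<Sum>i<m. (?y * s i) * t i)" by (simp add: algebra_simps sum_distrib_left)
      finally have "?cl (\<Sum>i<m. (?y * s i) * t i) = ?cl 0" by (simp add: cl(9))
      moreover have "(\<Oplus>\<^bsub>?M\<^esub>i\<in>{..<m}. ?c1 i \<odot>\<^bsub>?M\<^esub> e i) (PP_class m ?F w) = ?cl (\<Sum>i<m. (?y * s i) * t i)"
        by (rule comb [OF _ t]) simp_all
      ultimately show "?z (PP_class m ?F w) = (\<Oplus>\<^bsub>?M\<^esub>i\<in>{..<m}. ?c1 i \<odot>\<^bsub>?M\<^esub> e i) (PP_class m ?F w)"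
        by (simp only: z)
    qed
    moreover have "?z = (\<Oplus>\<^bsub>?M\<^esub>i\<in>{..<m}. ?c0 i \<odot>\<^bsub>?M\<^esub> e i)"
    proof (rule dual_eqI [OF M.zero_closed])
      show "(\<Oplus>\<^bsub>?M\<^esub>i\<in>{..<m}. ?c0 i \<odot>\<^bsub>?M\<^esub> e i) \<in> carrier ?M"
        by (rule dual_combination_closed) (auto simp: cl(2) ec)
      fix w
      obtain t where t: "\<And>i. i < m \<Longrightarrow> e i (PP_class m ?F w) = ?cl (t i)" using ev by blast
      have "(\<Oplus>\<^bsub>?M\<^esub>i\<in>{..<m}. ?c0 i \<odot>\<^bsub>?M\<^esub> e i) (PP_class m ?F w) = ?cl (\<Sum>i<m. 0 * t i)"
        by (rule comb [OF _ t]) simp_all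
      then show "?z (PP_class m ?F w) = (\<Oplus>\<^bsub>?M\<^esub>i\<in>{..<m}. ?c0 i \<odot>\<^bsub>?M\<^esub> e i) (PP_class m ?F w)"
        by (simp add: z)
    qed
    moreover have "?c1 \<in> {..<m} \<rightarrow>\<^sub>E carrier (OX ?F)" "?c0 \<in> {..<m} \<rightarrow>\<^sub>E carrier (OX ?F)"
      by (simp_all add: restrict_PiE_iff cl(2))
    ultimately have "?c1 = ?c0" using basis [OF M.zero_closed] by blast
    from fun_cong [OF this, of i] have "?cl (?y * s i) = ?cl 0" using i by simp
    then have "?F dvd ?y * s i" by (simp add: cl(9))
    then obtain q where "?y * s i = ?F * q" by blast
    then have "?y * s i = ?y * (?x * q)" unfolding F by (simp only: mult_ac)
    then have "s i = ?x * q" using y0 by (simp only: mult_cancel_left) blast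
    then show ?thesis by (rule dvdI)
  qed
  obtain t where t: "\<And>i. i < m \<Longrightarrow> e i (PP_class m ?F xi) = ?cl (t i)" using ev by blast
  \<comment> \<open>y_1^m kills x_2 - x_1 in the principal parts: y_1^m x_1 is a multiple of x_1
    y_1, and y_1^m is (y_1 - y_2)^m up to a multiple of y_2, which annihilates x_2. So y^m t_i lies
    in (xy).\<close>
  have x_dvd_t: "?x dvd t i" if i: "i < m" for i
  proof -
    let ?ly = "left_factor ?y" and ?ry = "right_factor ?y" and ?lx = "left_factor ?x" and ?rx = "right_factor ?x"
    note K = tideal_KN [of m ?F]
    have l: "?lx * ?ly \<in> KN m ?F" "?rx * ?ry \<in> KN m ?F"
      using factors_in_KN [of ?F m] by (simp_all add: F rhomD [OF rhom_left_factor] rhomD [OF rhom_right_factor] del: fps_const_mult)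
    have dvd: "b dvd (a - b) ^ n - a ^ n" for a b :: "'k fps fps fps fps fps" and n
    proof (induction n)
      case (Suc n)
      have "(a - b) ^ Suc n - a ^ Suc n = (a - b) * ((a - b) ^ n - a ^ n) - b * a ^ n" by (simp add: algebra_simps)
      then show ?case using Suc by simp
    qed simp
    obtain q where "(?ly - ?ry) ^ m - ?ly ^ m = ?ry * q" using dvd by blast
    then have yq: "?ly ^ m = (?ly - ?ry) ^ m - ?ry * q" by (simp add: algebra_simps)
    have "?ly ^ m * ?rx = (?ly - ?ry) ^ m * ?rx - (?rx * ?ry) * q"
      unfolding yq by (simp add: algebra_simps)
    then have "?ly ^ m * ?rx \<in> KN m ?F"
      using tideal_diff [OF K tideal_mult_right [OF K diff_power_KN] tideal_mult_right [OF K l(2)]] by simp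
    moreover have "?ly ^ m * ?lx = (?lx * ?ly) * ?ly ^ (m - 1)"
      using m by (cases m) (simp_all add: mult_ac)
    then have "?ly ^ m * ?lx \<in> KN m ?F" using tideal_mult_right [OF K l(1)] by (simp only:)
    ultimately have "?ly ^ m * xi \<in> KN m ?F"
      using tideal_diff [OF K] by (simp add: right_diff_distrib)
    then have "left_factor (?y ^ m) * xi \<in> KN m ?F" by (simp only: rhomD(7) [OF rhom_left_factor])
    then have "PP_class m ?F (left_factor (?y ^ m) * xi) = PP_class m ?F (left_factor 0 * xi)"
      by (simp add: surj_homD(9) [OF surj_hom_PP] rhomD [OF rhom_left_factor])
    then have "e i (PP_class m ?F (left_factor (?y ^ m) * xi)) = e i (PP_class m ?F (left_factor 0 * xi))" by simp
    moreover have "e i (PP_class m ?F (left_factor r * xi)) = ?cl (r * t i)" for r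
      using ec [OF i] t [OF i] unfolding dual_carrier_iff cl(4) by simp
    ultimately have "?cl (?y ^ m * t i) = ?cl (0 * t i)" by simp
    then have "?F dvd ?y ^ m * t i" by (simp add: cl(9))
    then obtain q where "?y ^ m * t i = ?F * q" by blast
    then have "?x * (?y * q) = ?y ^ m * t i" unfolding F by (simp add: mult_ac)
    then show ?thesis by (rule fps_const_x_dvd_cancel)
  qed
  \<comment> \<open>The form takes the value x on x_2 - x_1, while its expansion in the basis is
    divisible by x^2. This puts x into (x^2, xy), and cancelling x puts 1 into (x, y).\<close>
  have "?D xi = right_factor ?x"
    by (simp add: derivnD [OF D] D_left Theta_right coeff_map_const thx)
  then have "G xi = ?x" by (simp add: G_def)
  then have "?cl ?x = ?cl (\<Sum>i<m. s i * t i)"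
    using comb [of c s xi t, OF s t] c(2) \<phi>v [of xi] by simp
  then have "?F dvd ?x - (\<Sum>i<m. s i * t i)" by (simp add: cl(9))
  then obtain q where q: "?x - (\<Sum>i<m. s i * t i) = ?F * q" by blast
  have "?x * ?x dvd (\<Sum>i<m. s i * t i)"
    using x_dvd_s x_dvd_t by (intro dvd_sum mult_dvd_mono) auto
  then obtain r where r: "(\<Sum>i<m. s i * t i) = ?x * ?x * r" by blast
  have lin: "a * 1 = a * (a * b + c * d)" if "a - S = a * c * d" "S = a * a * b" for a b c d S :: "'k fps fps fps"
    using that by (simp add: algebra_simps diff_eq_eq)
  have "?x * 1 = ?x * (?x * r + ?y * q)"
    by (rule lin [OF q [unfolded F] r])
  then have "1 = ?x * r + ?y * q" using x0 by (simp only: mult_cancel_left) blast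
  from arg_cong [OF this, of "\<lambda>f. cf (fps_nth f 0) 0 0"] show False
    by (simp add: cf_1 cf_germ_x_mult cf_germ_y_mult)
qed


section \<open>Dimension after base change\<close>

text \<open>Preimages of the unit vectors form a basis of size n; that no smaller one exists is
  \<open>span_bound\<close> applied to coordinate vectors.\<close>

lemma vdim_coordinates:
  fixes V :: "('c::field, 'b) module" and \<Psi> :: "'b \<Rightarrow> nat \<Rightarrow> 'c"
  assumes V: "abelian_monoid V" and sm: "\<And>a x. x \<in> carrier V \<Longrightarrow> a \<odot>\<^bsub>V\<^esub> x \<in> carrier V"
    and add: "\<And>x y j. x \<in> carrier V \<Longrightarrow> y \<in> carrier V \<Longrightarrow> j < n \<Longrightarrow> \<Psi> (x \<oplus>\<^bsub>V\<^esub> y) j = \<Psi> x j + \<Psi> y j"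
    and smult: "\<And>a x j. x \<in> carrier V \<Longrightarrow> j < n \<Longrightarrow> \<Psi> (a \<odot>\<^bsub>V\<^esub> x) j = a * \<Psi> x j"
    and inj: "\<And>x y. x \<in> carrier V \<Longrightarrow> y \<in> carrier V \<Longrightarrow> (\<And>j. j < n \<Longrightarrow> \<Psi> x j = \<Psi> y j) \<Longrightarrow> x = y"
    and surj: "\<And>c. \<exists>x\<in>carrier V. \<forall>j<n. \<Psi> x j = c j"
  shows "vdim type_ring V = enat n"
proof -
  interpret abelian_monoid V by (rule V)
  have zero: "\<Psi> \<zero>\<^bsub>V\<^esub> j = 0" if "j < n" for j
  proof -
    have "\<Psi> \<zero>\<^bsub>V\<^esub> j = \<Psi> \<zero>\<^bsub>V\<^esub> j + \<Psi> \<zero>\<^bsub>V\<^esub> j"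
      using add [of "\<zero>\<^bsub>V\<^esub>" "\<zero>\<^bsub>V\<^esub>" j] that by (simp only: zero_closed l_zero)
    then show ?thesis by (simp only: add_cancel_right_right)
  qed
  have sum: "\<Psi> (\<Oplus>\<^bsub>V\<^esub>i\<in>A. c i \<odot>\<^bsub>V\<^esub> e i) j = (\<Sum>i\<in>A. c i * \<Psi> (e i) j)"
    if "finite A" "\<And>i. i \<in> A \<Longrightarrow> e i \<in> carrier V" "j < n" for A :: "nat set" and c e j
    using that
  proof (induction A rule: finite_induct)
    case (insert i A)
    have "(\<Oplus>\<^bsub>V\<^esub>i\<in>A. c i \<odot>\<^bsub>V\<^esub> e i) \<in> carrier V" using insert sm by (intro finsum_closed) auto
    then show ?case using insert sm by (simp add: add smult Pi_def)
  qed (simp add: zero)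
  have "\<exists>e. free_basis type_ring V n e"
  proof -
    have "\<exists>x\<in>carrier V. \<forall>j<n. \<Psi> x j = (if i = j then 1 else 0)" for i by (rule surj)
    then obtain e where e: "\<And>i. e i \<in> carrier V" "\<And>i j. j < n \<Longrightarrow> \<Psi> (e i) j = (if i = j then 1 else 0)" by metis
    have cl: "(\<Oplus>\<^bsub>V\<^esub>i\<in>{..<n}. c i \<odot>\<^bsub>V\<^esub> e i) \<in> carrier V" for c using e sm by (intro finsum_closed) auto
    have val: "\<Psi> (\<Oplus>\<^bsub>V\<^esub>i\<in>{..<n}. c i \<odot>\<^bsub>V\<^esub> e i) j = c j" if "j < n" for c j
    proof -
      have "(\<Sum>i<n. c i * \<Psi> (e i) j) = (\<Sum>i<n. if i = j then c i else 0)"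
        using that by (intro sum.cong) (auto simp: e)
      then show ?thesis using that e by (subst sum) auto
    qed
    have "free_basis type_ring V n e" unfolding free_basis_def
    proof (intro conjI allI impI ballI)
      fix x assume x: "x \<in> carrier V"
      define d where "d = restrict (\<Psi> x) {..<n}"
      show "\<exists>!c. c \<in> {..<n} \<rightarrow>\<^sub>E carrier type_ring \<and> x = (\<Oplus>\<^bsub>V\<^esub>i\<in>{..<n}. c i \<odot>\<^bsub>V\<^esub> e i)"
      proof (rule ex1I)
        have "x = (\<Oplus>\<^bsub>V\<^esub>i\<in>{..<n}. d i \<odot>\<^bsub>V\<^esub> e i)"
          by (rule inj [OF x cl]) (simp add: val d_def)
        then show "d \<in> {..<n} \<rightarrow>\<^sub>E carrier type_ring \<and> x = (\<Oplus>\<^bsub>V\<^esub>i\<in>{..<n}. d i \<odot>\<^bsub>V\<^esub> e i)"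
          by (simp add: d_def restrict_PiE_iff)
        fix c assume c: "c \<in> {..<n} \<rightarrow>\<^sub>E carrier type_ring \<and> x = (\<Oplus>\<^bsub>V\<^esub>i\<in>{..<n}. c i \<odot>\<^bsub>V\<^esub> e i)"
        then have "c j = \<Psi> x j" if "j < n" for j using val [OF that, of c] by simp
        with c show "c = d"
          by (intro PiE_ext [of c "{..<n}" "\<lambda>_. UNIV"]) (auto simp: d_def restrict_PiE_iff)
      qed
    qed (rule e)
    then show ?thesis by blast
  qed
  moreover have "n \<le> n'" if "free_basis type_ring V n' e" for n' e
  proof (rule span_bound [where V = "\<lambda>i j. \<Psi> (e i) j"])
    fix j assume "j < n"
    obtain x where x: "x \<in> carrier V" "\<forall>j'<n. \<Psi> x j' = (if j = j' then 1 else 0)"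
      using surj [of "\<lambda>j'. if j = j' then 1 else 0"] by blast
    have "\<exists>!c. c \<in> {..<n'} \<rightarrow>\<^sub>E carrier type_ring \<and> x = (\<Oplus>\<^bsub>V\<^esub>i\<in>{..<n'}. c i \<odot>\<^bsub>V\<^esub> e i)"
      using that x(1) unfolding free_basis_def by (elim conjE) (rule bspec)
    then obtain c where c: "x = (\<Oplus>\<^bsub>V\<^esub>i\<in>{..<n'}. c i \<odot>\<^bsub>V\<^esub> e i)"
      by (elim ex1E conjE)
    have "(\<Sum>i<n'. c i * \<Psi> (e i) j') = \<Psi> x j'" if "j' < n" for j'
      unfolding c using \<open>free_basis type_ring V n' e\<close> that by (subst sum) (auto simp: free_basis_def)
    then show "\<exists>c. \<forall>j'<n. (\<Sum>i<n'. c i * \<Psi> (e i) j') = (if j = j' then 1 else 0)"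
      using x by (intro exI [of _ c]) simp
  qed
  ultimately show ?thesis unfolding vdim_def
    by (intro antisym Inf_lower Inf_greatest) auto
qed

section \<open>Tensor products by generators and relations\<close>

lemma free_module_simps [simp]:
  "carrier (free_module B) = {\<phi>. finite {b. \<phi> b \<noteq> 0} \<and> {b. \<phi> b \<noteq> 0} \<subseteq> B}"
  "\<zero>\<^bsub>free_module B\<^esub> = (\<lambda>b. 0)" "\<phi> \<oplus>\<^bsub>free_module B\<^esub> \<psi> = (\<lambda>b. \<phi> b + \<psi> b)"
  "c \<odot>\<^bsub>free_module B\<^esub> \<phi> = (\<lambda>b. c * \<phi> b)"
  by (simp_all add: free_module_def)

lemma free_module_closed:
  fixes \<phi> \<psi> :: "'b \<Rightarrow> 'c::comm_ring_1"
  shows "\<phi> \<in> carrier (free_module B) \<Longrightarrow> \<psi> \<in> carrier (free_module B) \<Longrightarrow> (\<lambda>b. \<phi> b + \<psi> b) \<in> carrier (free_module B)"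
    "\<phi> \<in> carrier (free_module B) \<Longrightarrow> (\<lambda>b. c * \<phi> b) \<in> carrier (free_module B)"
proof -
  assume "\<phi> \<in> carrier (free_module B)" "\<psi> \<in> carrier (free_module B)"
  moreover have "{b. \<phi> b + \<psi> b \<noteq> 0} \<subseteq> {b. \<phi> b \<noteq> 0} \<union> {b. \<psi> b \<noteq> 0}" by auto
  ultimately show "(\<lambda>b. \<phi> b + \<psi> b) \<in> carrier (free_module B)"
    by (auto intro: finite_subset)
next
  assume "\<phi> \<in> carrier (free_module B)"
  moreover have "{b. c * \<phi> b \<noteq> 0} \<subseteq> {b. \<phi> b \<noteq> 0}" by auto
  ultimately show "(\<lambda>b. c * \<phi> b) \<in> carrier (free_module B)"
    by (auto intro: finite_subset)
qed

lemma module_free_module: "module type_ring (free_module B :: ('c::comm_ring_1, 'b \<Rightarrow> 'c) module)"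
proof (rule moduleI)
  show "cring (type_ring :: 'c ring)" by (rule cring_type_ring)
  show "abelian_group (free_module B :: ('c, 'b \<Rightarrow> 'c) module)"
  proof (rule abelian_groupI)
    fix \<phi> :: "'b \<Rightarrow> 'c" assume "\<phi> \<in> carrier (free_module B)"
    then have "(\<lambda>b. - 1 * \<phi> b) \<in> carrier (free_module B)" by (rule free_module_closed)
    moreover have "(\<lambda>b. - 1 * \<phi> b) \<oplus>\<^bsub>free_module B\<^esub> \<phi> = \<zero>\<^bsub>free_module B\<^esub>" by simp
    ultimately show "\<exists>\<psi>\<in>carrier (free_module B). \<psi> \<oplus>\<^bsub>free_module B\<^esub> \<phi> = \<zero>\<^bsub>free_module B\<^esub>" by blast
  qed (use free_module_closed in \<open>simp_all add: add_ac\<close>)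
qed (use free_module_closed in \<open>simp_all add: algebra_simps\<close>)

lemma submoduleD:
  assumes "submodule N type_ring (free_module B :: ('c::comm_ring_1, 'b \<Rightarrow> 'c) module)"
  shows "N \<subseteq> carrier (free_module B)" "(\<lambda>b. 0) \<in> N"
    "\<phi> \<in> N \<Longrightarrow> \<psi> \<in> N \<Longrightarrow> (\<lambda>b. \<phi> b + \<psi> b) \<in> N" "\<phi> \<in> N \<Longrightarrow> (\<lambda>b. c * \<phi> b) \<in> N"
proof -
  interpret submodule N type_ring "free_module B" by fact
  show "N \<subseteq> carrier (free_module B)" using subset by simp
  show "(\<lambda>b. 0) \<in> N" using one_closed by simp
  show "\<phi> \<in> N \<Longrightarrow> \<psi> \<in> N \<Longrightarrow> (\<lambda>b. \<phi> b + \<psi> b) \<in> N" using m_closed [of \<phi> \<psi>] by simp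
  show "\<phi> \<in> N \<Longrightarrow> (\<lambda>b. c * \<phi> b) \<in> N" using smult_closed [of c \<phi>] by simp
qed

lemma submodule_sum:
  assumes N: "submodule N type_ring (free_module B :: ('c::comm_ring_1, 'b \<Rightarrow> 'c) module)"
    and "\<And>i. i \<in> A \<Longrightarrow> f i \<in> N"
  shows "(\<lambda>b. \<Sum>i\<in>A. c i * f i b) \<in> N"
  using assms(2)
proof (induction A rule: infinite_finite_induct)
  case (insert i A)
  then show ?case using submoduleD(3) [OF N submoduleD(4) [OF N], of "f i" _ "c i"] by simp
qed (simp_all add: submoduleD(2) [OF N])

definition coord_sum :: "('b \<Rightarrow> nat \<Rightarrow> 'c) \<Rightarrow> ('b \<Rightarrow> 'c::comm_ring_1) \<Rightarrow> nat \<Rightarrow> 'c"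
  where "coord_sum co \<phi> i = (\<Sum>x | \<phi> x \<noteq> 0. \<phi> x * co x i)"

lemma coord_sum_superset:
  "finite S \<Longrightarrow> {x. \<phi> x \<noteq> 0} \<subseteq> S \<Longrightarrow> coord_sum co \<phi> i = (\<Sum>x\<in>S. \<phi> x * co x i)"
  unfolding coord_sum_def by (rule sum.mono_neutral_left) auto

lemma coord_sum_add:
  assumes "finite {x. \<phi> x \<noteq> 0}" "finite {x. \<psi> x \<noteq> 0}"
  shows "coord_sum co (\<lambda>x. \<phi> x + \<psi> x) i = coord_sum co \<phi> i + coord_sum co \<psi> i"
proof -
  let ?S = "{x. \<phi> x \<noteq> 0} \<union> {x. \<psi> x \<noteq> 0}"
  have "finite ?S" using assms by simp
  then show ?thesis
    by (subst (1 2 3) coord_sum_superset [of ?S]) (auto simp: distrib_right sum.distrib)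
qed

lemma coord_sum_scale:
  assumes "finite {x. \<phi> x \<noteq> 0}"
  shows "coord_sum co (\<lambda>x. c * \<phi> x) i = c * coord_sum co \<phi> i"
  by (subst (1 2) coord_sum_superset [OF assms]) (auto simp: sum_distrib_left mult_ac)

lemma single_in_free_module:
  "x \<in> B \<Longrightarrow> single x \<in> carrier (free_module B :: ('c::comm_ring_1, 'b \<Rightarrow> 'c) module)"
proof -
  have "{b. single x b \<noteq> (0 :: 'c)} \<subseteq> {x}" by (auto simp: single_def)
  then show "x \<in> B \<Longrightarrow> single x \<in> carrier (free_module B :: ('c, 'b \<Rightarrow> 'c) module)" by (auto intro: finite_subset)
qed

lemma coord_sum_single: "coord_sum co (single x) i = co x i"
  by (subst coord_sum_superset [of "{x}"]) (auto simp: single_def)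

text \<open>Extended to formal sums, the coordinates \<open>co\<close> give a linear map \<Psi> to
  K^n, and the tensor relations generate exactly its kernel. The last hypothesis builds x from the
  basis by a chain of partial sums, because the relations speak of two summands at a time.\<close>

lemma base_change_vdim:
  fixes h :: "'a::comm_ring_1 \<Rightarrow> 'c::field" and M :: "('a, 'b) module"
  assumes h: "rhom h"
    and closed: "\<And>x y. x \<in> carrier M \<Longrightarrow> y \<in> carrier M \<Longrightarrow> x \<oplus>\<^bsub>M\<^esub> y \<in> carrier M"
      "\<And>a x. x \<in> carrier M \<Longrightarrow> a \<odot>\<^bsub>M\<^esub> x \<in> carrier M"
    and zero: "\<zero>\<^bsub>M\<^esub> \<in> carrier M" "\<zero>\<^bsub>M\<^esub> \<oplus>\<^bsub>M\<^esub> \<zero>\<^bsub>M\<^esub> = \<zero>\<^bsub>M\<^esub>"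
    and co: "\<And>x y i. x \<in> carrier M \<Longrightarrow> y \<in> carrier M \<Longrightarrow> i < n \<Longrightarrow> co (x \<oplus>\<^bsub>M\<^esub> y) i = co x i + co y i"
      "\<And>a x i. x \<in> carrier M \<Longrightarrow> i < n \<Longrightarrow> co (a \<odot>\<^bsub>M\<^esub> x) i = a * co x i"
    and eb: "\<And>i. i < n \<Longrightarrow> eb i \<in> carrier M" "\<And>i j. i < n \<Longrightarrow> j < n \<Longrightarrow> co (eb i) j = (if i = j then 1 else 0)"
    and ex: "\<And>x. x \<in> carrier M \<Longrightarrow> \<exists>s. s 0 = \<zero>\<^bsub>M\<^esub> \<and> s n = x \<and>
      (\<forall>k<n. s k \<in> carrier M \<and> s (Suc k) = s k \<oplus>\<^bsub>M\<^esub> (co x k \<odot>\<^bsub>M\<^esub> eb k))"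
  shows "vdim type_ring (base_change h M) = enat n"
proof -
  let ?FM = "free_module (carrier M) :: ('c, 'b \<Rightarrow> 'c) module"
  define \<Psi> where "\<Psi> = coord_sum (\<lambda>x i. h (co x i))"
  define N0 where "N0 = {\<phi> \<in> carrier ?FM. \<forall>i<n. \<Psi> \<phi> i = 0}"
  define N where "N = \<Inter>{N. submodule N (type_ring :: 'c ring) ?FM \<and> tensor_relations h M \<subseteq> N}"
  interpret FM: module type_ring ?FM by (rule module_free_module)
  have \<Psi>add: "\<Psi> (\<lambda>x. \<phi> x + \<psi> x) i = \<Psi> \<phi> i + \<Psi> \<psi> i" if "\<phi> \<in> carrier ?FM" "\<psi> \<in> carrier ?FM" for \<phi> \<psi> i
    using that by (simp add: \<Psi>_def coord_sum_add)
  have \<Psi>scale: "\<Psi> (\<lambda>x. c * \<phi> x) i = c * \<Psi> \<phi> i" if "\<phi> \<in> carrier ?FM" for \<phi> c i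
    using that by (simp add: \<Psi>_def coord_sum_scale)
  have \<Psi>single: "\<Psi> (single x) i = h (co x i)" for x i
    by (simp add: \<Psi>_def coord_sum_single)
  note fc = free_module_closed [where B = "carrier M" and 'c = 'c]
  have diff: "(\<lambda>b. \<phi> b - \<psi> b) \<in> carrier ?FM" "\<Psi> (\<lambda>b. \<phi> b - \<psi> b) i = \<Psi> \<phi> i - \<Psi> \<psi> i"
    if "\<phi> \<in> carrier ?FM" "\<psi> \<in> carrier ?FM" for \<phi> \<psi> i
  proof -
    have m: "(\<lambda>b. - 1 * \<psi> b) \<in> carrier ?FM" using that(2) by (rule fc)
    have e: "(\<lambda>b. \<phi> b - \<psi> b) = (\<lambda>b. \<phi> b + - 1 * \<psi> b)" by simp
    show "(\<lambda>b. \<phi> b - \<psi> b) \<in> carrier ?FM" unfolding e by (rule fc(1) [OF that(1) m])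
    show "\<Psi> (\<lambda>b. \<phi> b - \<psi> b) i = \<Psi> \<phi> i - \<Psi> \<psi> i"
      unfolding e \<Psi>add [OF that(1) m] \<Psi>scale [OF that(2)] by simp
  qed
  have 0: "(\<lambda>b. 0) \<in> carrier ?FM" "\<Psi> (\<lambda>b. 0) i = 0" for i by (simp_all add: \<Psi>_def coord_sum_def)
  have "submodule N0 type_ring ?FM"
  proof (rule FM.submoduleI)
    show "N0 \<subseteq> carrier ?FM" by (auto simp: N0_def)
    show "\<zero>\<^bsub>?FM\<^esub> \<in> N0" using 0 by (simp add: N0_def)
    show "\<phi> \<oplus>\<^bsub>?FM\<^esub> \<psi> \<in> N0" if "\<phi> \<in> N0" "\<psi> \<in> N0" for \<phi> \<psi>
      using that \<Psi>add fc(1) by (simp add: N0_def del: free_module_simps(1))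
    show sc: "a \<odot>\<^bsub>?FM\<^esub> \<phi> \<in> N0" if "\<phi> \<in> N0" for a \<phi>
      using that \<Psi>scale fc(2) by (simp add: N0_def del: free_module_simps(1))
    show "\<ominus>\<^bsub>?FM\<^esub> \<phi> \<in> N0" if "\<phi> \<in> N0" for \<phi>
    proof -
      have "\<phi> \<in> carrier ?FM" using that by (auto simp: N0_def)
      then have "\<ominus>\<^bsub>?FM\<^esub> \<phi> = (- 1) \<odot>\<^bsub>?FM\<^esub> \<phi>"
        using fc(2) [of \<phi> "- 1"] by (intro FM.minus_equality) simp_all
      then show ?thesis using sc [OF that, of "- 1"] by (simp only:)
    qed
  qed
  moreover have "tensor_relations h M \<subseteq> N0"
  proof -
    have s: "single x \<in> carrier ?FM" if "x \<in> carrier M" for x using that by (rule single_in_free_module)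
    show ?thesis
      unfolding tensor_relations_def N0_def using closed s
      by (auto simp: \<Psi>single co rhomD [OF h] diff fc \<Psi>scale simp del: free_module_simps(1))
  qed
  ultimately have "N \<subseteq> N0" by (auto simp: N_def)
  \<comment> \<open>Modulo the relations each symbol \<open>single x\<close> is a combination of the
    symbols of the basis, so an element with vanishing coordinates is itself a combination of
    relations.\<close>
  moreover have "N0 \<subseteq> N'" if N': "submodule N' type_ring ?FM" "tensor_relations h M \<subseteq> N'" for N'
  proof
    fix \<phi> assume \<phi>: "\<phi> \<in> N0"
    have rel1: "(\<lambda>z. single (x \<oplus>\<^bsub>M\<^esub> y) z - single x z - single y z) \<in> N'" if "x \<in> carrier M" "y \<in> carrier M" for x y
      using that N'(2) unfolding tensor_relations_def by blast
    have rel2: "(\<lambda>z. single (a \<odot>\<^bsub>M\<^esub> x) z - h a * single x z) \<in> N'" if "x \<in> carrier M" for a x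
      using that N'(2) unfolding tensor_relations_def by blast
    have gen: "(\<lambda>z. single x z - (\<Sum>i<n. h (co x i) * single (eb i) z)) \<in> N'" if x: "x \<in> carrier M" for x
    proof -
      obtain s where s: "s 0 = \<zero>\<^bsub>M\<^esub>" "s n = x"
        "\<And>k. k < n \<Longrightarrow> s k \<in> carrier M \<and> s (Suc k) = s k \<oplus>\<^bsub>M\<^esub> (co x k \<odot>\<^bsub>M\<^esub> eb k)" using ex [OF x] by blast
      have "(\<lambda>z. single (s k) z - (\<Sum>i<k. h (co x i) * single (eb i) z)) \<in> N'" if "k \<le> n" for k
        using that
      proof (induction k)
        case 0
        \<comment> \<open>The relation for 0 + 0 = 0 shows that the symbol of zero lies in the
          submodule.\<close>
        have "(\<lambda>z. - 1 * (single (\<zero>\<^bsub>M\<^esub> \<oplus>\<^bsub>M\<^esub> \<zero>\<^bsub>M\<^esub>) z - single \<zero>\<^bsub>M\<^esub> z - single \<zero>\<^bsub>M\<^esub> z)) \<in> N'"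
          by (rule submoduleD(4) [OF N'(1) rel1 [OF zero(1) zero(1)]])
        then show ?case by (simp add: zero s)
      next
        case (Suc k)
        have k: "k < n" using Suc by simp
        have "(\<lambda>z. ((single (s k \<oplus>\<^bsub>M\<^esub> (co x k \<odot>\<^bsub>M\<^esub> eb k)) z - single (s k) z - single (co x k \<odot>\<^bsub>M\<^esub> eb k) z) +
            (single (co x k \<odot>\<^bsub>M\<^esub> eb k) z - h (co x k) * single (eb k) z)) +
            (single (s k) z - (\<Sum>i<k. h (co x i) * single (eb i) z))) \<in> N'"
          using Suc k s(3) [OF k] eb(1) [OF k] closed
          by (intro submoduleD(3) [OF N'(1)] rel1 rel2) auto
        then show ?case using s(3) [OF k] by (simp add: algebra_simps)
      qed
      from this [of n] show ?thesis by (simp add: s)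
    qed
    let ?S = "{x. \<phi> x \<noteq> 0}"
    have fin: "finite ?S" "?S \<subseteq> carrier M" using \<phi> by (auto simp: N0_def)
    have "(\<lambda>z. \<Sum>x\<in>?S. \<phi> x * (single x z - (\<Sum>i<n. h (co x i) * single (eb i) z))) \<in> N'"
      by (rule submodule_sum [OF N'(1)]) (use gen fin in blast)
    also have "(\<lambda>z. \<Sum>x\<in>?S. \<phi> x * (single x z - (\<Sum>i<n. h (co x i) * single (eb i) z))) = \<phi>"
    proof
      fix z
      have "(\<Sum>x\<in>?S. \<phi> x * (\<Sum>i<n. h (co x i) * single (eb i) z)) = (\<Sum>i<n. \<Psi> \<phi> i * single (eb i) z)"
        unfolding \<Psi>_def coord_sum_def sum_distrib_left sum_distrib_right
        by (subst sum.swap) (simp add: mult_ac)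
      also have "\<dots> = 0" using \<phi> by (simp add: N0_def)
      finally have a: "(\<Sum>x\<in>?S. \<phi> x * (\<Sum>i<n. h (co x i) * single (eb i) z)) = 0" .
      have "(\<Sum>x\<in>?S. \<phi> x * single x z) = (\<Sum>x\<in>?S. if z = x then \<phi> x else 0)"
        by (rule sum.cong) (auto simp: single_def)
      also have "\<dots> = \<phi> z" using fin by auto
      finally show "(\<Sum>x\<in>?S. \<phi> x * (single x z - (\<Sum>i<n. h (co x i) * single (eb i) z))) = \<phi> z"
        by (simp add: right_diff_distrib sum_subtractf a)
    qed
    finally show "\<phi> \<in> N'" .
  qed
  then have "N0 \<subseteq> N" by (auto simp: N_def)
  ultimately have N: "N = N0" by blast
  \<comment> \<open>The cosets of the kernel are the fibres of \<Psi>; the module operations on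
    cosets are computed in this form.\<close>
  define fib where "fib \<phi> = {\<chi> \<in> carrier ?FM. \<forall>i<n. \<Psi> \<chi> i = \<Psi> \<phi> i}" for \<phi>
  have coset: "N +>\<^bsub>?FM\<^esub> \<phi> = fib \<phi>" if \<phi>: "\<phi> \<in> carrier ?FM" for \<phi>
  proof (intro Set.set_eqI iffI)
    fix \<chi> assume "\<chi> \<in> N +>\<^bsub>?FM\<^esub> \<phi>"
    then show "\<chi> \<in> fib \<phi>" using \<phi> fc(1) \<Psi>add
      by (auto simp: a_r_coset_def' N N0_def fib_def simp del: free_module_simps(1))
  next
    fix \<chi> assume "\<chi> \<in> fib \<phi>"
    then have "(\<lambda>b. \<chi> b - \<phi> b) \<in> N"
      using diff [of \<chi> \<phi>] \<phi> by (auto simp: N N0_def fib_def simp del: free_module_simps(1))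
    then have "(\<lambda>b. \<chi> b - \<phi> b) \<oplus>\<^bsub>?FM\<^esub> \<phi> \<in> N +>\<^bsub>?FM\<^esub> \<phi>" unfolding a_r_coset_def' by blast
    then show "\<chi> \<in> N +>\<^bsub>?FM\<^esub> \<phi>" by simp
  qed
  let ?V = "base_change h M"
  have V: "?V = quot_module ?FM N" by (simp add: base_change_def N_def)
  have carr: "carrier ?V = fib ` carrier ?FM"
    unfolding V quot_module_def using coset by (auto simp: A_RCOSETS_def' simp flip: a_r_coset_def' simp del: free_module_simps(1))
  have add: "fib \<phi> \<oplus>\<^bsub>?V\<^esub> fib \<psi> = fib (\<lambda>b. \<phi> b + \<psi> b)" if p: "\<phi> \<in> carrier ?FM" "\<psi> \<in> carrier ?FM" for \<phi> \<psi>
  proof -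
    have "set_add ?FM (fib \<phi>) (fib \<psi>) = fib (\<lambda>b. \<phi> b + \<psi> b)"
    proof (intro Set.set_eqI iffI)
      fix \<chi> assume "\<chi> \<in> set_add ?FM (fib \<phi>) (fib \<psi>)"
      then show "\<chi> \<in> fib (\<lambda>b. \<phi> b + \<psi> b)" using p fc(1) \<Psi>add
        by (auto simp: set_add_def' fib_def simp del: free_module_simps(1))
    next
      fix \<chi> assume c: "\<chi> \<in> fib (\<lambda>b. \<phi> b + \<psi> b)"
      then have "(\<lambda>b. \<chi> b - \<phi> b) \<in> fib \<psi>" "\<phi> \<in> fib \<phi>"
        using diff [of \<chi> \<phi>] p \<Psi>add by (auto simp: fib_def simp del: free_module_simps(1))
      then have "\<phi> \<oplus>\<^bsub>?FM\<^esub> (\<lambda>b. \<chi> b - \<phi> b) \<in> set_add ?FM (fib \<phi>) (fib \<psi>)" unfolding set_add_def' by blast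
      then show "\<chi> \<in> set_add ?FM (fib \<phi>) (fib \<psi>)" by simp
    qed
    then show ?thesis by (simp add: V quot_module_def)
  qed
  have smult: "c \<odot>\<^bsub>?V\<^esub> fib \<phi> = fib (\<lambda>b. c * \<phi> b)" if p: "\<phi> \<in> carrier ?FM" for c \<phi>
  proof -
    have "set_add ?FM N ((\<lambda>x. c \<odot>\<^bsub>?FM\<^esub> x) ` fib \<phi>) = fib (\<lambda>b. c * \<phi> b)"
    proof (intro Set.set_eqI iffI)
      fix \<chi> assume "\<chi> \<in> set_add ?FM N ((\<lambda>x. c \<odot>\<^bsub>?FM\<^esub> x) ` fib \<phi>)"
      then show "\<chi> \<in> fib (\<lambda>b. c * \<phi> b)" using p fc \<Psi>add \<Psi>scale
        by (auto simp: set_add_def' fib_def N N0_def simp del: free_module_simps(1))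
    next
      fix \<chi> assume "\<chi> \<in> fib (\<lambda>b. c * \<phi> b)"
      then have "(\<lambda>b. \<chi> b - c * \<phi> b) \<in> N" "\<phi> \<in> fib \<phi>"
        using diff [of \<chi> "\<lambda>b. c * \<phi> b"] p \<Psi>scale fc(2) by (auto simp: fib_def N N0_def simp del: free_module_simps(1))
      then have "(\<lambda>b. \<chi> b - c * \<phi> b) \<oplus>\<^bsub>?FM\<^esub> (c \<odot>\<^bsub>?FM\<^esub> \<phi>)
          \<in> set_add ?FM N ((\<lambda>x. c \<odot>\<^bsub>?FM\<^esub> x) ` fib \<phi>)" unfolding set_add_def' by blast
      then show "\<chi> \<in> set_add ?FM N ((\<lambda>x. c \<odot>\<^bsub>?FM\<^esub> x) ` fib \<phi>)" by simp
    qed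
    then show ?thesis by (simp add: V quot_module_def)
  qed
  have zero': "\<zero>\<^bsub>?V\<^esub> = fib (\<lambda>b. 0)"
    using 0 by (simp add: V quot_module_def N N0_def fib_def)
  define rep where "rep C = (SOME \<chi>. \<chi> \<in> C)" for C :: "('b \<Rightarrow> 'c) set"
  have rep: "\<Psi> (rep (fib \<phi>)) i = \<Psi> \<phi> i" if "\<phi> \<in> carrier ?FM" "i < n" for \<phi> i
  proof -
    have "rep (fib \<phi>) \<in> fib \<phi>" unfolding rep_def by (rule someI [of _ \<phi>]) (use that in \<open>simp add: fib_def\<close>)
    then show ?thesis using that by (simp add: fib_def)
  qed
  have fib_eq: "fib \<phi> = fib \<psi>" if "\<And>i. i < n \<Longrightarrow> \<Psi> \<phi> i = \<Psi> \<psi> i" for \<phi> \<psi>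
    using that by (simp add: fib_def)
  show ?thesis
  proof (rule vdim_coordinates [where \<Psi> = "\<lambda>C. \<Psi> (rep C)"])
    show "abelian_monoid ?V"
    proof (rule abelian_monoidI)
      show "\<zero>\<^bsub>?V\<^esub> \<in> carrier ?V" unfolding zero' carr using 0(1) by blast
    qed (use fc(1) in \<open>auto simp: carr add zero' 0 \<Psi>add add_ac simp del: free_module_simps(1) intro!: fib_eq imageI\<close>)
    show "a \<odot>\<^bsub>?V\<^esub> x \<in> carrier ?V" if "x \<in> carrier ?V" for a x
      using that fc(2) by (auto simp: carr smult simp del: free_module_simps(1))
    show "\<Psi> (rep (x \<oplus>\<^bsub>?V\<^esub> y)) j = \<Psi> (rep x) j + \<Psi> (rep y) j" if "x \<in> carrier ?V" "y \<in> carrier ?V" "j < n" for x y j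
      using that fc(1) \<Psi>add by (auto simp: carr add rep simp del: free_module_simps(1))
    show "\<Psi> (rep (a \<odot>\<^bsub>?V\<^esub> x)) j = a * \<Psi> (rep x) j" if "x \<in> carrier ?V" "j < n" for a x j
      using that fc(2) \<Psi>scale by (auto simp: carr smult rep simp del: free_module_simps(1))
    show "x = y" if "x \<in> carrier ?V" "y \<in> carrier ?V" "\<And>j. j < n \<Longrightarrow> \<Psi> (rep x) j = \<Psi> (rep y) j" for x y
      using that by (auto simp: carr rep simp del: free_module_simps(1) intro!: fib_eq)
    fix c :: "nat \<Rightarrow> 'c"
    have s: "single (eb i) \<in> carrier ?FM" if "i < n" for i using eb(1) [OF that] by (rule single_in_free_module)
    have "\<exists>\<phi>\<in>carrier ?FM. \<forall>i<n. \<Psi> \<phi> i = (if i < k then c i else 0)" if "k \<le> n" for k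
      using that
    proof (induction k)
      case 0
      then show ?case using \<open>(\<lambda>b. 0) \<in> carrier ?FM\<close> \<open>\<And>i. \<Psi> (\<lambda>b. 0) i = 0\<close> by (intro bexI [of _ "\<lambda>b. 0"]) simp_all
    next
      case (Suc k)
      then obtain \<phi> where \<phi>: "\<phi> \<in> carrier ?FM" "\<forall>i<n. \<Psi> \<phi> i = (if i < k then c i else 0)" by auto
      have k: "k < n" using Suc by simp
      have e: "(\<lambda>b. c k * single (eb k) b) \<in> carrier ?FM" by (rule fc(2) [OF s [OF k]])
      show ?case
      proof (intro bexI allI impI)
        fix i assume "i < n"
        then show "\<Psi> (\<lambda>b. \<phi> b + c k * single (eb k) b) i = (if i < Suc k then c i else 0)"
          using \<phi> k by (auto simp: \<Psi>add [OF \<phi>(1) e] \<Psi>scale [OF s [OF k]] \<Psi>single eb(2) rhomD [OF h] less_Suc_eq)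
      qed (rule fc(1) [OF \<phi>(1) e])
    qed
    from this [of n] obtain \<phi> where "\<phi> \<in> carrier ?FM" "\<forall>i<n. \<Psi> \<phi> i = c i" by auto
    then show "\<exists>x\<in>carrier ?V. \<forall>j<n. \<Psi> (rep x) j = c j"
      unfolding carr by (intro bexI [of _ "fib \<phi>"]) (auto simp: rep simp del: free_module_simps(1))
  qed
qed

section \<open>The generic fibre\<close>

context smoothing
begin

text \<open>Representatives of a basis of the special fibre are a k[[t]]-basis of the quotient by
  the determinant, and base change preserves the rank.\<close>

lemma dim_generic_fiber_eq:
  assumes e: "PP_dual_basis m Feq e'" and \<tau>: "\<forall>j<m. \<tau> j \<in> carrier (PP m Feq)"
    and B: "\<And>i j. i < m \<Longrightarrow> j < m \<Longrightarrow> e' i (\<tau> j) = iot (B i j)"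
    and b: "quot_basis (fib_ideal (tdet m B)) n b"
  shows "dim_generic_fiber Feq (degeneracy_ideal m m Feq e' \<tau>) = enat n"
proof -
  let ?J = "degeneracy_ideal m m Feq e' \<tau>" and ?d = "tdet m B"
  let ?E = "OX Feq Quot ?J"
  define \<gamma> where "\<gamma> f = ?J +>\<^bsub>OX Feq\<^esub> iot f" for f
  have sh: "surj_hom \<gamma> ?E {s. ?d dvd s}"
  proof -
    have "{f. iot f \<in> ?J} = {s. ?d dvd s}" by (rule degeneracy_principal [OF e \<tau> B])
    with surj_hom_quot [OF surj_hom_iot ideal_degeneracy(1) [OF e \<tau>]] show ?thesis
      by (simp only: \<gamma>_def [abs_def])
  qed
  note g = surj_homD [OF sh]
  interpret E: cring ?E by (rule g(1))
  let ?M = "quot_kt_module Feq ?J"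
  have M: "carrier ?M = range \<gamma>" "\<zero>\<^bsub>?M\<^esub> = \<gamma> 0" "\<gamma> p \<oplus>\<^bsub>?M\<^esub> \<gamma> q = \<gamma> (p + q)" "a \<odot>\<^bsub>?M\<^esub> \<gamma> p = \<gamma> (kap a * p)" for p q a
  proof -
    have h: "?J +>\<^bsub>OX Feq\<^esub> OX_class Feq (coeff_map const2 a) = \<gamma> (kap a)"
      by (simp add: \<gamma>_def OX_class_eq_iot kap_def)
    show "carrier ?M = range \<gamma>" "\<zero>\<^bsub>?M\<^esub> = \<gamma> 0" "\<gamma> p \<oplus>\<^bsub>?M\<^esub> \<gamma> q = \<gamma> (p + q)" "a \<odot>\<^bsub>?M\<^esub> \<gamma> p = \<gamma> (kap a * p)"
      by (simp_all add: quot_kt_module_def alg_module_def h g(3,4,6) flip: g(8))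
  qed
  note kap = rhomD [OF rhom_kap]
  have "\<exists>c. ?d dvd f - (\<Sum>i<n. kap (c i) * b i)" for f
  proof -
    obtain c h where "f = (\<Sum>i<n. kap (c i) * b i) + ?d * h" using kt_spanning [OF b] by blast
    then have "f - (\<Sum>i<n. kap (c i) * b i) = ?d * h" by simp
    then show ?thesis by (intro exI [of _ c]) simp
  qed
  then obtain C where C: "?d dvd f - (\<Sum>i<n. kap (C f i) * b i)" for f by metis
  define co where "co x = C (SOME f. \<gamma> f = x)" for x
  have coord: "co (\<gamma> f) i = c i" if c: "?d dvd f - (\<Sum>i<n. kap (c i) * b i)" and i: "i < n" for f c i
  proof -
    define f' where "f' = (SOME f'. \<gamma> f' = \<gamma> f)"
    have "\<gamma> f' = \<gamma> f" unfolding f'_def by (rule someI) simp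
    then have f': "?d dvd f' - f" by (simp add: g(9))
    have "?d dvd (f' - (\<Sum>i<n. kap (C f' i) * b i)) - (f' - f) - (f - (\<Sum>i<n. kap (c i) * b i))"
      by (intro dvd_diff C f' c)
    also have "\<dots> = (\<Sum>i<n. kap (c i - C f' i) * b i)"
      by (simp add: kap left_diff_distrib sum_subtractf)
    finally obtain h where "(\<Sum>i<n. kap (c i - C f' i) * b i) = ?d * h" by blast
    from kt_independent [OF b this i] show ?thesis by (simp add: co_def f'_def)
  qed
  have hq: "rhom (\<lambda>g :: 'k fps. to_ac (fps_to_fls g))"
    by (rule rhomI) (simp_all add: fls_times_fps_to_fls)
  show ?thesis unfolding dim_generic_fiber_def
  proof (rule base_change_vdim [OF hq, where co = co and eb = "\<lambda>i. \<gamma> (b i)"])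
    show "x \<oplus>\<^bsub>?M\<^esub> y \<in> carrier ?M" if "x \<in> carrier ?M" "y \<in> carrier ?M" for x y
      using that by (auto simp: M)
    show "a \<odot>\<^bsub>?M\<^esub> x \<in> carrier ?M" if "x \<in> carrier ?M" for a x
      using that by (auto simp: M)
    show "\<zero>\<^bsub>?M\<^esub> \<in> carrier ?M" "\<zero>\<^bsub>?M\<^esub> \<oplus>\<^bsub>?M\<^esub> \<zero>\<^bsub>?M\<^esub> = \<zero>\<^bsub>?M\<^esub>"
      by (simp_all add: M)
    show "\<gamma> (b i) \<in> carrier ?M" for i by (simp add: M)
    fix i assume i: "i < n"
    show "co (x \<oplus>\<^bsub>?M\<^esub> y) i = co x i + co y i" if "x \<in> carrier ?M" "y \<in> carrier ?M" for x y
    proof -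
      from that obtain p q where [simp]: "x = \<gamma> p" "y = \<gamma> q" by (auto simp: M)
      have "?d dvd (p - (\<Sum>i<n. kap (C p i) * b i)) + (q - (\<Sum>i<n. kap (C q i) * b i))"
        by (intro dvd_add C)
      also have "\<dots> = (p + q) - (\<Sum>i<n. kap (C p i + C q i) * b i)"
        by (simp add: kap distrib_right sum.distrib)
      finally have "co (\<gamma> (p + q)) i = C p i + C q i" by (rule coord [OF _ i])
      then show ?thesis by (simp add: M coord [OF C i])
    qed
    show "co (a \<odot>\<^bsub>?M\<^esub> x) i = a * co x i" if "x \<in> carrier ?M" for a x
    proof -
      from that obtain p where [simp]: "x = \<gamma> p" by (auto simp: M)
      have "?d dvd kap a * (p - (\<Sum>i<n. kap (C p i) * b i))" by (intro dvd_mult C)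
      also have "\<dots> = kap a * p - (\<Sum>i<n. kap (a * C p i) * b i)"
        by (simp add: kap right_diff_distrib sum_distrib_left mult_ac)
      finally have "co (\<gamma> (kap a * p)) i = a * C p i" by (rule coord [OF _ i])
      then show ?thesis by (simp add: M coord [OF C i])
    qed
    show "co (\<gamma> (b i)) j = (if i = j then 1 else 0)" if "j < n" for j
    proof (rule coord [OF _ that])
      have "(\<Sum>j<n. kap (if i = j then 1 else 0) * b j) = (\<Sum>j<n. if i = j then b j else 0)"
        by (rule sum.cong) (auto simp: kap)
      then show "?d dvd b i - (\<Sum>j<n. kap (if i = j then 1 else 0) * b j)" using i by simp
    qed
  next
    fix x assume "x \<in> carrier ?M"
    then obtain p where x: "x = \<gamma> p" by (auto simp: M)
    define s where "s k = \<gamma> (\<Sum>i<k. kap (co x i) * b i)" for k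
    have "(\<Sum>i<n. kap (co x i) * b i) = (\<Sum>i<n. kap (C p i) * b i)"
      unfolding x by (intro sum.cong) (auto simp: coord [OF C])
    moreover have "?d dvd - (p - (\<Sum>i<n. kap (C p i) * b i))" using C by (simp only: dvd_minus_iff)
    ultimately have "s n = x" unfolding s_def x by (simp add: g(9))
    moreover have "s 0 = \<zero>\<^bsub>?M\<^esub>" by (simp add: s_def M)
    moreover have "s k \<in> carrier ?M \<and> s (Suc k) = s k \<oplus>\<^bsub>?M\<^esub> (co x k \<odot>\<^bsub>?M\<^esub> \<gamma> (b k))" for k
      by (simp add: s_def M)
    ultimately show "\<exists>s. s 0 = \<zero>\<^bsub>?M\<^esub> \<and> s n = x \<and>
      (\<forall>k<n. s k \<in> carrier ?M \<and> s (Suc k) = s k \<oplus>\<^bsub>?M\<^esub> (co x k \<odot>\<^bsub>?M\<^esub> \<gamma> (b k)))"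
      by (intro exI [of _ s]) simp
  qed
qed

text \<open>Applies to every list with finite special fibre dimension: finiteness makes the
  determinant regular modulo t, and the quotient is then free.\<close>

lemma limiting_dimension:
  assumes e: "PP_dual_basis m Feq e'" and \<tau>: "\<forall>j<m. \<tau> j \<in> carrier (PP m Feq)"
    and n: "dim_k_quot Feq (set_add (OX Feq) (special_fiber_ideal Feq) (degeneracy_ideal m m Feq e' \<tau>)) = enat n"
  shows "dim_generic_fiber Feq (degeneracy_ideal m m Feq e' \<tau>) = enat n"
proof -
  obtain P T where PT: "\<And>i j. i < m \<Longrightarrow> j < m \<Longrightarrow> e' i (\<tau> j) = iot (\<Sum>l<m. P i l * e (bpol m l) (T j))"
    using values_matrix [OF e \<tau>] by blast
  define B where "B i j = (\<Sum>l<m. P i l * e (bpol m l) (T j))" for i j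
  have B: "e' i (\<tau> j) = iot (B i j)" if "i < m" "j < m" for i j using PT that by (simp add: B_def)
  have "colength (fib_ideal (tdet m B)) = enat n"
    using n dim_special_fiber [OF e \<tau>, of B, OF B] by simp
  then obtain b where "quot_basis (fib_ideal (tdet m B)) n b" using colength_attained by blast
  from dim_generic_fiber_eq [OF e \<tau> B this] show ?thesis .
qed

end


section \<open>The parameter space\<close>

lemma poly_functions_line:
  assumes "p \<in> poly_functions 1"
  shows "\<exists>q. \<forall>a. p a = poly q (a 0)"
  using assms
proof (induction rule: poly_functions.induct)
  case (const c)
  show ?case by (rule exI [of _ "[:c:]"]) simp
next
  case (coord i)
  then show ?case by (intro exI [of _ "[:0, 1:]"]) simp
next
  case (add p q)
  then obtain r s where "\<forall>a. p a = poly r (a 0)" "\<forall>a. q a = poly s (a 0)" by blast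
  then show ?case by (intro exI [of _ "r + s"]) simp
next
  case (mult p q)
  then obtain r s where "\<forall>a. p a = poly r (a 0)" "\<forall>a. q a = poly s (a 0)" by blast
  then show ?case by (intro exI [of _ "r * s"]) simp
qed

lemma dense_nonzero:
  "dense_zariski_open 1 {a \<in> affine_space 1. a 0 \<noteq> (0 :: 'k::field_char_0)}"
  unfolding dense_zariski_open_def
proof (intro conjI allI impI)
  show "zariski_open 1 {a \<in> affine_space 1. a 0 \<noteq> (0 :: 'k)}"
    unfolding zariski_open_def
    by (rule exI [of _ "{\<lambda>a. a 0}"]) (auto intro: poly_functions.coord)
next
  fix V :: "(nat \<Rightarrow> 'k) set" assume "zariski_open 1 V \<and> V \<noteq> {}"
  then obtain S a p where S: "S \<subseteq> poly_functions 1" "V = {a \<in> affine_space 1. \<exists>p\<in>S. p a \<noteq> 0}"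
    and p: "p \<in> S" "p a \<noteq> 0" unfolding zariski_open_def by blast
  then obtain q where q: "\<And>a. p a = poly q (a 0)" using poly_functions_line by blast
  have "q \<noteq> 0" using p(2) q by auto
  then have "finite (insert 0 {x. poly q x = 0})" by (simp add: poly_roots_finite)
  \<comment> \<open>An infinite field has an element that is neither 0 nor a root of the polynomial
    describing the open set.\<close>
  then obtain c where c: "c \<notin> insert 0 {x. poly q x = 0}"
    using ex_new_if_finite [OF infinite_UNIV_char_0] by blast
  define a' where "a' = (\<lambda>i\<in>{..<1::nat}. c)"
  have "a' \<in> affine_space 1" by (simp add: a'_def affine_space_def restrict_PiE_iff)
  moreover have "p a' \<noteq> 0" "a' 0 \<noteq> 0" using c by (simp_all add: q a'_def)
  ultimately have "a' \<in> {a \<in> affine_space 1. a 0 \<noteq> 0} \<inter> V" using S(2) p(1) by auto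
  then show "{a \<in> affine_space 1. a 0 \<noteq> 0} \<inter> V \<noteq> {}" by blast
qed

lemma deformation_trivial: "a 0 = 0 \<Longrightarrow> deformation node 1 \<delta> a = fps_const node"
  by (simp add: deformation_def)

lemma deformation_smoothing:
  fixes \<delta> :: "nat \<Rightarrow> 'k::field_char_0 fps fps"
  assumes "cf (\<delta> 0) 0 0 \<noteq> 0" "a 0 \<noteq> 0"
  shows "\<exists>u w v. smoothing u w v \<and> deformation node 1 \<delta> a = smoothing.Feq u"
proof -
  have "cf (const2 (a 0) * \<delta> 0) 0 0 \<noteq> 0" using assms by simp
  from smoothing_exists [OF this] obtain w v where s: "smoothing (const2 (a 0) * \<delta> 0) w v" by blast
  moreover have "deformation node 1 \<delta> a = smoothing.Feq (const2 (a 0) * \<delta> 0)"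
    unfolding smoothing.Feq_def [OF s] by (simp add: deformation_def)
  ultimately show ?thesis by blast
qed

theorem theorem4p0p1:
  fixes \<delta> :: "nat \<Rightarrow> 'k::{alg_closed_field, field_char_0} fps fps" and d :: nat
  assumes "represents_Def1_basis node d \<delta>"
  shows "(\<forall>m\<ge>1. AD_1 node d \<delta> m = enat (m * (m - 1)) \<and>
                 limiting_inflection_number node d \<delta> m (enat (m * (m - 1)))) \<and>
         (\<forall>m\<ge>2. AD_2 node d \<delta> m = enat ((m + 1) choose 4)) \<and>
         (\<forall>m\<ge>1. AD_11 node d \<delta> m = enat ((m + 2) choose 4))"
proof -
  have d: "d = 1" and \<delta>: "cf (\<delta> 0) 0 0 \<noteq> 0" using Def1_node_basis [OF assms] by auto
  let ?F = "deformation node 1 \<delta>"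
  note One_nat_def [simp del]
  note ds = deformation_smoothing [of \<delta>, OF \<delta>]
  \<comment> \<open>A free dual forces a nonzero parameter as soon as m >= 2, so the lower bounds
    only meet smoothings.\<close>
  have sm: "\<exists>u w v. smoothing u w v \<and> ?F a = smoothing.Feq u"
    if "PP_dual_basis m (?F a) e" "m \<ge> 2 \<or> a 0 \<noteq> 0" for m a e
  proof -
    have "a 0 \<noteq> 0"
    proof
      assume "a 0 = 0"
      then have "?F a = fps_const node" by (rule deformation_trivial)
      moreover have "m \<ge> 2" using that(2) \<open>a 0 = 0\<close> by simp
      ultimately show False using that(1) node_dual_not_free [of m e] by (simp only:)
    qed
    then show ?thesis using ds by blast
  qed
  define a1 where "a1 = (\<lambda>i\<in>{..<1::nat}. 1 :: 'k)"
  have a1: "a1 \<in> affine_space 1" "a1 0 \<noteq> 0" by (simp_all add: a1_def affine_space_def restrict_PiE_iff)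
  have lower1: "enat (m * (m - 1)) \<le> dim_1 node 1 \<delta> m a e \<tau>"
    if adm: "admissible node 1 \<delta> m m a e \<tau>" and m: "m \<ge> 1" for m a e \<tau>
  \<comment> \<open>For m = 1 the bound is 0, and the trivial deformation does not have to be
    excluded.\<close>
  proof (cases "m = 1")
    case True
    then show ?thesis by (simp add: zero_enat_def [symmetric])
  next
    case False
    then obtain u w v where s: "smoothing u w v" and F: "?F a = smoothing.Feq u"
      using sm [of m a e] adm m by (auto simp: admissible_def)
    show ?thesis
      using smoothing.dim_special_fiber_lower [OF s m] adm by (simp add: dim_1_def Let_def admissible_def F)
  qed
  have upper1: "\<exists>e \<tau>. admissible node 1 \<delta> m m a e \<tau> \<and> dim_1 node 1 \<delta> m a e \<tau> \<le> enat (m * (m - 1))"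
    if a: "a \<in> affine_space 1" "a 0 \<noteq> 0" and m: "m \<ge> 1" for m a
  proof -
    obtain u w v where s: "smoothing u w v" and F: "?F a = smoothing.Feq u"
      using ds [of a, OF a(2)] by blast
    have "admissible node 1 \<delta> m m a (smoothing.edual u w v m) (\<lambda>j. PP_class m (?F a) (smoothing.tau1 w m j))"
      using a(1) smoothing.edual_basis [OF s m] by (simp add: admissible_def F carrier_PP)
    moreover have "dim_1 node 1 \<delta> m a (smoothing.edual u w v m) (\<lambda>j. PP_class m (?F a) (smoothing.tau1 w m j))
        \<le> enat (m * (m - 1))"
      using smoothing.dim_special_fiber_upper [OF s m] by (simp add: dim_1_def Let_def F)
    ultimately show ?thesis by blast
  qed
  have AD1: "AD_1 node 1 \<delta> m = enat (m * (m - 1))" if m: "m \<ge> 1" for m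
  proof (rule antisym)
    obtain e \<tau> where "admissible node 1 \<delta> m m a1 e \<tau>" "dim_1 node 1 \<delta> m a1 e \<tau> \<le> enat (m * (m - 1))"
      using upper1 [OF a1 m] by blast
    then show "AD_1 node 1 \<delta> m \<le> enat (m * (m - 1))"
      unfolding AD_1_def by (intro Inf_lower2 [of "dim_1 node 1 \<delta> m a1 e \<tau>"]) auto
    show "enat (m * (m - 1)) \<le> AD_1 node 1 \<delta> m"
      unfolding AD_1_def by (rule Inf_greatest) (use lower1 m in auto)
  qed
  have lim: "limiting_inflection_number node 1 \<delta> m (enat (m * (m - 1)))" if m: "m \<ge> 1" for m
    unfolding limiting_inflection_number_def AD1 [OF m] Let_def
  \<comment> \<open>The open set of smoothings: at every parameter other than 0 the term added to xy
    is t times a unit.\<close>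
  proof (intro exI [of _ "{a \<in> affine_space 1. a 0 \<noteq> 0}"] conjI ballI allI impI dense_nonzero)
    fix a :: "nat \<Rightarrow> 'k" assume a: "a \<in> {a \<in> affine_space 1. a 0 \<noteq> 0}"
    then obtain e \<tau> where "admissible node 1 \<delta> m m a e \<tau>" "dim_1 node 1 \<delta> m a e \<tau> \<le> enat (m * (m - 1))"
      using upper1 [of a m] m by blast
    then show "\<exists>e \<tau>. admissible node 1 \<delta> m m a e \<tau> \<and> dim_1 node 1 \<delta> m a e \<tau> = enat (m * (m - 1))"
      using lower1 [of m a e \<tau>] m by (intro exI [of _ e] exI [of _ \<tau>]) auto
    fix e \<tau> assume *: "admissible node 1 \<delta> m m a e \<tau> \<and> dim_1 node 1 \<delta> m a e \<tau> = enat (m * (m - 1))"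
    obtain u w v where s: "smoothing u w v" and F: "?F a = smoothing.Feq u"
      using ds [of a] a by blast
    show "dim_generic_fiber (?F a) (degeneracy_ideal m m (?F a) e \<tau>) = enat (m * (m - 1))"
      using smoothing.limiting_dimension [OF s] * by (simp add: dim_1_def Let_def admissible_def F)
  qed
  have AD2: "AD_2 node 1 \<delta> m = enat ((m + 1) choose 4)" if m: "m \<ge> 2" for m
  proof (rule antisym)
    obtain u w v where s: "smoothing u w v" and F: "?F a1 = smoothing.Feq u"
      using ds [of a1, OF a1(2)] by blast
    have "admissible node 1 \<delta> m (m - 1) a1 (smoothing.edual u w v m) (\<lambda>j. PP_class m (?F a1) (smoothing.tau2 w m j))"
      using a1(1) smoothing.edual_basis [OF s] m by (simp add: admissible_def F carrier_PP)
    then show "AD_2 node 1 \<delta> m \<le> enat ((m + 1) choose 4)"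
      using smoothing.degeneracy_dim_2 [OF s m] unfolding AD_2_def Let_def
      by (intro Inf_lower2 [of "dim_k_quot (?F a1) (degeneracy_ideal m (m - 1) (?F a1) (smoothing.edual u w v m)
        (\<lambda>j. PP_class m (?F a1) (smoothing.tau2 w m j)))"]) (blast, simp add: F)
    have "enat ((m + 1) choose 4) \<le> dim_k_quot (?F a) (degeneracy_ideal m (m - 1) (?F a) e \<tau>)"
      if adm: "admissible node 1 \<delta> m (m - 1) a e \<tau>" for a e \<tau>
    proof -
      obtain u w v where s: "smoothing u w v" and F: "?F a = smoothing.Feq u"
        using sm [of m a e] adm m by (auto simp: admissible_def)
      have r: "min m (m - 1) \<ge> 1" "min m (m - 1) + 2 = m + 1" using m by auto
      show ?thesis
        using smoothing.degeneracy_dim_lower [OF s _ _ r(1), of e \<tau>] adm unfolding r(2)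
        by (simp add: admissible_def F)
    qed
    then show "enat ((m + 1) choose 4) \<le> AD_2 node 1 \<delta> m"
      unfolding AD_2_def Let_def by (intro Inf_greatest) auto
  qed
  have AD11: "AD_11 node 1 \<delta> m = enat ((m + 2) choose 4)" if m: "m \<ge> 1" for m
  proof (rule antisym)
    obtain u w v where s: "smoothing u w v" and F: "?F a1 = smoothing.Feq u"
      using ds [of a1, OF a1(2)] by blast
    have "admissible node 1 \<delta> m (m + 1) a1 (smoothing.edual u w v m) (\<lambda>j. PP_class m (?F a1) (smoothing.tau11 w m j))"
      using a1(1) smoothing.edual_basis [OF s m] by (simp add: admissible_def F carrier_PP)
    then show "AD_11 node 1 \<delta> m \<le> enat ((m + 2) choose 4)"
      using smoothing.degeneracy_dim_11 [OF s m] unfolding AD_11_def Let_def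
      by (intro Inf_lower2 [of "dim_k_quot (?F a1) (degeneracy_ideal m (m + 1) (?F a1) (smoothing.edual u w v m)
        (\<lambda>j. PP_class m (?F a1) (smoothing.tau11 w m j)))"]) (blast, simp add: F)
    have "enat ((m + 2) choose 4) \<le> dim_k_quot (?F a) (degeneracy_ideal m (m + 1) (?F a) e \<tau>)"
      if adm: "admissible node 1 \<delta> m (m + 1) a e \<tau>" for a e \<tau>
    proof (cases "m = 1")
      case True
      then show ?thesis by (simp add: binomial_eq_0 zero_enat_def [symmetric])
    next
      case False
      then obtain u w v where s: "smoothing u w v" and F: "?F a = smoothing.Feq u"
        using sm [of m a e] adm m by (auto simp: admissible_def)
      have r: "min m (m + 1) \<ge> 1" "min m (m + 1) + 2 = m + 2" using m by auto
      show ?thesis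
        using smoothing.degeneracy_dim_lower [OF s _ _ r(1), of e \<tau>] adm unfolding r(2)
        by (simp add: admissible_def F)
    qed
    then show "enat ((m + 2) choose 4) \<le> AD_11 node 1 \<delta> m"
      unfolding AD_11_def Let_def by (intro Inf_greatest) auto
  qed
  show ?thesis unfolding d using AD1 lim AD2 AD11 by blast
qed

end
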